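(* Let $E\subset\mathbb R^2$ be a polygon, and let $W_E$, $V_E$, $\Pi^\nabla$ be as in the context. Let $\mathsf C_1,\mathsf C_2,\mathsf C_3,\mathsf C_4$ be the positive constants (possibly depending on $E$) defined as follows: (A1) $\mathsf C_1=\|\widehat v\|_{L^\infty(E)}$, where $\widehat v\in H^1_0(E)$ satisfies $-\Delta\widehat v=1$ in $E$; (A2) $\mathsf C_2$ is the smallest positive real number such that $\|\Pi^\nabla w\|_{L^\infty(E)}\le\mathsf C_2\|w\|_{L^\infty(\partial E)}$ for all $w\in W_E$; (A3) $\mathsf C_3$ is the smallest positive real number such that $\|\Delta w\|_{L^2(E)}^2\le\mathsf C_3\|\nabla w\|_{L^2(E)}^2$ for all $w\in H^1_0(E)$ with $\Delta w\in\mathbb P_1(E)$; (A4) $\mathsf C_4$ is the smallest positive real number such that $\|q_1\|_{L^\infty(E)}\le\mathsf C_4|E|^{-1/2}\|q_1\|_{L^2(E)}$ for all $q_1\in\mathbb P_1(E)$. Then there is an absolute constant $C$ (independent of $E$ and $v$) such that $$\|v\|_{L^\infty(E)}\le C\,[1+\mathsf C_1\mathsf C_4(1+\mathsf C_2)\mathsf C_3]\,\|v\|_{L^\infty(\partial E)}\qquad\forall v\in V_E.$$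
   Context: $B_{\partial E}$ is the space of continuous functions on $\partial E$ that are affine on each edge of $E$; $\mathbb P_1(E)$ is the space of polynomials of degree $\le1$. The projector $\Pi^\nabla=\Pi^\nabla_E:H^1(E)\to\mathbb P_1(E)$ is defined by $(\nabla(v-\Pi^\nabla v),\nabla q)_{L^2(E)}=0$ for all $q\in\mathbb P_1(E)$ and $\int_{\partial E}(v-\Pi^\nabla v)=0$. The basic virtual space is $W_E=\{w\in H^1(E):w_{|\partial E}\in B_{\partial E},\ \Delta w=0\}$, and the enhanced virtual space is $V_E=\{v\in H^1(E):v_{|\partial E}\in B_{\partial E},\ \Delta v\in\mathbb P_1(E),\ \int_E(v-\Pi^\nabla v)q_1=0\ \forall q_1\in\mathbb P_1(E)\}$. *)

theory Defs
  imports "HOL-Analysis.Analysis" "HOL-Probability.Essential_Supremum"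
begin

section \<open>Lebesgue norms\<close>

definition L2_space :: "'a measure \<Rightarrow> ('a \<Rightarrow> 'b::euclidean_space) set" where
  "L2_space M = {f \<in> borel_measurable M. integrable M (\<lambda>x. (norm (f x))\<^sup>2)}"

definition L2_norm :: "'a measure \<Rightarrow> ('a \<Rightarrow> 'b::euclidean_space) \<Rightarrow> real" where
  "L2_norm M f = sqrt (\<integral>x. (norm (f x))\<^sup>2 \<partial>M)"

text \<open>Extended-real valued, so that an upper bound on the norm includes the claim that the
  function is essentially bounded.\<close>

definition Linf_norm :: "'a measure \<Rightarrow> ('a \<Rightarrow> real) \<Rightarrow> ereal" where
  "Linf_norm M f = esssup M (\<lambda>x. ereal \<bar>f x\<bar>)"


section \<open>Smooth functions and test functions\<close>

text \<open>The coinductive reading gives \<open>C\<^sup>\<infinity>\<close> functions on the whole space: \<open>f\<close> is differentiable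
  everywhere and all its directional derivatives are again smooth.\<close>

coinductive smooth :: "('a::euclidean_space \<Rightarrow> real) \<Rightarrow> bool" where
  "\<lbrakk>\<And>x. (f has_derivative f' x) (at x); \<And>h. smooth (\<lambda>x. f' x h)\<rbrakk> \<Longrightarrow> smooth f"

definition test_functions :: "'a::euclidean_space set \<Rightarrow> ('a \<Rightarrow> real) set" where
  "test_functions E = {\<phi>. smooth \<phi> \<and> (\<exists>K. compact K \<and> K \<subseteq> E \<and> (\<forall>x. x \<notin> K \<longrightarrow> \<phi> x = 0))}"

definition grad :: "('a::euclidean_space \<Rightarrow> real) \<Rightarrow> 'a \<Rightarrow> 'a" where
  "grad f x = (\<Sum>i\<in>Basis. frechet_derivative f (at x) i *\<^sub>R i)"


section \<open>Sobolev spaces\<close>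

text \<open>Elements of Sobolev spaces on an open set \<open>E\<close> are represented by functions on the whole
  space; only their values almost everywhere in \<open>E\<close> matter.\<close>

definition has_weak_gradient ::
    "'a::euclidean_space set \<Rightarrow> ('a \<Rightarrow> real) \<Rightarrow> ('a \<Rightarrow> 'a) \<Rightarrow> bool" where
  "has_weak_gradient E u G \<longleftrightarrow> G \<in> L2_space (lebesgue_on E) \<and>
     (\<forall>\<phi>\<in>test_functions E.
        (\<integral>x. u x *\<^sub>R grad \<phi> x \<partial>lebesgue_on E) = - (\<integral>x. \<phi> x *\<^sub>R G x \<partial>lebesgue_on E))"

definition H1 :: "'a::euclidean_space set \<Rightarrow> ('a \<Rightarrow> real) set" where
  "H1 E = {u \<in> L2_space (lebesgue_on E). \<exists>G. has_weak_gradient E u G}"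

text \<open>A representative of the weak gradient, which is unique up to null sets.\<close>

definition wgrad :: "'a::euclidean_space set \<Rightarrow> ('a \<Rightarrow> real) \<Rightarrow> 'a \<Rightarrow> 'a" where
  "wgrad E u = (SOME G. has_weak_gradient E u G)"

definition H1_norm :: "'a::euclidean_space set \<Rightarrow> ('a \<Rightarrow> real) \<Rightarrow> real" where
  "H1_norm E u = sqrt ((L2_norm (lebesgue_on E) u)\<^sup>2 + (L2_norm (lebesgue_on E) (wgrad E u))\<^sup>2)"

text \<open>The closure of the test functions in \<^term>\<open>H1 E\<close>.\<close>

definition H10 :: "'a::euclidean_space set \<Rightarrow> ('a \<Rightarrow> real) set" where
  "H10 E = {u \<in> H1 E. \<exists>\<phi>. (\<forall>n. \<phi> n \<in> test_functions E) \<and>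
                            (\<lambda>n::nat. H1_norm E (\<lambda>x. \<phi> n x - u x)) \<longlonglongrightarrow> 0}"

text \<open>For \<open>u\<close> in \<^term>\<open>H1 E\<close>: the distributional Laplacian of \<open>u\<close>, that is, the distributional
  divergence of its weak gradient, is the function \<open>f\<close>.\<close>

definition has_weak_laplacian ::
    "'a::euclidean_space set \<Rightarrow> ('a \<Rightarrow> real) \<Rightarrow> ('a \<Rightarrow> real) \<Rightarrow> bool" where
  "has_weak_laplacian E u f \<longleftrightarrow> f \<in> L2_space (lebesgue_on E) \<and>
     (\<forall>\<phi>\<in>test_functions E.
        - (\<integral>x. wgrad E u x \<bullet> grad \<phi> x \<partial>lebesgue_on E) = (\<integral>x. f x * \<phi> x \<partial>lebesgue_on E))"

text \<open>Polynomials of degree at most 1, as functions on the whole space.\<close>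

definition P1 :: "('a::euclidean_space \<Rightarrow> real) set" where
  "P1 = {\<lambda>x. a + b \<bullet> x | a b. True}"


section \<open>Polygons\<close>

text \<open>A polygon is given by the cyclic list of its vertices. Two distinct edges may meet only in
  common end points; consecutive edges are allowed to be collinear.\<close>

type_synonym polygon = "(real^2) list"

definition vert :: "polygon \<Rightarrow> nat \<Rightarrow> real^2" where
  "vert vs i = vs ! (i mod length vs)"

definition edge :: "polygon \<Rightarrow> nat \<Rightarrow> (real^2) set" where
  "edge vs i = closed_segment (vert vs i) (vert vs (Suc i))"

definition simple_polygon :: "polygon \<Rightarrow> bool" where
  "simple_polygon vs \<longleftrightarrow> 3 \<le> length vs \<and> distinct vs \<and>
     (\<forall>i<length vs. \<forall>j<length vs. i \<noteq> j \<longrightarrow>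
        edge vs i \<inter> edge vs j = {vert vs i, vert vs (Suc i)} \<inter> {vert vs j, vert vs (Suc j)})"

definition bdry :: "polygon \<Rightarrow> (real^2) set" where
  "bdry vs = (\<Union>i<length vs. edge vs i)"

text \<open>The open set enclosed by the polygonal curve.\<close>

definition region :: "polygon \<Rightarrow> (real^2) set" where
  "region vs = inside (bdry vs)"

text \<open>Arc length on the boundary: each edge is the image of the unit interval, whose Lebesgue
  measure is scaled by the length of the edge.\<close>

definition bdry_measure :: "polygon \<Rightarrow> (real^2) measure" where
  "bdry_measure vs =
     distr (density (count_space {..<length vs} \<Otimes>\<^sub>M restrict_space lborel {0..1})
                    (\<lambda>(i, t). ennreal (dist (vert vs i) (vert vs (Suc i)))))
           (restrict_space borel (bdry vs))
           (\<lambda>(i, t). linepath (vert vs i) (vert vs (Suc i)) t)"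

text \<open>The trace operator is the continuous extension to \<open>H\<^sup>1\<close> of the restriction to the boundary,
  with values in \<open>L\<^sup>2\<close> of the boundary, from the dense subspace of restrictions of smooth functions
  on the plane. Traces are unique up to null sets of the boundary.\<close>

definition has_trace :: "polygon \<Rightarrow> (real^2 \<Rightarrow> real) \<Rightarrow> (real^2 \<Rightarrow> real) \<Rightarrow> bool" where
  "has_trace vs v g \<longleftrightarrow> v \<in> H1 (region vs) \<and> g \<in> L2_space (bdry_measure vs) \<and>
     (\<exists>\<phi>. (\<forall>n. smooth (\<phi> n)) \<and>
          (\<lambda>n::nat. H1_norm (region vs) (\<lambda>x. \<phi> n x - v x)) \<longlonglongrightarrow> 0 \<and>
          (\<lambda>n. L2_norm (bdry_measure vs) (\<lambda>x. \<phi> n x - g x)) \<longlonglongrightarrow> 0)"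

definition bdry_trace :: "polygon \<Rightarrow> (real^2 \<Rightarrow> real) \<Rightarrow> real^2 \<Rightarrow> real" where
  "bdry_trace vs v = (SOME g. has_trace vs v g)"


section \<open>Virtual element spaces\<close>

definition B_bdry :: "polygon \<Rightarrow> (real^2 \<Rightarrow> real) set" where
  "B_bdry vs = {b. continuous_on (bdry vs) b \<and>
                   (\<forall>i<length vs. \<exists>p\<in>P1. \<forall>x\<in>edge vs i. b x = p x)}"

definition Pi_nabla :: "polygon \<Rightarrow> (real^2 \<Rightarrow> real) \<Rightarrow> real^2 \<Rightarrow> real" where
  "Pi_nabla vs v = (THE p. p \<in> P1 \<and>
     (\<forall>q\<in>P1. (\<integral>x. wgrad (region vs) (\<lambda>x. v x - p x) x \<bullet> wgrad (region vs) q x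
                \<partial>lebesgue_on (region vs)) = 0) \<and>
     (\<integral>x. (bdry_trace vs v x - p x) \<partial>bdry_measure vs) = 0)"

definition W_space :: "polygon \<Rightarrow> (real^2 \<Rightarrow> real) set" where
  "W_space vs = {w \<in> H1 (region vs).
     (\<exists>b\<in>B_bdry vs. has_trace vs w b) \<and>
     has_weak_laplacian (region vs) w (\<lambda>_. 0)}"

definition V_space :: "polygon \<Rightarrow> (real^2 \<Rightarrow> real) set" where
  "V_space vs = {v \<in> H1 (region vs).
     (\<exists>b\<in>B_bdry vs. has_trace vs v b) \<and>
     (\<exists>f\<in>P1. has_weak_laplacian (region vs) v f) \<and>
     (\<forall>q\<in>P1. (\<integral>x. (v x - Pi_nabla vs v x) * q x \<partial>lebesgue_on (region vs)) = 0)}"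

definition smallest_positive :: "(real \<Rightarrow> bool) \<Rightarrow> real \<Rightarrow> bool" where
  "smallest_positive Q c \<longleftrightarrow> 0 < c \<and> Q c \<and> (\<forall>c'. 0 < c' \<and> Q c' \<longrightarrow> c \<le> c')"

end

theory Submission
  imports Defs "HOL-Computational_Algebra.Polynomial"
begin

text \<open>Let \<open>z \<in> H\<^sup>1\<^sub>0\<close> solve \<open>\<Delta> z = \<Delta> v =: f \<in> P1\<close> and put \<open>w = v - z\<close>, the harmonic function with the
  boundary values of \<open>v\<close>; then \<open>\<bar>w\<bar> \<le> M\<close> for \<open>M\<close> the maximum of \<open>\<bar>v\<bar>\<close> on the boundary. The projection sees
  only boundary values, so it agrees on \<open>v\<close> and \<open>w\<close>, and the enhancement constraint gives
  \<open>\<parallel>\<nabla>z\<parallel>\<^sup>2 = - \<integral> z f = \<integral> (w - \<Pi> w) f \<le> (1 + C2) M \<bar>E\<bar>\<^sup>1\<^sup>/\<^sup>2 \<parallel>f\<parallel>\<close>. With (A3) and (A4) this yields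
  \<open>\<bar>f\<bar> \<le> C4 C3 (1 + C2) M\<close>, and comparing \<open>z\<close> with the torsion function bounds \<open>\<bar>z\<bar>\<close> by \<open>C1\<close> times that;
  hence the absolute constant is 1.

  Both pointwise bounds come from one maximum principle for subharmonic \<open>u\<close> with trace at most \<open>M\<close>.
  Truncating with the smooth function \<open>bump t = exp(-1/t)\<close> instead of the positive part makes
  \<open>bump (\<phi> - M)\<close> smooth for smooth \<open>\<phi>\<close>, so no chain rule for weak derivatives is needed. Testing the
  equations of \<open>u\<close> and of the torsion function with the limit of these truncations shows that
  \<open>bump (u - M)\<close> has integral 0. That a function with vanishing trace may serve as a test function is
  shown directly, by cutting off near the edges and vertices.\<close>


section \<open>Smooth functions\<close>

text \<open>The obstacle is that vanishing trace and membership in \<open>H10\<close> are different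
  notions here: the first means being a limit of smooth functions on the plane that become small on
  the boundary, the second being a limit of test functions. A weak equation may be tested with the
  second kind, whereas truncations of \<open>u\<close> supply the first. The edge part of the cutoff
  costs a trace norm times a factor that is not controlled as the strips get thin, plus a bounded
  multiple of the gradient norm; the corner part costs a bounded amount. Everything is multiplied by
  the norm of the tested field near the boundary. Passing to the limit in the truncations before
  thinning the strips removes the uncontrolled term, and thinning the strips then removes the rest.
  The equation of \<open>u\<close> only shows that the truncation has zero gradient. The torsion
  function turns this into vanishing, because its equation expresses the integral of the truncation
  through that gradient. In the final estimate the factor \<bar>E\<bar>^(1/2) from Cauchy-Schwarz
  cancels the \<bar>E\<bar>^(-1/2) of (A4), so only the four constants remain.\<close>

lemma smooth_derivative:
  assumes "smooth f"
  shows "\<exists>f'. (\<forall>x. (f has_derivative f' x) (at x)) \<and> (\<forall>h. smooth (\<lambda>x. f' x h))"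
  using assms by (cases rule: smooth.cases) blast

lemma smooth_const: "smooth (\<lambda>_. c)"
proof -
  have "\<exists>c. f = (\<lambda>_. c) \<Longrightarrow> smooth f" for f :: "'a \<Rightarrow> real"
  proof (coinduction arbitrary: f rule: smooth.coinduct)
    case (smooth f)
    then show ?case by (intro exI[of _ "\<lambda>_ _. 0"] exI[of _ f]) auto
  qed
  then show ?thesis by blast
qed

lemma smooth_bounded_linear: "bounded_linear f \<Longrightarrow> smooth f"
  by (rule smooth.intros[of f "\<lambda>_. f"])
    (auto intro: bounded_linear_imp_has_derivative smooth_const)

text \<open>The algebra generated by the smooth functions is closed under directional derivatives, so
  it is itself contained in the coinductively defined class.\<close>

inductive smooth_gen :: "('a::euclidean_space \<Rightarrow> real) \<Rightarrow> bool" where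
  base: "smooth f \<Longrightarrow> smooth_gen f"
| add: "smooth_gen f \<Longrightarrow> smooth_gen g \<Longrightarrow> smooth_gen (\<lambda>x. f x + g x)"
| mult: "smooth_gen f \<Longrightarrow> smooth_gen g \<Longrightarrow> smooth_gen (\<lambda>x. f x * g x)"
| comp: "smooth (s::real \<Rightarrow> real) \<Longrightarrow> smooth_gen f \<Longrightarrow> smooth_gen (\<lambda>x. s (f x))"
| inv: "smooth_gen f \<Longrightarrow> (\<And>x. f x \<noteq> 0) \<Longrightarrow> smooth_gen (\<lambda>x. inverse (f x))"

lemma smooth_gen_derivative:
  assumes "smooth_gen f"
  shows "\<exists>f'. (\<forall>x. (f has_derivative f' x) (at x)) \<and> (\<forall>h. smooth_gen (\<lambda>x. f' x h))"
  using assms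
proof induction
  case (base f)
  then obtain f' where "\<And>x. (f has_derivative f' x) (at x)" "\<And>h. smooth (\<lambda>x. f' x h)"
    using smooth_derivative by blast
  then show ?case by (intro exI[of _ f']) (auto intro: smooth_gen.base)
next
  case (add f g)
  then obtain f' g' where
    "\<And>x. (f has_derivative f' x) (at x)" "\<And>h. smooth_gen (\<lambda>x. f' x h)"
    "\<And>x. (g has_derivative g' x) (at x)" "\<And>h. smooth_gen (\<lambda>x. g' x h)"
    by blast
  then show ?case
    by (intro exI[of _ "\<lambda>x h. f' x h + g' x h"])
      (auto intro!: smooth_gen.add derivative_eq_intros)
next
  case (mult f g)
  then obtain f' g' where
    "\<And>x. (f has_derivative f' x) (at x)" "\<And>h. smooth_gen (\<lambda>x. f' x h)"
    "\<And>x. (g has_derivative g' x) (at x)" "\<And>h. smooth_gen (\<lambda>x. g' x h)"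
    by blast
  with mult.hyps show ?case
    by (intro exI[of _ "\<lambda>x h. f x * g' x h + f' x h * g x"] conjI allI has_derivative_mult)
      (auto intro!: smooth_gen.add smooth_gen.mult)
next
  case (comp s f)
  then obtain f' where f: "\<And>x. (f has_derivative f' x) (at x)" "\<And>h. smooth_gen (\<lambda>x. f' x h)"
    by blast
  from \<open>smooth s\<close> obtain s' where s: "\<And>x. (s has_derivative s' x) (at x)" "\<And>h. smooth (\<lambda>x. s' x h)"
    using smooth_derivative by blast
  \<comment> \<open>A linear map on the reals is multiplication by its value at 1. This writes the
    chain rule as a product of two functions that belong to the generated class.\<close>
  have lin: "s' t y = s' t 1 * y" for t y
    using linear_cmul[OF has_derivative_linear[OF s(1)], of t y 1] by (simp add: mult.commute)
  show ?case
  proof (intro exI[of _ "\<lambda>x h. s' (f x) (f' x h)"] conjI allI)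
    show "((\<lambda>x. s (f x)) has_derivative (\<lambda>h. s' (f x) (f' x h))) (at x)" for x
      using has_derivative_compose[OF f(1) s(1), of x] .
    show "smooth_gen (\<lambda>x. s' (f x) (f' x h))" for h
      by (subst lin) (intro smooth_gen.mult smooth_gen.comp[of "\<lambda>t. s' t 1"] comp f s)
  qed
next
  case (inv f)
  then obtain f' where f: "\<And>x. (f has_derivative f' x) (at x)" "\<And>h. smooth_gen (\<lambda>x. f' x h)"
    by blast
  show ?case
  proof (intro exI[of _ "\<lambda>x h. - (inverse (f x) * f' x h * inverse (f x))"] conjI allI)
    show "((\<lambda>x. inverse (f x)) has_derivative (\<lambda>h. - (inverse (f x) * f' x h * inverse (f x)))) (at x)" for x
      using Deriv.has_derivative_inverse[OF inv(2) f(1)] .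
    \<comment> \<open>The class is closed under products but has no rule for negation, hence the
      constant factor -1.\<close>
    have "smooth_gen (\<lambda>x. (-1) * (inverse (f x) * f' x h * inverse (f x)))" for h
      by (intro smooth_gen.mult smooth_gen.inv inv f smooth_gen.base smooth_const)
    then show "smooth_gen (\<lambda>x. - (inverse (f x) * f' x h * inverse (f x)))" for h
      by simp
  qed
qed

lemma smooth_gen_imp_smooth: "smooth_gen f \<Longrightarrow> smooth f"
proof (coinduction arbitrary: f rule: smooth.coinduct)
  case (smooth f)
  then show ?case using smooth_gen_derivative by blast
qed

lemma smooth_add: "smooth f \<Longrightarrow> smooth g \<Longrightarrow> smooth (\<lambda>x. f x + g x)"
  by (rule smooth_gen_imp_smooth, rule smooth_gen.add) (simp_all add: smooth_gen.base)

lemma smooth_mult: "smooth f \<Longrightarrow> smooth g \<Longrightarrow> smooth (\<lambda>x. f x * g x)"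
  by (rule smooth_gen_imp_smooth, rule smooth_gen.mult) (simp_all add: smooth_gen.base)

lemma smooth_comp: "smooth (s::real \<Rightarrow> real) \<Longrightarrow> smooth f \<Longrightarrow> smooth (\<lambda>x. s (f x))"
  by (rule smooth_gen_imp_smooth, rule smooth_gen.comp) (simp_all add: smooth_gen.base)

lemma smooth_inverse: "smooth f \<Longrightarrow> (\<And>x. f x \<noteq> 0) \<Longrightarrow> smooth (\<lambda>x. inverse (f x))"
  by (rule smooth_gen_imp_smooth, rule smooth_gen.inv) (simp_all add: smooth_gen.base)

lemma smooth_cmult: "smooth f \<Longrightarrow> smooth (\<lambda>x. c * f x)"
  by (intro smooth_mult smooth_const)

lemma smooth_diff: "smooth f \<Longrightarrow> smooth g \<Longrightarrow> smooth (\<lambda>x. f x - g x)"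
  using smooth_add[of f "\<lambda>x. (-1) * g x"] smooth_cmult[of g "-1"] by simp

lemma smooth_sum: "(\<And>i. i \<in> I \<Longrightarrow> smooth (f i)) \<Longrightarrow> smooth (\<lambda>x. \<Sum>i\<in>I. f i x)"
  by (induction I rule: infinite_finite_induct) (auto intro: smooth_const smooth_add)

lemma smooth_prod: "(\<And>i. i \<in> I \<Longrightarrow> smooth (f i)) \<Longrightarrow> smooth (\<lambda>x. \<Prod>i\<in>I. f i x)"
  by (induction I rule: infinite_finite_induct) (auto intro: smooth_const smooth_mult)

lemma smooth_inner_left: "smooth (\<lambda>x. x \<bullet> a)"
  by (rule smooth_bounded_linear[OF bounded_linear_inner_left])

lemma smooth_inner_diff: "smooth (\<lambda>x. (x - p) \<bullet> a)"
  unfolding inner_diff_left by (intro smooth_diff smooth_inner_left smooth_const)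

lemma smooth_norm_sq: "smooth (\<lambda>x. (norm (x - p))\<^sup>2)"
  unfolding power2_norm_eq_inner
  by (subst euclidean_inner) (intro smooth_sum smooth_mult smooth_inner_diff)

text \<open>The coinductive rule only yields some derivative. Uniqueness identifies it with
  \<open>frechet_derivative\<close>, and linearity reduces it to its values on \<open>Basis\<close>,
  which are the components of \<open>grad\<close>.\<close>

lemma smooth_has_derivative:
  assumes "smooth f" shows "(f has_derivative (\<lambda>h. grad f x \<bullet> h)) (at x)"
proof -
  obtain f' where f': "\<And>x. (f has_derivative f' x) (at x)" "\<And>h. smooth (\<lambda>x. f' x h)"
    using smooth_derivative[OF assms] by blast
  have eq: "frechet_derivative f (at x) = f' x"
    using frechet_derivative_at[OF f'(1)] by simp
  interpret linear "f' x" by (rule has_derivative_linear[OF f'(1)])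
  have "f' x h = grad f x \<bullet> h" for h
  proof -
    have "f' x h = f' x (\<Sum>i\<in>Basis. (h \<bullet> i) *\<^sub>R i)" by (simp add: euclidean_representation)
    also have "\<dots> = grad f x \<bullet> h"
      unfolding grad_def eq by (simp add: sum scale inner_sum_left inner_commute[of h] mult.commute)
    finally show ?thesis .
  qed
  then have "f' x = (\<lambda>h. grad f x \<bullet> h)" by blast
  then show ?thesis using f'(1)[of x] by simp
qed

lemma grad_eqI:
  assumes "(f has_derivative (\<lambda>h. g \<bullet> h)) (at x)" shows "grad f x = g"
  unfolding grad_def frechet_derivative_at[OF assms, symmetric]
  by (rule euclidean_representation)

lemma smooth_grad_inner:
  assumes "smooth f" shows "smooth (\<lambda>x. grad f x \<bullet> h)"
proof -
  obtain f' where f': "\<And>x. (f has_derivative f' x) (at x)" "\<And>h. smooth (\<lambda>x. f' x h)"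
    using smooth_derivative[OF assms] by blast
  have "f' x = (\<lambda>h. grad f x \<bullet> h)" for x
    using has_derivative_unique[OF f'(1) smooth_has_derivative[OF assms]] .
  then show ?thesis using f'(2)[of h] by simp
qed

lemma smooth_continuous: "smooth f \<Longrightarrow> continuous_on A f"
  by (meson continuous_at_imp_continuous_on has_derivative_continuous smooth_has_derivative)

lemma smooth_grad_continuous: "smooth f \<Longrightarrow> continuous_on A (grad f)"
  by (subst continuous_on_componentwise) (auto intro: smooth_continuous smooth_grad_inner)

lemma smooth_borel: "smooth f \<Longrightarrow> f \<in> borel_measurable borel"
  by (intro borel_measurable_continuous_onI smooth_continuous)

lemma smooth_grad_borel: "smooth f \<Longrightarrow> grad f \<in> borel_measurable borel"
  by (intro borel_measurable_continuous_onI smooth_grad_continuous)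

lemma grad_const: "grad (\<lambda>_. c) x = 0"
  by (rule grad_eqI) (auto intro!: derivative_eq_intros)

lemma grad_add: "smooth f \<Longrightarrow> smooth g \<Longrightarrow> grad (\<lambda>x. f x + g x) x = grad f x + grad g x"
  by (rule grad_eqI) (auto intro!: derivative_eq_intros smooth_has_derivative simp: inner_simps)

lemma grad_diff: "smooth f \<Longrightarrow> smooth g \<Longrightarrow> grad (\<lambda>x. f x - g x) x = grad f x - grad g x"
  by (rule grad_eqI) (auto intro!: derivative_eq_intros smooth_has_derivative simp: inner_simps)

lemma grad_cmult: "smooth f \<Longrightarrow> grad (\<lambda>x. c * f x) x = c *\<^sub>R grad f x"
  by (rule grad_eqI) (auto intro!: derivative_eq_intros smooth_has_derivative simp: inner_simps)

lemma grad_mult: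
  "smooth f \<Longrightarrow> smooth g \<Longrightarrow> grad (\<lambda>x. f x * g x) x = f x *\<^sub>R grad g x + g x *\<^sub>R grad f x"
  by (rule grad_eqI)
    (auto intro!: derivative_eq_intros smooth_has_derivative simp: inner_simps algebra_simps)

lemma grad_comp:
  assumes "smooth s" "smooth f"
  shows "grad (\<lambda>x. s (f x)) x = deriv s (f x) *\<^sub>R grad f x"
proof (rule grad_eqI)
  have "(s has_derivative (\<lambda>h. grad s (f x) * h)) (at (f x))"
    using smooth_has_derivative[OF assms(1), of "f x"] by simp
  then have *: "(s has_field_derivative grad s (f x)) (at (f x))"
    by (simp add: has_field_derivative_def)
  have "deriv s (f x) = grad s (f x)" by (rule DERIV_imp_deriv[OF *])
  then show "((\<lambda>x. s (f x)) has_derivative (\<lambda>h. (deriv s (f x) *\<^sub>R grad f x) \<bullet> h)) (at x)"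
    using has_derivative_compose[OF smooth_has_derivative[OF assms(2)] smooth_has_derivative[OF assms(1)], of x]
    by simp
qed

lemma smooth_deriv:
  assumes "smooth (s::real \<Rightarrow> real)" shows "smooth (deriv s)"
proof -
  have "deriv s t = grad s t \<bullet> 1" for t
  proof (rule DERIV_imp_deriv)
    show "(s has_field_derivative grad s t \<bullet> 1) (at t)"
      using smooth_has_derivative[OF assms, of t] by (simp add: has_field_derivative_def)
  qed
  then have "deriv s = (\<lambda>t. grad s t \<bullet> 1)" by blast
  then show ?thesis using smooth_grad_inner[OF assms, of 1] by simp
qed

section \<open>The smooth function exp(-1/t)\<close>

definition bump :: "real \<Rightarrow> real" where
  "bump t = (if t \<le> 0 then 0 else exp (- (1 / t)))"

lemma poly_exp_tendsto: "((\<lambda>u. poly p u * exp (- u)) \<longlongrightarrow> (0::real)) at_top"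
proof -
  have "((\<lambda>u. \<Sum>i\<le>degree p. coeff p i * (u ^ i / exp u)) \<longlongrightarrow> (\<Sum>i\<le>degree p. coeff p i * 0)) at_top"
    by (intro tendsto_sum tendsto_mult tendsto_const tendsto_power_div_exp_0)
  moreover have "(\<Sum>i\<le>degree p. coeff p i * (u ^ i / exp u)) = poly p u * exp (- u)" for u :: real
    by (simp add: poly_altdef sum_distrib_right exp_minus divide_inverse mult.assoc)
  ultimately show ?thesis by simp
qed

text \<open>The functions p(1/t) exp(-1/t), extended by 0, form a family closed under
  differentiation: with u = 1/t the derivative replaces p(u) by u^2 (p(u) - p'(u)). Smoothness of
  \<open>bump\<close> follows by coinduction over this family.\<close>

definition poly_bump :: "real poly \<Rightarrow> real \<Rightarrow> real" where
  "poly_bump p t = (if t \<le> 0 then 0 else poly p (1 / t) * exp (- (1 / t)))"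

lemma DERIV_poly_bump:
  "(poly_bump p has_field_derivative poly_bump ([:0, 0, 1:] * (p - pderiv p)) t) (at t)"
proof -
  consider "t < 0" | "t = 0" | "t > 0" by linarith
  then show ?thesis
  proof cases
    case 1
    have "((\<lambda>_. 0) has_field_derivative 0) (at t)" by simp
    moreover have "\<forall>\<^sub>F x in nhds t. poly_bump p x = 0"
      using eventually_nhds_in_open[of "{..<0}" t] 1
      by (auto elim!: eventually_mono simp: poly_bump_def)
    ultimately show ?thesis
      using 1 by (subst DERIV_cong_ev[OF refl _ refl, where g = "\<lambda>_. 0"]) (auto simp: poly_bump_def)
  next
    case 3
    have "((\<lambda>t. poly p (1 / t) * exp (- (1 / t))) has_field_derivative
        poly (pderiv p) (1 / t) * (- (1 / t\<^sup>2)) * exp (- (1 / t)) + poly p (1 / t) * (exp (- (1 / t)) * (1 / t\<^sup>2))) (at t)"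
      using 3 by (auto intro!: derivative_eq_intros DERIV_chain2[OF poly_DERIV]
          simp: power2_eq_square field_simps)
    moreover have "poly (pderiv p) (1 / t) * (- (1 / t\<^sup>2)) * exp (- (1 / t)) + poly p (1 / t) * (exp (- (1 / t)) * (1 / t\<^sup>2))
       = poly_bump ([:0, 0, 1:] * (p - pderiv p)) t"
      using 3 by (simp add: poly_bump_def field_simps power2_eq_square)
    moreover have "\<forall>\<^sub>F x in nhds t. poly_bump p x = poly p (1 / x) * exp (- (1 / x))"
      using eventually_nhds_in_open[of "{0<..}" t] 3
      by (auto elim!: eventually_mono simp: poly_bump_def)
    ultimately show ?thesis
      by (subst DERIV_cong_ev[OF refl _ refl]) auto
  next
    case 2
    have "((\<lambda>h. poly_bump p h / h) \<longlongrightarrow> 0) (at_right 0)"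
    proof -
      \<comment> \<open>Division by h amounts to multiplying the polynomial by its variable, so the
        right-hand difference quotient at 0 is again a polynomial times a decaying exponential in
        1/h.\<close>
      have "((\<lambda>h. poly ([:0,1:] * p) (inverse h) * exp (- inverse h)) \<longlongrightarrow> 0) (at_right 0)"
        using filterlim_compose[OF poly_exp_tendsto filterlim_inverse_at_top_right] .
      moreover have "\<forall>\<^sub>F h in at_right 0. poly_bump p h / h = poly ([:0,1:] * p) (inverse h) * exp (- inverse h)"
        by (auto simp: eventually_at_right_less eventually_at_filter poly_bump_def inverse_eq_divide)
      ultimately show ?thesis by (simp add: tendsto_cong)
    qed
    moreover have "((\<lambda>h. poly_bump p h / h) \<longlongrightarrow> 0) (at_left 0)"
      by (rule tendsto_eventually) (auto simp: eventually_at_filter poly_bump_def)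
    ultimately have "((\<lambda>h. poly_bump p h / h) \<longlongrightarrow> 0) (at 0)"
      by (simp add: filterlim_split_at)
    then show ?thesis unfolding 2 by (simp add: DERIV_def poly_bump_def)
  qed
qed

lemma smooth_poly_bump: "smooth (poly_bump p)"
proof -
  \<comment> \<open>The factor \<open>c\<close> in the invariant absorbs the direction
    \<open>h\<close>: a directional derivative is the one-dimensional derivative times a
    number.\<close>
  have "\<exists>p c. f = (\<lambda>x. poly_bump p x * c) \<Longrightarrow> smooth f" for f :: "real \<Rightarrow> real"
  proof (coinduction arbitrary: f rule: smooth.coinduct)
    case (smooth f)
    then obtain p c where f: "f = (\<lambda>x. poly_bump p x * c)" by blast
    let ?q = "[:0, 0, 1:] * (p - pderiv p)"
    have "(f has_derivative (\<lambda>h. poly_bump ?q x * (h * c))) (at x)" for x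
    proof -
      have "((\<lambda>x. poly_bump p x * c) has_field_derivative poly_bump ?q x * c) (at x)"
        by (rule DERIV_cmult_right[OF DERIV_poly_bump])
      moreover have "(*) (poly_bump ?q x * c) = (\<lambda>h. poly_bump ?q x * (h * c))"
        by (rule ext) (simp only: ac_simps)
      ultimately show ?thesis
        unfolding f has_field_derivative_def by metis
    qed
    then show ?case
      by (intro exI[of _ f] exI[of _ "\<lambda>x h. poly_bump ?q x * (h * c)"]) blast
  qed
  then have "smooth (\<lambda>x. poly_bump p x * 1)" by blast
  then show ?thesis by simp
qed

lemma bump_eq: "bump = poly_bump 1"
  by (auto simp: bump_def poly_bump_def)

lemma smooth_bump: "smooth bump" unfolding bump_eq by (rule smooth_poly_bump)

lemma deriv_bump: "deriv bump t = (if t \<le> 0 then 0 else (1 / t)\<^sup>2 * exp (- (1 / t)))"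
  unfolding bump_eq by (subst DERIV_imp_deriv[OF DERIV_poly_bump]) (simp add: poly_bump_def power2_eq_square)

lemma bump_range: "0 \<le> bump t" "bump t \<le> 1" by (auto simp: bump_def)

lemma bump_pos: "0 < t \<Longrightarrow> 0 < bump t" by (auto simp: bump_def)

lemma bump_zero: "t \<le> 0 \<Longrightarrow> bump t = 0" by (auto simp: bump_def)

text \<open>Follows from 1/t \<le> exp(1/t). It allows a truncated function to be compared on the
  boundary with its distance from the trace.\<close>

lemma bump_le: "bump t \<le> max t 0"
proof (cases "t \<le> 0")
  case False
  have "1 / t \<le> exp (1 / t)" using exp_ge_add_one_self[of "1/t"] by linarith
  then have "exp (- (1 / t)) \<le> t" using False by (simp add: exp_minus field_simps)
  then show ?thesis using False by (simp add: bump_def)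
qed (simp add: bump_def)

text \<open>The derivative is u^2 exp(-u) with u = 1/t, and exp u dominates its quadratic Taylor
  term u^2/2. The sign makes testing with a truncation a monotone operation; the bound keeps
  truncated gradients in L2.\<close>

lemma deriv_bump_range: "0 \<le> deriv bump t" "deriv bump t \<le> 2"
proof -
  show "0 \<le> deriv bump t" by (simp add: deriv_bump)
  have "u\<^sup>2 \<le> 2 * exp u" if "u \<ge> 0" for u :: real
    using exp_lower_Taylor_quadratic[OF that] that by (simp add: field_simps)
  from this[of "1/t"] show "deriv bump t \<le> 2"
    by (auto simp: deriv_bump exp_minus field_simps)
qed

text \<open>The usual transition from 0 on t \<le> 0 to 1 on t \<ge> 1. The two summands of the
  denominator never vanish together.\<close>

definition smooth_step :: "real \<Rightarrow> real" where
  "smooth_step t = bump t * inverse (bump t + bump (1 - t))"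

lemma bump_sum_pos: "0 < bump t + bump (1 - t)"
  using bump_range[of t] bump_range[of "1 - t"] bump_pos[of t] bump_pos[of "1 - t"]
  by (cases "t > 0") auto

lemma smooth_smooth_step: "smooth smooth_step"
proof -
  have "bump t + bump (1 - t) \<noteq> 0" for t using bump_sum_pos[of t] by simp
  moreover have "smooth (\<lambda>t. bump (1 - t))"
    by (rule smooth_comp[OF smooth_bump])
      (intro smooth_diff smooth_const smooth_bounded_linear bounded_linear_ident)
  ultimately show ?thesis unfolding smooth_step_def[abs_def]
    by (intro smooth_mult smooth_inverse smooth_add smooth_bump)
qed

lemma smooth_step_range: "0 \<le> smooth_step t" "smooth_step t \<le> 1"
  using bump_sum_pos[of t] bump_range(1)[of t] bump_range(1)[of "1 - t"]
  by (auto simp: smooth_step_def field_simps divide_inverse[symmetric])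

lemma smooth_step_0: "t \<le> 0 \<Longrightarrow> smooth_step t = 0"
  by (simp add: smooth_step_def bump_zero)

lemma smooth_step_1: "1 \<le> t \<Longrightarrow> smooth_step t = 1"
  using bump_pos[of t] by (simp add: smooth_step_def bump_zero)

lemma deriv_const_open:
  assumes "open S" "\<And>t. t \<in> S \<Longrightarrow> f t = (c::real)" "t \<in> S"
  shows "deriv f t = 0"
proof (rule DERIV_imp_deriv)
  show "(f has_field_derivative 0) (at t)"
    using DERIV_cong_ev[of t t f "\<lambda>_. c" 0 0] eventually_nhds_in_open[OF assms(1,3)] assms(2)
    by (metis (mono_tags, lifting) DERIV_const eventually_mono)
qed

text \<open>The derivative is continuous on the unit interval and zero outside it. This
  \<open>B\<close> enters all later gradient bounds for cutoffs.\<close>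

lemma smooth_step_deriv_bounded:
  obtains B where "0 \<le> B" "\<And>t. \<bar>deriv smooth_step t\<bar> \<le> B"
proof -
  have "compact (deriv smooth_step ` {0..1})"
    by (intro compact_continuous_image smooth_continuous smooth_deriv smooth_smooth_step) simp
  then have "bounded (deriv smooth_step ` {0..1})" by (rule compact_imp_bounded)
  then obtain B where "\<forall>y\<in>deriv smooth_step ` {0..1}. norm y \<le> B" unfolding bounded_iff ..
  then have B: "\<And>t. t \<in> {0..1} \<Longrightarrow> \<bar>deriv smooth_step t\<bar> \<le> B" by simp
  have "deriv smooth_step t = 0" if "t < 0" for t
    using that by (intro deriv_const_open[of "{..<0}" _ 0]) (auto simp: smooth_step_0)
  moreover have "deriv smooth_step t = 0" if "t > 1" for t
    using that by (intro deriv_const_open[of "{1<..}" _ 1]) (auto simp: smooth_step_1)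
  moreover have "0 \<le> B" using B[of 0] by auto
  ultimately have "\<bar>deriv smooth_step t\<bar> \<le> B" for t
    using B[of t] by (cases "t < 0 \<or> t > 1") auto
  then show ?thesis using that \<open>0 \<le> B\<close> by blast
qed

section \<open>Square integrable functions\<close>

lemma tendsto_zero_bound:
  fixes a b :: "nat \<Rightarrow> real"
  assumes "\<And>n. \<bar>a n\<bar> \<le> b n" "b \<longlonglongrightarrow> 0"
  shows "a \<longlonglongrightarrow> 0"
  by (rule Lim_null_comparison[OF _ assms(2)]) (simp add: assms(1))

lemma L2_norm_nonneg [simp]: "0 \<le> L2_norm M f"
  by (simp add: L2_norm_def)

lemma L2_norm_sq: "(L2_norm M f)\<^sup>2 = (\<integral>x. (norm (f x))\<^sup>2 \<partial>M)"
  by (simp add: L2_norm_def)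

lemma L2_measurable: "f \<in> L2_space M \<Longrightarrow> f \<in> borel_measurable M"
  by (simp add: L2_space_def)

lemma L2_integrable: "f \<in> L2_space M \<Longrightarrow> integrable M (\<lambda>x. (norm (f x))\<^sup>2)"
  by (simp add: L2_space_def)

lemma L2_dominated:
  assumes "f \<in> borel_measurable M" "g \<in> L2_space M" "AE x in M. norm (f x) \<le> norm (g x)"
  shows "f \<in> L2_space M" "L2_norm M f \<le> L2_norm M g"
proof -
  have ae: "AE x in M. (norm (f x))\<^sup>2 \<le> (norm (g x))\<^sup>2"
    using assms(3) by (auto elim!: eventually_mono intro: power_mono)
  show f: "f \<in> L2_space M"
    unfolding L2_space_def using assms(1) ae
    by (auto intro!: Bochner_Integration.integrable_bound[OF L2_integrable[OF assms(2)]])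
  show "L2_norm M f \<le> L2_norm M g"
    unfolding L2_norm_def
    by (intro real_sqrt_le_mono integral_mono_AE L2_integrable f assms(2) ae)
qed

lemma L2_norm_cong_AE:
  assumes "f \<in> borel_measurable M" "g \<in> borel_measurable M" "AE x in M. f x = g x"
  shows "L2_norm M f = L2_norm M g"
proof -
  note [measurable] = assms(1,2)
  have "(\<integral>x. (norm (f x))\<^sup>2 \<partial>M) = (\<integral>x. (norm (g x))\<^sup>2 \<partial>M)"
    using assms(3) by (intro integral_cong_AE) (auto elim: eventually_mono)
  then show ?thesis by (simp add: L2_norm_def)
qed

lemma L2_zero [simp]: "(\<lambda>_. 0) \<in> L2_space M"
  by (simp add: L2_space_def)

lemma L2_scaleR: "f \<in> L2_space M \<Longrightarrow> (\<lambda>x. c *\<^sub>R f x) \<in> L2_space M"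
  by (auto simp: L2_space_def power_mult_distrib)

lemma L2_norm_scaleR: "L2_norm M (\<lambda>x. c *\<^sub>R f x) = \<bar>c\<bar> * L2_norm M f"
  by (simp add: L2_norm_def power_mult_distrib real_sqrt_mult)

lemma L2_minus: "f \<in> L2_space M \<Longrightarrow> (\<lambda>x. - f x) \<in> L2_space M"
  using L2_scaleR[of f M "-1"] by simp

lemma L2_add:
  assumes "f \<in> L2_space M" "g \<in> L2_space M"
  shows "(\<lambda>x. f x + g x) \<in> L2_space M"
  unfolding L2_space_def
proof (intro CollectI conjI)
  show [measurable]: "(\<lambda>x. f x + g x) \<in> borel_measurable M"
    using assms by (intro borel_measurable_add L2_measurable)
  have *: "integrable M (\<lambda>x. 2 * (norm (f x))\<^sup>2 + 2 * (norm (g x))\<^sup>2)"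
    using L2_integrable[OF assms(1)] L2_integrable[OF assms(2)] by simp
  have "(norm (f x + g x))\<^sup>2 \<le> 2 * (norm (f x))\<^sup>2 + 2 * (norm (g x))\<^sup>2" for x
  proof -
    have "(norm (f x + g x))\<^sup>2 \<le> (norm (f x) + norm (g x))\<^sup>2"
      by (intro power_mono norm_triangle_ineq) simp
    also have "\<dots> \<le> 2 * (norm (f x))\<^sup>2 + 2 * (norm (g x))\<^sup>2"
      using sum_squares_bound[of "norm (f x)" "norm (g x)"] by (simp add: power2_sum)
    finally show ?thesis .
  qed
  then show "integrable M (\<lambda>x. (norm (f x + g x))\<^sup>2)"
    by (rule_tac Bochner_Integration.integrable_bound[OF *]) (auto intro!: AE_I2)
qed

lemma L2_diff: "f \<in> L2_space M \<Longrightarrow> g \<in> L2_space M \<Longrightarrow> (\<lambda>x. f x - g x) \<in> L2_space M"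
  using L2_add[of f M "\<lambda>x. - g x"] L2_minus[of g M] by simp

lemma L2_norm_minus: "L2_norm M (\<lambda>x. - f x) = L2_norm M f"
  by (simp add: L2_norm_def)

lemma L2_norm_diff_commute: "L2_norm M (\<lambda>x. f x - g x) = L2_norm M (\<lambda>x. g x - f x)"
  by (simp add: L2_norm_def norm_minus_commute)

lemma L2_norm_of_norm: "L2_norm M (\<lambda>x. norm (f x)) = L2_norm M f"
  by (simp add: L2_norm_def)

lemma L2_of_norm: "f \<in> L2_space M \<Longrightarrow> (\<lambda>x. norm (f x)) \<in> L2_space M"
  by (auto simp: L2_space_def intro!: borel_measurable_norm)

lemma L2_norm_eq_0_AE:
  assumes "f \<in> L2_space M" "L2_norm M f = 0"
  shows "AE x in M. f x = 0"
proof -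
  have "(\<integral>x. (norm (f x))\<^sup>2 \<partial>M) = 0" using assms(2) by (simp add: L2_norm_def)
  then have "AE x in M. (norm (f x))\<^sup>2 = 0"
    using integral_nonneg_eq_0_iff_AE[OF L2_integrable[OF assms(1)]] by simp
  then show ?thesis by (auto elim: eventually_mono)
qed

lemma L2_mult_integrable:
  fixes f g :: "'a \<Rightarrow> real"
  assumes "f \<in> L2_space M" "g \<in> L2_space M"
  shows "integrable M (\<lambda>x. f x * g x)"
proof (rule Bochner_Integration.integrable_bound[where f = "\<lambda>x. (norm (f x))\<^sup>2 + (norm (g x))\<^sup>2"])
  show "AE x in M. norm (f x * g x) \<le> norm ((norm (f x))\<^sup>2 + (norm (g x))\<^sup>2)"
  proof (rule AE_I2)
    fix x
    have "2 * \<bar>f x\<bar> * \<bar>g x\<bar> \<le> \<bar>f x\<bar>\<^sup>2 + \<bar>g x\<bar>\<^sup>2" by (rule sum_squares_bound)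
    moreover have "0 \<le> \<bar>f x\<bar> * \<bar>g x\<bar>" by simp
    ultimately have "\<bar>f x\<bar> * \<bar>g x\<bar> \<le> (f x)\<^sup>2 + (g x)\<^sup>2" unfolding power2_abs by linarith
    then show "norm (f x * g x) \<le> norm ((norm (f x))\<^sup>2 + (norm (g x))\<^sup>2)"
      by (simp add: abs_mult)
  qed
  show "(\<lambda>x. f x * g x) \<in> borel_measurable M"
    using assms by (intro borel_measurable_times L2_measurable)
qed (use assms in \<open>intro Bochner_Integration.integrable_add L2_integrable\<close>)

text \<open>Weighted Young inequality: with a and b the two norms, \<bar>f g\<bar> is at most b/(2a)
  f^2 + a/(2b) g^2, and integrating the right side gives exactly a b. A vanishing norm is treated
  separately, since the product is then zero almost everywhere.\<close>

lemma L2_norm_mult_integral: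
  fixes f g :: "'a \<Rightarrow> real"
  assumes "f \<in> L2_space M" "g \<in> L2_space M"
  shows "(\<integral>x. \<bar>f x * g x\<bar> \<partial>M) \<le> L2_norm M f * L2_norm M g"
proof -
  let ?a = "L2_norm M f" and ?b = "L2_norm M g"
  consider "?a = 0" | "?b = 0" | "?a > 0" "?b > 0" using L2_norm_nonneg[of M f] L2_norm_nonneg[of M g] by linarith
  then show ?thesis
  proof cases
    case 1
    then have "AE x in M. \<bar>f x * g x\<bar> = 0"
      using L2_norm_eq_0_AE[OF assms(1)] by (auto elim: eventually_mono)
    then have "(\<integral>x. \<bar>f x * g x\<bar> \<partial>M) = 0" by (rule integral_eq_zero_AE)
    then show ?thesis by simp
  next
    case 2
    then have "AE x in M. \<bar>f x * g x\<bar> = 0"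
      using L2_norm_eq_0_AE[OF assms(2)] by (auto elim: eventually_mono)
    then have "(\<integral>x. \<bar>f x * g x\<bar> \<partial>M) = 0" by (rule integral_eq_zero_AE)
    then show ?thesis by simp
  next
    case 3
    have "(\<integral>x. \<bar>f x * g x\<bar> \<partial>M) \<le> (\<integral>x. (?b / (2 * ?a)) * (norm (f x))\<^sup>2 + (?a / (2 * ?b)) * (norm (g x))\<^sup>2 \<partial>M)"
    proof (rule integral_mono)
      show "\<bar>f x * g x\<bar> \<le> (?b / (2 * ?a)) * (norm (f x))\<^sup>2 + (?a / (2 * ?b)) * (norm (g x))\<^sup>2" for x
      proof -
        have "2 * (?b * \<bar>f x\<bar>) * (?a * \<bar>g x\<bar>) \<le> (?b * \<bar>f x\<bar>)\<^sup>2 + (?a * \<bar>g x\<bar>)\<^sup>2"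
          by (rule sum_squares_bound)
        then have "\<bar>f x * g x\<bar> * (2 * ?a * ?b) \<le> (?b * \<bar>f x\<bar>)\<^sup>2 + (?a * \<bar>g x\<bar>)\<^sup>2"
          by (simp add: abs_mult ac_simps)
        then have "\<bar>f x * g x\<bar> \<le> ((?b * \<bar>f x\<bar>)\<^sup>2 + (?a * \<bar>g x\<bar>)\<^sup>2) / (2 * ?a * ?b)"
          using 3 by (subst pos_le_divide_eq) auto
        also have "\<dots> = (?b / (2 * ?a)) * (norm (f x))\<^sup>2 + (?a / (2 * ?b)) * (norm (g x))\<^sup>2"
          using 3 by (simp add: field_simps power2_eq_square)
        finally show ?thesis .
      qed
      show "integrable M (\<lambda>x. \<bar>f x * g x\<bar>)"
        by (intro integrable_abs L2_mult_integrable assms)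
      show "integrable M (\<lambda>x. ?b / (2 * ?a) * (norm (f x))\<^sup>2 + ?a / (2 * ?b) * (norm (g x))\<^sup>2)"
        by (rule Bochner_Integration.integrable_add; rule integrable_mult_right; rule L2_integrable[OF assms(1)] L2_integrable[OF assms(2)])
    qed
    also have "\<dots> = (?b / (2 * ?a)) * ?a\<^sup>2 + (?a / (2 * ?b)) * ?b\<^sup>2"
      using L2_integrable[OF assms(1)] L2_integrable[OF assms(2)]
      by (subst Bochner_Integration.integral_add) (auto simp: L2_norm_sq)
    also have "\<dots> = ?a * ?b" using 3 by (simp add: field_simps power2_eq_square)
    finally show ?thesis .
  qed
qed

lemma L2_inner_integrable:
  assumes "f \<in> L2_space M" "g \<in> L2_space M"
  shows "integrable M (\<lambda>x. f x \<bullet> g x)"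
proof (rule Bochner_Integration.integrable_bound)
  show "integrable M (\<lambda>x. norm (f x) * norm (g x))"
    by (intro L2_mult_integrable L2_of_norm assms)
  show "(\<lambda>x. f x \<bullet> g x) \<in> borel_measurable M"
    using assms by (intro borel_measurable_inner L2_measurable)
qed (simp add: Cauchy_Schwarz_ineq2)

lemma L2_Cauchy_Schwarz:
  assumes "f \<in> L2_space M" "g \<in> L2_space M"
  shows "\<bar>\<integral>x. f x \<bullet> g x \<partial>M\<bar> \<le> L2_norm M f * L2_norm M g"
proof -
  have "\<bar>\<integral>x. f x \<bullet> g x \<partial>M\<bar> \<le> (\<integral>x. \<bar>f x \<bullet> g x\<bar> \<partial>M)" by (rule integral_abs_bound)
  also have "\<dots> \<le> (\<integral>x. \<bar>norm (f x) * norm (g x)\<bar> \<partial>M)"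
    using L2_mult_integrable[OF L2_of_norm[OF assms(1)] L2_of_norm[OF assms(2)]]
    by (intro integral_mono integrable_abs L2_inner_integrable assms) (auto simp: Cauchy_Schwarz_ineq2)
  also have "\<dots> \<le> L2_norm M f * L2_norm M g"
    using L2_norm_mult_integral[OF L2_of_norm[OF assms(1)] L2_of_norm[OF assms(2)]]
    by (simp add: L2_norm_of_norm)
  finally show ?thesis .
qed

lemma L2_norm_add_sq:
  assumes "f \<in> L2_space M" "g \<in> L2_space M"
  shows "(L2_norm M (\<lambda>x. f x + g x))\<^sup>2 = (L2_norm M f)\<^sup>2 + 2 * (\<integral>x. f x \<bullet> g x \<partial>M) + (L2_norm M g)\<^sup>2"
proof -
  have "(L2_norm M (\<lambda>x. f x + g x))\<^sup>2 = (\<integral>x. (norm (f x))\<^sup>2 + 2 * (f x \<bullet> g x) + (norm (g x))\<^sup>2 \<partial>M)"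
    by (simp add: L2_norm_sq power2_norm_eq_inner inner_simps inner_commute algebra_simps)
  also have "\<dots> = (\<integral>x. (norm (f x))\<^sup>2 \<partial>M) + 2 * (\<integral>x. f x \<bullet> g x \<partial>M) + (\<integral>x. (norm (g x))\<^sup>2 \<partial>M)"
    using L2_integrable[OF assms(1)] L2_integrable[OF assms(2)] L2_inner_integrable[OF assms]
    by simp
  finally show ?thesis by (simp add: L2_norm_sq)
qed

lemma L2_triangle:
  assumes "f \<in> L2_space M" "g \<in> L2_space M"
  shows "L2_norm M (\<lambda>x. f x + g x) \<le> L2_norm M f + L2_norm M g"
proof (rule power2_le_imp_le)
  show "(L2_norm M (\<lambda>x. f x + g x))\<^sup>2 \<le> (L2_norm M f + L2_norm M g)\<^sup>2"
    unfolding L2_norm_add_sq[OF assms] using L2_Cauchy_Schwarz[OF assms]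
    by (simp add: power2_sum)
qed simp

lemma L2_triangle_diff:
  assumes "f \<in> L2_space M" "g \<in> L2_space M" "h \<in> L2_space M"
  shows "L2_norm M (\<lambda>x. f x - h x) \<le> L2_norm M (\<lambda>x. f x - g x) + L2_norm M (\<lambda>x. g x - h x)"
  using L2_triangle[OF L2_diff[OF assms(1,2)] L2_diff[OF assms(2,3)]] by simp

lemma L2_norm_tendsto:
  assumes "\<And>n. f n \<in> L2_space M" "g \<in> L2_space M" "(\<lambda>n. L2_norm M (\<lambda>x. f n x - g x)) \<longlonglongrightarrow> 0"
  shows "(\<lambda>n. L2_norm M (f n)) \<longlonglongrightarrow> L2_norm M g"
proof -
  have "\<bar>L2_norm M (f n) - L2_norm M g\<bar> \<le> L2_norm M (\<lambda>x. f n x - g x)" for n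
    using L2_triangle_diff[OF assms(1)[of n] assms(2) L2_zero] L2_triangle_diff[OF assms(2) assms(1)[of n] L2_zero]
    by (simp add: L2_norm_diff_commute[of M g])
  then have "(\<lambda>n. L2_norm M (f n) - L2_norm M g) \<longlonglongrightarrow> 0"
    using assms(3) by (rule tendsto_zero_bound)
  then show ?thesis by (simp add: LIM_zero_iff)
qed

lemma L2_inner_tendsto:
  assumes "\<And>n. f n \<in> L2_space M" "g \<in> L2_space M" "(\<lambda>n. L2_norm M (\<lambda>x. f n x - g x)) \<longlonglongrightarrow> 0"
    "h \<in> L2_space M"
  shows "(\<lambda>n. \<integral>x. h x \<bullet> f n x \<partial>M) \<longlonglongrightarrow> (\<integral>x. h x \<bullet> g x \<partial>M)"
proof -
  have "\<bar>(\<integral>x. h x \<bullet> f n x \<partial>M) - (\<integral>x. h x \<bullet> g x \<partial>M)\<bar> \<le> L2_norm M h * L2_norm M (\<lambda>x. f n x - g x)" for n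
    using L2_Cauchy_Schwarz[OF assms(4) L2_diff[OF assms(1)[of n] assms(2)]]
      L2_inner_integrable[OF assms(4) assms(1)[of n]] L2_inner_integrable[OF assms(4,2)]
    by (simp add: inner_simps)
  moreover have "(\<lambda>n. L2_norm M h * L2_norm M (\<lambda>x. f n x - g x)) \<longlonglongrightarrow> 0"
    using tendsto_mult_right_zero[OF assms(3)] .
  ultimately have "(\<lambda>n. (\<integral>x. h x \<bullet> f n x \<partial>M) - (\<integral>x. h x \<bullet> g x \<partial>M)) \<longlonglongrightarrow> 0"
    by (rule tendsto_zero_bound)
  then show ?thesis by (simp add: LIM_zero_iff)
qed

lemma L2_bounded_scaleR:
  assumes "b \<in> borel_measurable M" "f \<in> L2_space M" "\<And>x. \<bar>b x\<bar> \<le> B"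
  shows "(\<lambda>x. b x *\<^sub>R f x) \<in> L2_space M" "L2_norm M (\<lambda>x. b x *\<^sub>R f x) \<le> B * L2_norm M f"
proof -
  have m: "(\<lambda>x. b x *\<^sub>R f x) \<in> borel_measurable M"
    using assms(1) L2_measurable[OF assms(2)] by (rule borel_measurable_scaleR)
  have B: "0 \<le> B" using assms(3)[of undefined] by simp
  have "norm (b x *\<^sub>R f x) \<le> norm (B *\<^sub>R f x)" for x
    using assms(3)[of x] B by (simp add: mult_right_mono)
  then have ae: "AE x in M. norm (b x *\<^sub>R f x) \<le> norm (B *\<^sub>R f x)" by simp
  show "(\<lambda>x. b x *\<^sub>R f x) \<in> L2_space M"
    by (rule L2_dominated(1)[OF m L2_scaleR[OF assms(2)] ae])
  show "L2_norm M (\<lambda>x. b x *\<^sub>R f x) \<le> B * L2_norm M f"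
    using L2_dominated(2)[OF m L2_scaleR[OF assms(2)] ae] B by (simp add: L2_norm_scaleR)
qed

lemma L2_bounded:
  assumes "finite_measure M" "f \<in> borel_measurable M" "AE x in M. norm (f x) \<le> B"
  shows "f \<in> L2_space M" "L2_norm M f \<le> sqrt (measure M (space M)) * \<bar>B\<bar>"
proof -
  interpret finite_measure M by fact
  have "(\<lambda>_. B) \<in> L2_space M" by (simp add: L2_space_def)
  moreover have "AE x in M. norm (f x) \<le> norm B"
    using assms(3) by (auto elim: eventually_mono)
  moreover have "L2_norm M (\<lambda>_. B) = sqrt (measure M (space M)) * \<bar>B\<bar>"
    by (simp add: L2_norm_def real_sqrt_mult)
  ultimately show "f \<in> L2_space M" "L2_norm M f \<le> sqrt (measure M (space M)) * \<bar>B\<bar>"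
    using L2_dominated[OF assms(2), of "\<lambda>_. B"] by auto
qed

lemma L2_imp_integrable:
  assumes "finite_measure M" "f \<in> L2_space M" shows "integrable M f"
proof -
  interpret finite_measure M by fact
  have "integrable M (\<lambda>x. norm (f x) * 1)"
    by (rule L2_mult_integrable[OF L2_of_norm[OF assms(2)]]) (simp add: L2_space_def)
  then show ?thesis using L2_measurable[OF assms(2)] by (simp add: integrable_norm_iff)
qed

text \<open>Lets a function and its gradient be treated as one vector-valued function, so that a
  single appeal to completeness produces both limits.\<close>

lemma L2_Pair:
  assumes "f \<in> L2_space M" "g \<in> L2_space M"
  shows "(\<lambda>x. (f x, g x)) \<in> L2_space M"
    "(L2_norm M (\<lambda>x. (f x, g x)))\<^sup>2 = (L2_norm M f)\<^sup>2 + (L2_norm M g)\<^sup>2"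
proof -
  have eq: "(norm (f x, g x))\<^sup>2 = (norm (f x))\<^sup>2 + (norm (g x))\<^sup>2" for x
    by (simp add: norm_Pair)
  have [measurable]: "f \<in> borel_measurable M" "g \<in> borel_measurable M"
    using assms by (auto intro: L2_measurable)
  have "(\<lambda>x. (f x, g x)) \<in> borel_measurable M" by measurable
  then show "(\<lambda>x. (f x, g x)) \<in> L2_space M"
    using L2_integrable[OF assms(1)] L2_integrable[OF assms(2)]
    unfolding L2_space_def by (simp add: eq)
  show "(L2_norm M (\<lambda>x. (f x, g x)))\<^sup>2 = (L2_norm M f)\<^sup>2 + (L2_norm M g)\<^sup>2"
    unfolding L2_norm_sq eq using L2_integrable[OF assms(1)] L2_integrable[OF assms(2)] by simp
qed

lemma L2_AE_subseq:
  assumes "\<And>n. f n \<in> L2_space M" "g \<in> L2_space M" "(\<lambda>n. L2_norm M (\<lambda>x. f n x - g x)) \<longlonglongrightarrow> 0"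
  shows "\<exists>r. strict_mono r \<and> (AE x in M. (\<lambda>n. f (r n) x) \<longlonglongrightarrow> g x)"
proof -
  have "(\<lambda>n. (L2_norm M (\<lambda>x. f n x - g x))\<^sup>2) \<longlonglongrightarrow> 0\<^sup>2" by (intro tendsto_power assms(3))
  then have "(\<lambda>n. \<integral>x. norm ((norm (f n x - g x))\<^sup>2) \<partial>M) \<longlonglongrightarrow> 0"
    by (simp add: L2_norm_sq)
  then obtain r where r: "strict_mono r" "AE x in M. (\<lambda>n. (norm (f (r n) x - g x))\<^sup>2) \<longlonglongrightarrow> 0"
    using tendsto_L1_AE_subseq[of M "\<lambda>n x. (norm (f n x - g x))\<^sup>2"] L2_integrable[OF L2_diff[OF assms(1,2)]]
    by blast
  have "(\<lambda>n. f (r n) x) \<longlonglongrightarrow> g x" if "(\<lambda>n. (norm (f (r n) x - g x))\<^sup>2) \<longlonglongrightarrow> 0" for x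
    using that by (simp add: tendsto_norm_zero_iff LIM_zero_iff)
  with r show ?thesis by (metis (mono_tags, lifting) eventually_mono)
qed

text \<open>The bound assumed for the sequence passes to the almost everywhere limit, so the
  difference is at most twice \<open>g\<close> in norm; this is the origin of the factor 4 in the
  dominating function.\<close>

lemma L2_dominated_convergence:
  assumes "f \<in> borel_measurable M" "\<And>n. b n \<in> borel_measurable M" "g \<in> L2_space M"
    "\<And>n x. norm (b n x) \<le> norm (g x)" "AE x in M. (\<lambda>n. b n x) \<longlonglongrightarrow> f x"
  shows "(\<lambda>n. L2_norm M (\<lambda>x. b n x - f x)) \<longlonglongrightarrow> 0"
proof -
  have [measurable]: "f \<in> borel_measurable M" "\<And>n. b n \<in> borel_measurable M" by fact+
  have "(\<lambda>n. \<integral>x. (norm (b n x - f x))\<^sup>2 \<partial>M) \<longlonglongrightarrow> (\<integral>x. 0 \<partial>M)"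
  proof (rule integral_dominated_convergence[where w = "\<lambda>x. 4 * (norm (g x))\<^sup>2"])
    show "AE x in M. (\<lambda>n. (norm (b n x - f x))\<^sup>2) \<longlonglongrightarrow> 0"
      using assms(5)
    proof eventually_elim
      case (elim x)
      then have "(\<lambda>n. (norm (b n x - f x))\<^sup>2) \<longlonglongrightarrow> (norm (f x - f x))\<^sup>2"
        by (intro tendsto_intros)
      then show ?case by simp
    qed
    show "AE x in M. norm ((norm (b n x - f x))\<^sup>2) \<le> 4 * (norm (g x))\<^sup>2" for n
      using assms(5)
    proof eventually_elim
      case (elim x)
      have "norm (f x) \<le> norm (g x)"
        by (rule Lim_bounded[OF tendsto_norm[OF elim]]) (use assms(4) in auto)
      then have "norm (b n x - f x) \<le> 2 * norm (g x)"
        using norm_triangle_ineq4[of "b n x" "f x"] assms(4)[of n x] by linarith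
      then have "(norm (b n x - f x))\<^sup>2 \<le> (2 * norm (g x))\<^sup>2" by (intro power_mono) auto
      then show ?case by (simp add: power_mult_distrib)
    qed
  qed (use assms(3) in \<open>auto intro!: L2_integrable\<close>)
  then have "(\<lambda>n. sqrt (\<integral>x. (norm (b n x - f x))\<^sup>2 \<partial>M)) \<longlonglongrightarrow> sqrt 0"
    by (intro tendsto_real_sqrt) simp
  then show ?thesis by (simp add: L2_norm_def)
qed

text \<open>Riesz-Fischer: a subsequence with geometrically small increments converges almost
  everywhere, and Fatou's lemma carries the Cauchy estimate over to the limit.\<close>

lemma L2_complete:
  fixes f :: "nat \<Rightarrow> 'a \<Rightarrow> 'b::euclidean_space"
  assumes "finite_measure M" and f: "\<And>n. f n \<in> L2_space M"
    and Cauchy: "\<And>e. e > 0 \<Longrightarrow> \<exists>N. \<forall>m\<ge>N. \<forall>n\<ge>N. L2_norm M (\<lambda>x. f m x - f n x) < e"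
  shows "\<exists>g\<in>L2_space M. (\<lambda>n. L2_norm M (\<lambda>x. f n x - g x)) \<longlonglongrightarrow> 0"
proof -
  interpret finite_measure M by fact
  have [measurable]: "\<And>n. f n \<in> borel_measurable M" using f by (auto intro: L2_measurable)
  have "\<exists>N. \<forall>k. \<forall>m\<ge>N k. \<forall>n\<ge>N k. L2_norm M (\<lambda>x. f m x - f n x) < (1/2)^k"
    using Cauchy by (intro choice) simp
  then obtain N where N: "\<And>k m n. m \<ge> N k \<Longrightarrow> n \<ge> N k \<Longrightarrow> L2_norm M (\<lambda>x. f m x - f n x) < (1/2)^k"
    by blast
  \<comment> \<open>The maximum makes the index sequence monotone while keeping it above each
    threshold \<open>N k\<close>.\<close>
  define r where "r k = Max (N ` {..k})" for k
  have rN: "N k \<le> r k" and rmono: "r k \<le> r (Suc k)" for k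
    by (auto simp: r_def intro!: Max_ge Max_mono)
  have fast: "L2_norm M (\<lambda>x. f (r (Suc k)) x - f (r k) x) \<le> (1/2)^k" for k
    using N[of k "r (Suc k)" "r k"] rN[of k] rmono[of k] by simp
  define d where "d k x = norm (f (r (Suc k)) x - f (r k) x)" for k x
  have dL2: "d k \<in> L2_space M" "L2_norm M (d k) \<le> (1/2)^k" for k
    using fast[of k] L2_of_norm[OF L2_diff[OF f f]] by (auto simp: d_def[abs_def] L2_norm_of_norm)
  have dint: "integrable M (d k)" for k using L2_imp_integrable[OF _ dL2(1)] by (simp add: finite_measure_axioms)
  \<comment> \<open>Cauchy-Schwarz against the constant 1, which is square integrable because the
    measure is finite, turns the L2 rate into an L1 rate. Hence the increments are summable almost
    everywhere.\<close>
  have dI: "(\<integral>x. d k x \<partial>M) \<le> (1/2)^k * L2_norm M (\<lambda>_. 1::real)" for k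
  proof -
    have "(\<integral>x. d k x \<partial>M) \<le> \<bar>\<integral>x. d k x \<bullet> 1 \<partial>M\<bar>" by simp
    also have "\<dots> \<le> L2_norm M (d k) * L2_norm M (\<lambda>_. 1::real)"
      by (rule L2_Cauchy_Schwarz[OF dL2(1)]) (simp add: L2_space_def)
    also have "\<dots> \<le> (1/2)^k * L2_norm M (\<lambda>_. 1::real)"
      by (intro mult_right_mono dL2) auto
    finally show ?thesis .
  qed
  have "AE x in M. summable (\<lambda>k. d k x)"
  proof -
    have "(\<integral>\<^sup>+x. (\<Sum>k. ennreal (d k x)) \<partial>M) = (\<Sum>k. \<integral>\<^sup>+x. ennreal (d k x) \<partial>M)"
      by (rule nn_integral_suminf) (auto simp: d_def[abs_def])
    also have "\<dots> = (\<Sum>k. ennreal (\<integral>x. d k x \<partial>M))"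
      by (intro suminf_cong nn_integral_eq_integral dint) (auto simp: d_def)
    also have "\<dots> \<le> (\<Sum>k. ennreal ((1/2)^k * L2_norm M (\<lambda>_. 1::real)))"
      by (intro suminf_le ennreal_leI dI) auto
    also have "\<dots> = ennreal (\<Sum>k. (1/2)^k * L2_norm M (\<lambda>_. 1::real))"
      by (intro suminf_ennreal2 summable_mult2 summable_geometric) auto
    finally have "(\<integral>\<^sup>+x. (\<Sum>k. ennreal (d k x)) \<partial>M) \<noteq> \<infinity>"
      by (auto simp: top_unique)
    then have "AE x in M. (\<Sum>k. ennreal (d k x)) \<noteq> \<infinity>"
      by (intro nn_integral_PInf_AE) (auto simp: d_def[abs_def])
    then show ?thesis
      by eventually_elim (auto intro: summable_suminf_not_top simp: d_def)
  qed
  then have AEconv: "AE x in M. convergent (\<lambda>k. f (r k) x)"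
  proof eventually_elim
    case (elim x)
    then have "summable (\<lambda>k. f (r (Suc k)) x - f (r k) x)"
      unfolding d_def by (rule summable_norm_cancel)
    then have "convergent (\<lambda>n. \<Sum>k<n. f (r (Suc k)) x - f (r k) x)"
      by (simp add: summable_iff_convergent)
    then have "convergent (\<lambda>n. f (r n) x - f (r 0) x)"
      using sum_lessThan_telescope[of "\<lambda>k. f (r k) x"] by simp
    then have "convergent (\<lambda>n. (f (r n) x - f (r 0) x) + f (r 0) x)"
      by (intro convergent_add convergent_const)
    then show ?case by simp
  qed
  define g where "g x = lim (\<lambda>k. f (r k) x)" for x
  have gm [measurable]: "g \<in> borel_measurable M"
    unfolding g_def[abs_def] by measurable
  have lim: "AE x in M. (\<lambda>k. f (r k) x) \<longlonglongrightarrow> g x"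
    using AEconv by eventually_elim (simp add: g_def convergent_LIMSEQ_iff)
  \<comment> \<open>For \<open>n\<close> beyond \<open>N k\<close> the comparison is directly with
    the late members of the subsequence, so the whole sequence converges to \<open>g\<close> with
    the same geometric rate.\<close>
  have Fatou: "(\<integral>\<^sup>+x. ennreal ((norm (f n x - g x))\<^sup>2) \<partial>M) \<le> ennreal (((1/2)^k)\<^sup>2)" if n: "n \<ge> N k" for n k
  proof -
    have "(\<integral>\<^sup>+x. ennreal ((norm (f n x - g x))\<^sup>2) \<partial>M)
      = (\<integral>\<^sup>+x. liminf (\<lambda>j. ennreal ((norm (f n x - f (r j) x))\<^sup>2)) \<partial>M)"
    proof (rule nn_integral_cong_AE, use lim in eventually_elim)
      case (elim x)
      then have "(\<lambda>j. ennreal ((norm (f n x - f (r j) x))\<^sup>2)) \<longlonglongrightarrow> ennreal ((norm (f n x - g x))\<^sup>2)"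
        by (intro tendsto_intros)
      then show ?case by (subst lim_imp_Liminf) simp_all
    qed
    also have "\<dots> \<le> liminf (\<lambda>j. \<integral>\<^sup>+x. ennreal ((norm (f n x - f (r j) x))\<^sup>2) \<partial>M)"
      by (rule nn_integral_liminf) measurable
    also have "\<dots> \<le> ennreal (((1/2)^k)\<^sup>2)"
    proof (rule Liminf_le)
      show "\<forall>\<^sub>F j in sequentially. (\<integral>\<^sup>+x. ennreal ((norm (f n x - f (r j) x))\<^sup>2) \<partial>M) \<le> ennreal (((1/2)^k)\<^sup>2)"
        using eventually_ge_at_top[of k]
      proof eventually_elim
        case (elim j)
        have "r k \<le> r j" using elim rmono by (simp add: lift_Suc_mono_le)
        then have le: "L2_norm M (\<lambda>x. f n x - f (r j) x) \<le> (1/2)^k"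
          using N[of k n "r j"] rN[of k] n by simp
        have "(\<integral>\<^sup>+x. ennreal ((norm (f n x - f (r j) x))\<^sup>2) \<partial>M) = ennreal ((L2_norm M (\<lambda>x. f n x - f (r j) x))\<^sup>2)"
          unfolding L2_norm_sq by (intro nn_integral_eq_integral L2_integrable L2_diff f) auto
        also have "\<dots> \<le> ennreal (((1/2)^k)\<^sup>2)"
          by (intro ennreal_leI power_mono le) simp
        finally show ?case .
      qed
    qed simp
    finally show ?thesis .
  qed
  have diffL2: "(\<lambda>x. f n x - g x) \<in> L2_space M \<and> L2_norm M (\<lambda>x. f n x - g x) \<le> (1/2)^k" if "n \<ge> N k" for n k
  proof
    have int: "integrable M (\<lambda>x. (norm (f n x - g x))\<^sup>2)"
      using Fatou[OF that] by (intro integrableI_bounded) (auto simp: order_le_less_trans ennreal_less_top)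
    then show "(\<lambda>x. f n x - g x) \<in> L2_space M" by (simp add: L2_space_def)
    have "ennreal ((L2_norm M (\<lambda>x. f n x - g x))\<^sup>2) \<le> ennreal (((1/2)^k)\<^sup>2)"
      unfolding L2_norm_sq using Fatou[OF that] nn_integral_eq_integral[OF int] by simp
    then have "(L2_norm M (\<lambda>x. f n x - g x))\<^sup>2 \<le> ((1/2)^k)\<^sup>2"
      by (simp add: ennreal_le_iff)
    then show "L2_norm M (\<lambda>x. f n x - g x) \<le> (1/2)^k"
      by (rule power2_le_imp_le) simp
  qed
  have "g \<in> L2_space M"
    using L2_diff[OF f[of "N 0"] conjunct1[OF diffL2[of 0 "N 0"]]] by simp
  moreover have "(\<lambda>n. L2_norm M (\<lambda>x. f n x - g x)) \<longlonglongrightarrow> 0"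
  proof (rule LIMSEQ_I)
    fix e :: real assume "e > 0"
    obtain k where k: "(1/2)^k < e" using real_arch_pow_inv[OF \<open>e > 0\<close>, of "1/2"] by auto
    show "\<exists>no. \<forall>n\<ge>no. norm (L2_norm M (\<lambda>x. f n x - g x) - 0) < e"
      using diffL2[of k] k by (intro exI[of _ "N k"]) force
  qed
  ultimately show ?thesis by blast
qed

section \<open>Test functions\<close>

lemma test_functionsI:
  "smooth \<phi> \<Longrightarrow> compact K \<Longrightarrow> K \<subseteq> E \<Longrightarrow> (\<And>x. x \<notin> K \<Longrightarrow> \<phi> x = 0) \<Longrightarrow> \<phi> \<in> test_functions E"
  by (auto simp: test_functions_def)

lemma test_functions_smooth: "\<phi> \<in> test_functions E \<Longrightarrow> smooth \<phi>"
  by (simp add: test_functions_def)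

lemma test_functions_support:
  assumes "\<phi> \<in> test_functions E"
  shows "\<exists>K. compact K \<and> K \<subseteq> E \<and> (\<forall>x. x \<notin> K \<longrightarrow> \<phi> x = 0)"
  using assms by (auto simp: test_functions_def)

lemma grad_eq_0_outside:
  assumes "closed K" "\<And>x. x \<notin> K \<Longrightarrow> \<phi> x = c" "x \<notin> K"
  shows "grad \<phi> x = 0"
proof (rule grad_eqI)
  have "((\<lambda>_. c) has_derivative (\<lambda>h. 0 \<bullet> h)) (at x)" by simp
  then show "(\<phi> has_derivative (\<lambda>h. 0 \<bullet> h)) (at x)"
    using assms
    by (auto intro!: has_derivative_transform_within_open[of "\<lambda>_. c" _ x UNIV "- K" \<phi>])
qed

lemma test_functions_outside:
  assumes "\<phi> \<in> test_functions E" "x \<notin> E" shows "\<phi> x = 0" "grad \<phi> x = 0"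
proof -
  obtain K where K: "compact K" "K \<subseteq> E" "\<And>x. x \<notin> K \<Longrightarrow> \<phi> x = 0"
    using test_functions_support[OF assms(1)] by blast
  then show "\<phi> x = 0" using assms(2) by auto
  show "grad \<phi> x = 0"
    using grad_eq_0_outside[OF compact_imp_closed[OF K(1)], of \<phi> 0 x] K(2,3) assms(2) by auto
qed

lemma test_functions_zero: "(\<lambda>_. 0) \<in> test_functions E"
  by (rule test_functionsI[of _ "{}"]) (auto intro: smooth_const)

lemma test_functions_add:
  assumes "\<phi> \<in> test_functions E" "\<psi> \<in> test_functions E"
  shows "(\<lambda>x. \<phi> x + \<psi> x) \<in> test_functions E"
proof -
  obtain K where K: "compact K" "K \<subseteq> E" "\<And>x. x \<notin> K \<Longrightarrow> \<phi> x = 0"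
    using test_functions_support[OF assms(1)] by blast
  obtain L where L: "compact L" "L \<subseteq> E" "\<And>x. x \<notin> L \<Longrightarrow> \<psi> x = 0"
    using test_functions_support[OF assms(2)] by blast
  show ?thesis
    by (rule test_functionsI[of _ "K \<union> L"])
      (use K L assms in \<open>auto intro: smooth_add test_functions_smooth\<close>)
qed

lemma test_functions_mult:
  assumes "\<phi> \<in> test_functions E" "smooth \<psi>"
  shows "(\<lambda>x. \<psi> x * \<phi> x) \<in> test_functions E"
proof -
  obtain K where K: "compact K" "K \<subseteq> E" "\<And>x. x \<notin> K \<Longrightarrow> \<phi> x = 0"
    using test_functions_support[OF assms(1)] by blast
  show ?thesis
    by (rule test_functionsI[of _ K])
      (use K assms in \<open>auto intro: smooth_mult test_functions_smooth\<close>)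
qed

lemma test_functions_cmult: "\<phi> \<in> test_functions E \<Longrightarrow> (\<lambda>x. c * \<phi> x) \<in> test_functions E"
  by (rule test_functions_mult[OF _ smooth_const])

lemma integrable_compact_support:
  assumes "continuous_on UNIV f" "compact K" "\<And>x. x \<notin> K \<Longrightarrow> f x = (0::'b::euclidean_space)"
  shows "integrable lborel f"
proof -
  have "integrable lborel (\<lambda>x. indicator K x *\<^sub>R f x)"
    by (rule borel_integrable_compact[OF assms(2)]) (use assms(1) continuous_on_subset in blast)
  moreover have "(\<lambda>x. indicator K x *\<^sub>R f x) = f"
    using assms(3) by (auto simp: indicator_def)
  ultimately show ?thesis by simp
qed

lemma difference_quotient_tendsto:
  assumes "smooth \<phi>"
  shows "(\<lambda>n. real (Suc n) * (\<phi> (x + (1 / real (Suc n)) *\<^sub>R h) - \<phi> x)) \<longlonglongrightarrow> grad \<phi> x \<bullet> h"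
proof -
  have "((\<lambda>t. x + t *\<^sub>R h) has_derivative (\<lambda>t. t *\<^sub>R h)) (at 0)"
    by (auto intro!: derivative_eq_intros)
  from has_derivative_compose[OF this smooth_has_derivative[OF assms]]
  have "((\<lambda>t. \<phi> (x + t *\<^sub>R h)) has_derivative (\<lambda>t. grad \<phi> x \<bullet> (t *\<^sub>R h))) (at 0)"
    by simp
  moreover have "(\<lambda>t. grad \<phi> x \<bullet> (t *\<^sub>R h)) = (*) (grad \<phi> x \<bullet> h)" by (auto simp: mult.commute)
  ultimately have "((\<lambda>t. \<phi> (x + t *\<^sub>R h)) has_field_derivative (grad \<phi> x \<bullet> h)) (at 0)"
    by (simp add: has_field_derivative_def)
  then have "((\<lambda>t. (\<phi> (x + t *\<^sub>R h) - \<phi> x) / t) \<longlongrightarrow> grad \<phi> x \<bullet> h) (at 0)"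
    by (simp add: DERIV_def)
  moreover have "filterlim (\<lambda>n. 1 / real (Suc n)) (at 0) sequentially"
    unfolding filterlim_at using LIMSEQ_inverse_real_of_nat
    by (simp add: inverse_eq_divide eventually_sequentially)
  ultimately have "(\<lambda>n. (\<phi> (x + (1 / real (Suc n)) *\<^sub>R h) - \<phi> x) / (1 / real (Suc n))) \<longlonglongrightarrow> grad \<phi> x \<bullet> h"
    by (rule filterlim_compose)
  then show ?thesis by (simp add: mult.commute)
qed

lemma continuous_bounded_on_compact:
  assumes "continuous_on UNIV f" "compact K"
  obtains B where "0 < B" "\<And>x. x \<in> K \<Longrightarrow> norm (f x) \<le> B"
proof -
  have "bounded (f ` K)"
    using assms by (intro compact_imp_bounded compact_continuous_image continuous_on_subset[OF assms(1)]) auto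
  then show ?thesis using that unfolding bounded_pos by auto
qed

text \<open>The integral of a difference quotient vanishes by translation invariance.\<close>

lemma integral_grad_test_function:
  assumes "\<phi> \<in> test_functions UNIV"
  shows "(\<integral>x. grad \<phi> x \<bullet> h \<partial>lborel) = 0"
proof -
  obtain K where K: "compact K" "\<And>x. x \<notin> K \<Longrightarrow> \<phi> x = 0"
    using test_functions_support[OF assms] by blast
  have sm: "smooth \<phi>" using assms by (rule test_functions_smooth)
  have [measurable]: "\<phi> \<in> borel_measurable borel" "grad \<phi> \<in> borel_measurable borel"
    using sm by (auto intro: smooth_borel smooth_grad_borel)
  have int: "integrable lborel \<phi>"
    using integrable_compact_support[OF smooth_continuous[OF sm] K] .
  obtain R where R: "0 < R" "\<And>x. x \<in> K \<Longrightarrow> norm x \<le> R"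
    using compact_imp_bounded[OF K(1)] unfolding bounded_pos by auto
  obtain B0 where B0: "0 < B0" "\<And>x. x \<in> K \<Longrightarrow> norm (grad \<phi> x) \<le> B0"
    using continuous_bounded_on_compact[OF smooth_grad_continuous[OF sm] K(1)] by metis
  have B: "norm (grad \<phi> x) \<le> B0" for x
    using B0 grad_eq_0_outside[OF compact_imp_closed[OF K(1)], of \<phi> 0 x] K(2) by (cases "x \<in> K") auto
  \<comment> \<open>Makes the difference quotients bounded uniformly in \<open>n\<close>, as
    dominated convergence requires.\<close>
  have Lip: "\<bar>\<phi> y - \<phi> x\<bar> \<le> B0 * norm (y - x)" for x y
  proof -
    have "onorm (\<lambda>h. grad \<phi> x \<bullet> h) \<le> B0" for x
      using B0(1) B[of x] by (intro onorm_le) (metis Cauchy_Schwarz_ineq2 mult_right_mono norm_ge_zero order_trans real_norm_def)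
    then have "norm (\<phi> y - \<phi> x) \<le> B0 * norm (y - x)"
      by (intro differentiable_bound[of UNIV \<phi> "\<lambda>x h. grad \<phi> x \<bullet> h" B0])
        (auto intro: smooth_has_derivative[OF sm])
    then show ?thesis by simp
  qed
  let ?q = "\<lambda>n x. real (Suc n) * (\<phi> (x + (1 / real (Suc n)) *\<^sub>R h) - \<phi> x)"
  \<comment> \<open>The shifts have length at most that of \<open>h\<close>, so all difference
    quotients vanish outside this enlarged ball.\<close>
  let ?w = "\<lambda>x. indicator (cball 0 (R + norm h)) x *\<^sub>R (B0 * norm h)"
  have zero: "(\<integral>x. ?q n x \<partial>lborel) = 0" for n
  proof -
    let ?c = "(1 / real (Suc n)) *\<^sub>R h"
    have d: "lborel = distr lborel borel ((+) ?c)" by (rule lborel_distr_plus[symmetric])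
    have i2: "integrable lborel (\<lambda>x. \<phi> (x + ?c))"
      using int by (subst (asm) d) (simp add: integrable_distr_eq add.commute)
    have "(\<integral>x. \<phi> x \<partial>lborel) = (\<integral>x. \<phi> (x + ?c) \<partial>lborel)"
      by (subst d) (simp add: integral_distr add.commute)
    then show ?thesis using int i2 by simp
  qed
  have "(\<lambda>n. \<integral>x. ?q n x \<partial>lborel) \<longlonglongrightarrow> (\<integral>x. grad \<phi> x \<bullet> h \<partial>lborel)"
  proof (rule integral_dominated_convergence[where w = ?w])
    show "integrable lborel ?w"
      by (rule borel_integrable_compact) auto
    show "AE x in lborel. (\<lambda>n. ?q n x) \<longlonglongrightarrow> grad \<phi> x \<bullet> h"
      using difference_quotient_tendsto[OF sm] by simp
    show "AE x in lborel. norm (?q n x) \<le> ?w x" for n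
    proof (rule AE_I2)
      fix x
      let ?y = "x + (1 / real (Suc n)) *\<^sub>R h"
      show "norm (?q n x) \<le> ?w x"
      proof (cases "x \<in> cball 0 (R + norm h)")
        case True
        have "norm (?q n x) = real (Suc n) * \<bar>\<phi> ?y - \<phi> x\<bar>" by (simp add: abs_mult)
        also have "\<dots> \<le> real (Suc n) * (B0 * norm (?y - x))"
          by (intro mult_left_mono Lip) auto
        also have "\<dots> = B0 * norm h" by (simp add: field_simps)
        finally show ?thesis using True by simp
      next
        case False
        then have x: "norm x > R + norm h" by simp
        then have "x \<notin> K" using R(2)[of x] norm_ge_zero[of h] by linarith
        have "norm ((1 / real (Suc n)) *\<^sub>R h) \<le> 1 * norm h"
          unfolding norm_scaleR by (intro mult_right_mono) auto
        then have "norm ?y > R"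
          using x norm_triangle_ineq2[of x "- ((1 / real (Suc n)) *\<^sub>R h)"] by (simp only: norm_minus_cancel diff_minus_eq_add)
        then have "?y \<notin> K" using R(2)[of ?y] by linarith
        with \<open>x \<notin> K\<close> show ?thesis using K(2) False by simp
      qed
    qed
  qed simp_all
  then show ?thesis unfolding zero by (simp add: LIMSEQ_const_iff)
qed

lemma borel_measurable_lebesgue_on:
  fixes f :: "'a::euclidean_space \<Rightarrow> 'b::topological_space"
  assumes "f \<in> borel_measurable borel" shows "f \<in> borel_measurable (lebesgue_on E)"
  using assms by (intro measurable_restrict_space1 measurable_completion) simp

text \<open>Bridge between the completed and restricted measure on which the function spaces live
  and \<open>lborel\<close>, where translation invariance is used.\<close>

lemma integral_lebesgue_on_eq:
  fixes f :: "'a::euclidean_space \<Rightarrow> 'b::euclidean_space"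
  assumes "E \<in> sets lebesgue" "f \<in> borel_measurable borel" "\<And>x. x \<notin> E \<Longrightarrow> f x = 0"
  shows "(\<integral>x. f x \<partial>lebesgue_on E) = (\<integral>x. f x \<partial>lborel)"
proof -
  have "(\<integral>x. f x \<partial>lebesgue_on E) = (\<integral>x. indicator E x *\<^sub>R f x \<partial>lebesgue)"
    using assms(1) by (intro integral_restrict_space) auto
  also have "\<dots> = (\<integral>x. f x \<partial>lebesgue)"
    using assms(3) by (intro Bochner_Integration.integral_cong) (auto simp: indicator_def)
  also have "\<dots> = (\<integral>x. f x \<partial>lborel)"
    using assms(2) by (intro integral_completion) simp
  finally show ?thesis .
qed

section \<open>Weak gradients on bounded open sets\<close>

locale bounded_domain =
  fixes E :: "'a::euclidean_space set"
  assumes open_E: "open E" and bounded_E: "bounded E"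
begin

abbreviation \<mu> where "\<mu> \<equiv> lebesgue_on E"

lemma sets_E [measurable]: "E \<in> sets borel" "E \<in> sets lebesgue"
  using open_E by auto

lemma finite_measure_E: "finite_measure \<mu>"
proof
  have "emeasure lebesgue E < \<infinity>"
    using emeasure_bounded_finite[OF bounded_E] open_E by simp
  then show "emeasure \<mu> (space \<mu>) \<noteq> \<infinity>"
    by (simp add: emeasure_restrict_space sets_E)
qed

lemma continuous_L2:
  fixes f :: "'a \<Rightarrow> 'b::euclidean_space"
  assumes "continuous_on UNIV f" shows "f \<in> L2_space \<mu>"
proof -
  obtain B where "\<And>x. x \<in> closure E \<Longrightarrow> norm (f x) \<le> B"
    using continuous_bounded_on_compact[OF assms, of "closure E"] bounded_E by (metis compact_closure)
  then have "AE x in \<mu>. norm (f x) \<le> B"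
    by (auto intro!: AE_I2 simp: closure_subset[THEN subsetD])
  then show ?thesis
    using L2_bounded(1)[OF finite_measure_E borel_measurable_lebesgue_on[OF borel_measurable_continuous_onI[OF assms]]]
    by blast
qed

lemma smooth_L2: "smooth f \<Longrightarrow> f \<in> L2_space \<mu>"
  and smooth_grad_L2: "smooth f \<Longrightarrow> grad f \<in> L2_space \<mu>"
  by (auto intro: continuous_L2 smooth_continuous smooth_grad_continuous)

lemma test_L2: "f \<in> test_functions E \<Longrightarrow> f \<in> L2_space \<mu>"
  and test_grad_L2: "f \<in> test_functions E \<Longrightarrow> grad f \<in> L2_space \<mu>"
  by (auto intro: smooth_L2 smooth_grad_L2 test_functions_smooth)

lemma integral_grad_inner_test:
  assumes "\<phi> \<in> test_functions E"
  shows "(\<integral>x. grad \<phi> x \<bullet> h \<partial>\<mu>) = 0"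
proof -
  have "\<phi> \<in> test_functions UNIV" using assms by (auto simp: test_functions_def)
  moreover have "(\<integral>x. grad \<phi> x \<bullet> h \<partial>\<mu>) = (\<integral>x. grad \<phi> x \<bullet> h \<partial>lborel)"
    using test_functions_smooth[OF assms] test_functions_outside[OF assms] sets_E
    by (intro integral_lebesgue_on_eq borel_measurable_continuous_onI smooth_continuous smooth_grad_inner) auto
  ultimately show ?thesis using integral_grad_test_function by metis
qed

lemma integration_by_parts:
  assumes "smooth \<phi>" "\<theta> \<in> test_functions E"
  shows "(\<integral>x. \<phi> x *\<^sub>R grad \<theta> x \<partial>\<mu>) = - (\<integral>x. \<theta> x *\<^sub>R grad \<phi> x \<partial>\<mu>)"
proof (rule euclidean_eqI)
  fix i :: 'a assume "i \<in> Basis"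
  have sm: "smooth \<theta>" using assms(2) by (rule test_functions_smooth)
  have i1: "integrable \<mu> (\<lambda>x. \<phi> x *\<^sub>R grad \<theta> x)"
    and i2: "integrable \<mu> (\<lambda>x. \<theta> x *\<^sub>R grad \<phi> x)"
    using assms(1) sm
    by (auto intro!: L2_imp_integrable[OF finite_measure_E] continuous_L2 continuous_on_scaleR
        smooth_continuous smooth_grad_continuous)
  have "0 = (\<integral>x. grad (\<lambda>x. \<phi> x * \<theta> x) x \<bullet> i \<partial>\<mu>)"
    using integral_grad_inner_test[OF test_functions_mult[OF assms(2,1)]] by simp
  also have "\<dots> = (\<integral>x. (\<phi> x *\<^sub>R grad \<theta> x) \<bullet> i + (\<theta> x *\<^sub>R grad \<phi> x) \<bullet> i \<partial>\<mu>)"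
    by (simp add: grad_mult[OF assms(1) sm] inner_add_left)
  also have "\<dots> = (\<integral>x. (\<phi> x *\<^sub>R grad \<theta> x) \<partial>\<mu>) \<bullet> i + (\<integral>x. (\<theta> x *\<^sub>R grad \<phi> x) \<partial>\<mu>) \<bullet> i"
    unfolding integral_inner_left[OF i1, symmetric] integral_inner_left[OF i2, symmetric]
    by (intro Bochner_Integration.integral_add integrable_inner_left i1 i2)
  finally show "(\<integral>x. \<phi> x *\<^sub>R grad \<theta> x \<partial>\<mu>) \<bullet> i = - (\<integral>x. \<theta> x *\<^sub>R grad \<phi> x \<partial>\<mu>) \<bullet> i"
    by simp
qed

text \<open>Proved by integrating the derivative of \<open>x\<^sub>i \<phi>\<^sup>2\<close>.\<close>

lemma Poincare:
  obtains R where "0 < R"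
    "\<And>\<phi>. \<phi> \<in> test_functions E \<Longrightarrow> L2_norm \<mu> \<phi> \<le> R * L2_norm \<mu> (grad \<phi>)"
proof -
  obtain R where R: "0 < R" "\<And>x. x \<in> E \<Longrightarrow> norm x \<le> R"
    using bounded_E unfolding bounded_pos by auto
  obtain i :: 'a where i: "i \<in> Basis" using nonempty_Basis by blast
  let ?N = "\<lambda>f. L2_norm \<mu> f"
  have "?N \<phi> \<le> 2 * R * L2_norm \<mu> (grad \<phi>)" if \<phi>: "\<phi> \<in> test_functions E" for \<phi>
  proof -
    have sm: "smooth \<phi>" using \<phi> by (rule test_functions_smooth)
    have sx: "smooth (\<lambda>x. x \<bullet> i)" by (rule smooth_inner_left)
    have gx: "grad (\<lambda>x. x \<bullet> i) x = i" for x
      by (rule grad_eqI) (auto intro!: derivative_eq_intros simp: inner_commute)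
    let ?d = "\<lambda>x. (x \<bullet> i) * (grad \<phi> x \<bullet> i)"
    have cd: "continuous_on UNIV ?d"
      by (intro continuous_on_mult smooth_continuous sx smooth_grad_inner sm)
    have dL2: "?d \<in> L2_space \<mu>" by (rule continuous_L2[OF cd])
    have pL2: "\<phi> \<in> L2_space \<mu>" by (rule test_L2[OF \<phi>])
    have eq: "grad (\<lambda>x. ((x \<bullet> i) * \<phi> x) * \<phi> x) x \<bullet> i = (norm (\<phi> x))\<^sup>2 + 2 * (\<phi> x * ?d x)" for x
      unfolding grad_mult[OF smooth_mult[OF sx sm] sm] grad_mult[OF sx sm] gx
      using i by (simp add: inner_simps algebra_simps power2_eq_square)
    have "0 = (\<integral>x. (norm (\<phi> x))\<^sup>2 + 2 * (\<phi> x * ?d x) \<partial>\<mu>)"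
      using integral_grad_inner_test[OF test_functions_mult[OF \<phi> smooth_mult[OF sx sm]], of i]
      by (simp add: eq)
    also have "\<dots> = (?N \<phi>)\<^sup>2 + 2 * (\<integral>x. \<phi> x * ?d x \<partial>\<mu>)"
      unfolding L2_norm_sq using L2_integrable[OF pL2] L2_mult_integrable[OF pL2 dL2]
      by (subst Bochner_Integration.integral_add) auto
    finally have sq: "(?N \<phi>)\<^sup>2 \<le> 2 * \<bar>\<integral>x. \<phi> x * ?d x \<partial>\<mu>\<bar>" by linarith
    have "\<bar>\<integral>x. \<phi> x * ?d x \<partial>\<mu>\<bar> \<le> ?N \<phi> * ?N ?d"
      using L2_Cauchy_Schwarz[OF pL2 dL2] by simp
    moreover have "?N ?d \<le> ?N (\<lambda>x. R *\<^sub>R grad \<phi> x)"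
    proof (rule L2_dominated(2))
      show "AE x in \<mu>. norm (?d x) \<le> norm (R *\<^sub>R grad \<phi> x)"
      proof (rule AE_I2)
        fix x assume "x \<in> space \<mu>"
        then have "\<bar>x \<bullet> i\<bar> \<le> R" using R(2)[of x] Basis_le_norm[OF i, of x] by simp
        then show "norm (?d x) \<le> norm (R *\<^sub>R grad \<phi> x)"
          using R(1) Basis_le_norm[OF i, of "grad \<phi> x"] by (simp add: abs_mult mult_mono)
      qed
    qed (use dL2 in \<open>auto intro!: L2_scaleR test_grad_L2[OF \<phi>] L2_measurable\<close>)
    moreover have "?N (\<lambda>x. R *\<^sub>R grad \<phi> x) = R * ?N (grad \<phi>)"
      using R(1) by (simp add: L2_norm_scaleR)
    ultimately have "\<bar>\<integral>x. \<phi> x * ?d x \<partial>\<mu>\<bar> \<le> ?N \<phi> * (R * ?N (grad \<phi>))"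
      using mult_left_mono[of "?N ?d" "R * ?N (grad \<phi>)" "?N \<phi>"] by simp
    with sq have *: "?N \<phi> * ?N \<phi> \<le> ?N \<phi> * (2 * R * ?N (grad \<phi>))"
      by (simp add: power2_eq_square ac_simps)
    show ?thesis
    proof (cases "?N \<phi> = 0")
      case True then show ?thesis using R(1) by simp
    next
      case False
      then have "0 < ?N \<phi>" using L2_norm_nonneg[of "\<mu>" \<phi>] by linarith
      then show ?thesis using * by (simp only: mult_le_cancel_left_pos)
    qed
  qed
  then show ?thesis using that[of "2 * R"] R(1) by simp
qed

end

section \<open>The fundamental lemma of the calculus of variations\<close>

text \<open>Open boxes form an intersection-stable generator of the Borel sets, so Dynkin induction
  extends the vanishing of the integral to every Borel set; \<open>total\<close> serves the
  complement step. Uniqueness of densities then gives the claim.\<close>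

lemma integral_boxes_0_imp_AE_0:
  fixes f :: "'a::euclidean_space \<Rightarrow> real"
  assumes f: "integrable lebesgue f" and total: "(\<integral>x. f x \<partial>lebesgue) = 0"
    and box0: "\<And>a b. (\<integral>x. indicator (box a b) x * f x \<partial>lebesgue) = 0"
  shows "AE x in lebesgue. f x = 0"
proof -
  have int: "integrable lebesgue (\<lambda>x. indicator A x * f x)" if "A \<in> sets lebesgue" for A
    using integrable_mult_indicator[OF that f] by simp
  have borel: "(\<integral>x. indicator A x * f x \<partial>lebesgue) = 0" if "A \<in> sets borel" for A
  proof -
    have A: "A \<in> sigma_sets UNIV (range (\<lambda>(a, b). box a b))"
      using that by (subst (asm) borel_eq_box) (simp add: sets_measure_of)
    have "Int_stable (range (\<lambda>(a, b). box a b :: 'a set))"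
      by (auto simp: Int_stable_def box_Int_box)
    moreover have "range (\<lambda>(a, b). box a b :: 'a set) \<subseteq> Pow UNIV" by simp
    ultimately show ?thesis using A
    proof (induction rule: sigma_sets_induct_disjoint)
      case (basic A) then show ?case using box0 by auto
    next
      case empty show ?case by simp
    next
      case (compl A)
      then have "A \<in> sets borel"
        by (subst borel_eq_box) (simp add: sets_measure_of)
      then have A: "A \<in> sets lebesgue" by auto
      have "(\<integral>x. indicator (UNIV - A) x * f x \<partial>lebesgue) = (\<integral>x. f x - indicator A x * f x \<partial>lebesgue)"
        by (intro Bochner_Integration.integral_cong) (auto simp: indicator_def)
      then show ?case using int[OF A] f total compl by simp
    next
      case (union A)
      then have "A i \<in> sets borel" for i
        by (subst borel_eq_box) (auto simp: sets_measure_of)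
      then have A: "A i \<in> sets lebesgue" for i by auto
      have "(LINT x:(\<Union>i. A i)|lebesgue. f x) = (\<Sum>i. (LINT x:(A i)|lebesgue. f x))"
        using union A f
        by (intro lebesgue_integral_countable_add)
          (auto simp: set_integrable_def disjoint_family_on_def intro!: int)
      then show ?case using union by (simp add: set_lebesgue_integral_def)
    qed
  qed
  show ?thesis
  proof (rule density_unique_real[OF f])
    show "integrable lebesgue (\<lambda>_. 0::real)" by simp
    fix A :: "'a set" assume A: "A \<in> sets lebesgue"
    \<comment> \<open>A Lebesgue set differs from a Borel set by a subset of a Borel null set, which
      does not affect the integral.\<close>
    then obtain S N N' where SN: "A = S \<union> N" "N \<subseteq> N'" "N' \<in> null_sets lborel" "S \<in> sets lborel"
      by (rule sets_completionE)
    have S: "S \<in> sets borel" "S \<in> sets lebesgue" using SN(4) by auto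
    have "AE x in lborel. x \<notin> N'" by (rule AE_not_in[OF SN(3)])
    then have "AE x in lebesgue. x \<notin> N'" by (rule AE_completion)
    then have "AE x in lebesgue. indicator A x * f x = indicator S x * f x"
      by eventually_elim (use SN in \<open>auto simp: indicator_def\<close>)
    then have "(\<integral>x. indicator A x * f x \<partial>lebesgue) = (\<integral>x. indicator S x * f x \<partial>lebesgue)"
      using int[OF A] int[OF S(2)] by (intro integral_cong_AE) auto
    then show "(LINT x:A|lebesgue. f x) = (LINT x:A|lebesgue. 0)"
      using borel[OF S(1)] by (simp add: set_lebesgue_integral_def)
  qed
qed

context bounded_domain
begin

text \<open>As \<open>n\<close> grows these functions tend pointwise to the indicator of the open
  box, which turns vanishing against test functions into vanishing over boxes.\<close>

definition box_cutoff :: "'a \<Rightarrow> 'a \<Rightarrow> nat \<Rightarrow> 'a \<Rightarrow> real" where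
  "box_cutoff a b n x = (\<Prod>i\<in>Basis. smooth_step (n * ((x - a) \<bullet> i)) * smooth_step (n * ((b - x) \<bullet> i)))"

lemma smooth_box_cutoff: "smooth (box_cutoff a b n)"
proof -
  have "(b - x) \<bullet> i = (-1) * ((x - b) \<bullet> i)" for x i by (simp add: inner_simps)
  then show ?thesis unfolding box_cutoff_def[abs_def]
    by (intro smooth_prod smooth_mult smooth_comp[OF smooth_smooth_step] smooth_cmult)
      (simp_all only: smooth_inner_diff smooth_cmult)
qed

lemma box_cutoff_outside: "x \<notin> box a b \<Longrightarrow> box_cutoff a b n x = 0"
  by (auto simp: box_cutoff_def mem_box inner_simps not_less mult_nonneg_nonpos intro!: prod_zero bexI smooth_step_0)

lemma box_cutoff_range: "0 \<le> box_cutoff a b n x" "box_cutoff a b n x \<le> 1"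
  unfolding box_cutoff_def
  by (auto intro!: prod_nonneg prod_le_1 mult_le_one smooth_step_range mult_nonneg_nonneg)

lemma smooth_step_tendsto: "0 < t \<Longrightarrow> (\<lambda>n. smooth_step (real n * t)) \<longlonglongrightarrow> 1"
proof (rule tendsto_eventually)
  assume "0 < t"
  obtain N :: nat where N: "1 / t < N" using reals_Archimedean2 by blast
  have "smooth_step (n * t) = 1" if "n \<ge> N" for n
  proof (rule smooth_step_1)
    have "1 / t \<le> n" using N that by linarith
    then show "1 \<le> n * t" using \<open>0 < t\<close> by (simp add: field_simps)
  qed
  then show "\<forall>\<^sub>F n in sequentially. smooth_step (real n * t) = 1"
    by (auto simp: eventually_sequentially)
qed

lemma box_cutoff_tendsto: "(\<lambda>n. box_cutoff a b n x) \<longlonglongrightarrow> indicator (box a b) x"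
proof (cases "x \<in> box a b")
  case True
  have "(\<lambda>n. box_cutoff a b n x) \<longlonglongrightarrow> (\<Prod>i\<in>(Basis::'a set). 1 * 1)"
    unfolding box_cutoff_def
    using True by (intro tendsto_prod tendsto_mult smooth_step_tendsto) (auto simp: mem_box inner_simps)
  then show ?thesis using True by simp
qed (simp add: box_cutoff_outside)

text \<open>On a closed box inside \<open>E\<close> the box cutoffs are admissible, so all integrals
  over smaller boxes vanish and the density argument applies there; countably many such boxes cover
  \<open>E\<close>.\<close>

lemma fundamental_lemma:
  assumes g: "integrable \<mu> g"
    and zero: "\<And>\<phi>. \<phi> \<in> test_functions E \<Longrightarrow> (\<integral>x. g x * \<phi> x \<partial>\<mu>) = 0"
  shows "AE x in \<mu>. g x = 0"
proof -
  have gE: "integrable lebesgue (\<lambda>x. indicator E x * g x)"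
    using g by (simp add: integrable_restrict_space sets_E)
  have box0: "(\<integral>x. indicator (box a b) x * (indicator E x * g x) \<partial>lebesgue) = 0" if ab: "cbox a b \<subseteq> E" for a b
  proof -
    have test: "box_cutoff a b n \<in> test_functions E" for n
      by (rule test_functionsI[of _ "cbox a b"])
        (use ab box_subset_cbox[of a b] in \<open>auto intro: smooth_box_cutoff box_cutoff_outside\<close>)
    have [measurable]: "box_cutoff a b n \<in> borel_measurable \<mu>" for n
      by (intro borel_measurable_lebesgue_on smooth_borel smooth_box_cutoff)
    have "(\<lambda>n. \<integral>x. g x * box_cutoff a b n x \<partial>\<mu>) \<longlonglongrightarrow> (\<integral>x. g x * indicator (box a b) x \<partial>\<mu>)"
    proof (rule integral_dominated_convergence[where w = "\<lambda>x. norm (g x)"])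
      show "AE x in \<mu>. (\<lambda>n. g x * box_cutoff a b n x) \<longlonglongrightarrow> g x * indicator (box a b) x"
        by (intro AE_I2 tendsto_mult tendsto_const box_cutoff_tendsto)
      show "AE x in \<mu>. norm (g x * box_cutoff a b n x) \<le> norm (g x)" for n
        using box_cutoff_range by (intro AE_I2) (auto simp: abs_mult intro!: mult_left_le)
      show "integrable \<mu> (\<lambda>x. norm (g x))" using g by simp
      have "indicator (box a b) \<in> borel_measurable \<mu>"
        by (intro borel_measurable_lebesgue_on) simp
      then show "(\<lambda>x. g x * indicator (box a b) x) \<in> borel_measurable \<mu>"
        using g by measurable
      show "(\<lambda>x. g x * box_cutoff a b n x) \<in> borel_measurable \<mu>" for n
        using g by measurable
    qed
    then have "(\<integral>x. g x * indicator (box a b) x \<partial>\<mu>) = 0"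
      by (simp add: zero[OF test] LIMSEQ_const_iff)
    also have "(\<integral>x. g x * indicator (box a b) x \<partial>\<mu>) = (\<integral>x. indicator (box a b) x * (indicator E x * g x) \<partial>lebesgue)"
      by (subst integral_restrict_space) (auto simp: sets_E ac_simps)
    finally show ?thesis .
  qed
  have *: "AE x in lebesgue. x \<in> cbox c d \<longrightarrow> g x = 0" if cd: "cbox c d \<subseteq> E" for c d
  proof -
    let ?f = "\<lambda>x. indicator (box c d) x * (indicator E x * g x)"
    \<comment> \<open>An empty open box may come with a nonempty, degenerate closed box that leaves
      \<open>E\<close>, so that case has to be set apart.\<close>
    have sub: "cbox a' b' \<subseteq> E \<or> box a' b' = {}" if "box a' b' \<subseteq> box c d" for a' b'
    proof (cases "box a' b' = {}")
      case False
      then have "cbox a' b' = closure (box a' b')" by (simp add: closure_box)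
      also have "\<dots> \<subseteq> cbox c d"
        using that box_subset_cbox[of c d] by (intro closure_minimal) auto
      finally show ?thesis using cd by auto
    qed simp
    have "AE x in lebesgue. ?f x = 0"
    proof (rule integral_boxes_0_imp_AE_0)
      show "integrable lebesgue ?f"
        using integrable_mult_indicator[OF _ gE, of "box c d"] by simp
      show "(\<integral>x. ?f x \<partial>lebesgue) = 0" by (rule box0[OF cd])
      fix a b
      obtain a' b' where ab: "box a b \<inter> box c d = box a' b'" by (rule that[OF box_Int_box])
      have "(\<integral>x. indicator (box a b) x * ?f x \<partial>lebesgue) = (\<integral>x. indicator (box a' b') x * (indicator E x * g x) \<partial>lebesgue)"
        unfolding ab[symmetric] by (simp add: indicator_inter_arith mult.assoc)
      then show "(\<integral>x. indicator (box a b) x * ?f x \<partial>lebesgue) = 0"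
        using sub[of a' b'] ab box0[of a' b'] by (cases "box a' b' = {}") auto
    qed
    moreover have "AE x in lebesgue. x \<notin> cbox c d - box c d"
      using negligible_frontier_interval[of c d] by (intro AE_not_in) (simp add: negligible_iff_null_sets)
    ultimately show ?thesis
      by eventually_elim (use cd box_subset_cbox[of c d] in \<open>auto simp: indicator_def split: if_splits\<close>)
  qed
  \<comment> \<open>Countability of the cover keeps the union of the exceptional sets null.\<close>
  obtain D where D: "countable D" "\<And>X. X \<in> D \<Longrightarrow> X \<subseteq> E \<and> (\<exists>a b. X = cbox a b)" "\<Union>D = E"
    using open_countable_Union_open_cbox[OF open_E] by (metis (no_types, lifting) PowD subsetD)
  have "AE x in lebesgue. \<forall>X\<in>D. x \<in> X \<longrightarrow> g x = 0"
    using D(1,2) * by (subst AE_ball_countable) metis+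
  then have "AE x in lebesgue. x \<in> E \<longrightarrow> g x = 0"
    by eventually_elim (use D(3) in blast)
  then show ?thesis by (subst AE_restrict_space_iff) (auto simp: sets_E)
qed


section \<open>Weak gradients and smooth approximation in H1\<close>

lemma weak_gradient_L2: "has_weak_gradient E u G \<Longrightarrow> G \<in> L2_space \<mu>"
  by (simp add: has_weak_gradient_def)

lemma integrable_scaleR_L2:
  assumes "u \<in> L2_space \<mu>" "G \<in> L2_space \<mu>"
  shows "integrable \<mu> (\<lambda>x. (u x::real) *\<^sub>R G x)"
proof (rule Bochner_Integration.integrable_bound)
  show "integrable \<mu> (\<lambda>x. norm (u x) * norm (G x))"
    by (intro L2_mult_integrable L2_of_norm assms)
  show "(\<lambda>x. u x *\<^sub>R G x) \<in> borel_measurable \<mu>"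
    using assms by (intro borel_measurable_scaleR L2_measurable)
qed simp

text \<open>The fundamental lemma is applied to each component of the difference. Uniqueness makes
  the arbitrary choice inside \<open>wgrad\<close> harmless: any weak gradient that can be exhibited
  agrees with it almost everywhere.\<close>

lemma weak_gradient_unique:
  assumes "has_weak_gradient E u G" "has_weak_gradient E u G'"
  shows "AE x in \<mu>. G x = G' x"
proof -
  have L2: "G \<in> L2_space \<mu>" "G' \<in> L2_space \<mu>"
    using assms by (auto intro: weak_gradient_L2)
  have int: "integrable \<mu> G" "integrable \<mu> G'"
    using L2 by (auto intro: L2_imp_integrable finite_measure_E)
  have "AE x in \<mu>. (G x - G' x) \<bullet> i = 0" for i
  proof (rule fundamental_lemma)
    show "integrable \<mu> (\<lambda>x. (G x - G' x) \<bullet> i)"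
      using int by auto
    fix \<phi> assume \<phi>: "\<phi> \<in> test_functions E"
    have i: "integrable \<mu> (\<lambda>x. \<phi> x *\<^sub>R G x)" "integrable \<mu> (\<lambda>x. \<phi> x *\<^sub>R G' x)"
      by (intro integrable_scaleR_L2 test_L2 \<phi> L2)+
    have "(\<integral>x. \<phi> x *\<^sub>R G x \<partial>\<mu>) = (\<integral>x. \<phi> x *\<^sub>R G' x \<partial>\<mu>)"
      using assms \<phi> unfolding has_weak_gradient_def by (metis neg_equal_iff_equal)
    then have "(\<integral>x. \<phi> x *\<^sub>R G x - \<phi> x *\<^sub>R G' x \<partial>\<mu>) \<bullet> i = 0"
      using i by simp
    then have "(\<integral>x. (\<phi> x *\<^sub>R G x - \<phi> x *\<^sub>R G' x) \<bullet> i \<partial>\<mu>) = 0"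
      using i by (subst integral_inner_left) auto
    then show "(\<integral>x. (G x - G' x) \<bullet> i * \<phi> x \<partial>\<mu>) = 0"
      by (simp add: inner_diff_left algebra_simps)
  qed
  then have "AE x in \<mu>. \<forall>i\<in>Basis. (G x - G' x) \<bullet> i = 0"
    by (intro AE_finite_allI) auto
  then show ?thesis
    by eventually_elim (rule euclidean_eqI, simp add: inner_diff_left)
qed

lemma H1_L2: "u \<in> H1 E \<Longrightarrow> u \<in> L2_space \<mu>"
  by (simp add: H1_def)

lemma H1I: "u \<in> L2_space \<mu> \<Longrightarrow> has_weak_gradient E u G \<Longrightarrow> u \<in> H1 E"
  by (auto simp: H1_def)

lemma wgrad_weak: "u \<in> H1 E \<Longrightarrow> has_weak_gradient E u (wgrad E u)"
  unfolding H1_def wgrad_def by (auto intro: someI[of "has_weak_gradient E u"])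

lemma wgrad_L2: "u \<in> H1 E \<Longrightarrow> wgrad E u \<in> L2_space \<mu>"
  using wgrad_weak weak_gradient_L2 by blast

lemma wgrad_eq_AE:
  assumes "has_weak_gradient E u G"
  shows "AE x in \<mu>. wgrad E u x = G x"
proof -
  have "has_weak_gradient E u (wgrad E u)"
    unfolding wgrad_def using assms by (rule someI[of "has_weak_gradient E u"])
  then show ?thesis using assms by (rule weak_gradient_unique)
qed

lemma has_weak_gradient_smooth: "smooth \<phi> \<Longrightarrow> has_weak_gradient E \<phi> (grad \<phi>)"
  unfolding has_weak_gradient_def by (auto intro: smooth_grad_L2 integration_by_parts)

lemma has_weak_gradient_lincomb:
  assumes "u \<in> L2_space \<mu>" "v \<in> L2_space \<mu>"
    "has_weak_gradient E u G" "has_weak_gradient E v H"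
  shows "has_weak_gradient E (\<lambda>x. a * u x + b * v x) (\<lambda>x. a *\<^sub>R G x + b *\<^sub>R H x)"
  unfolding has_weak_gradient_def
proof (intro conjI ballI)
  have GH: "G \<in> L2_space \<mu>" "H \<in> L2_space \<mu>"
    using assms by (auto intro: weak_gradient_L2)
  then show "(\<lambda>x. a *\<^sub>R G x + b *\<^sub>R H x) \<in> L2_space \<mu>"
    by (intro L2_add L2_scaleR)
  fix \<phi> assume \<phi>: "\<phi> \<in> test_functions E"
  have i: "integrable \<mu> (\<lambda>x. u x *\<^sub>R grad \<phi> x)" "integrable \<mu> (\<lambda>x. v x *\<^sub>R grad \<phi> x)"
    "integrable \<mu> (\<lambda>x. \<phi> x *\<^sub>R G x)" "integrable \<mu> (\<lambda>x. \<phi> x *\<^sub>R H x)"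
    by (intro integrable_scaleR_L2 test_L2 test_grad_L2 \<phi> assms GH)+
  have "(\<integral>x. (a * u x + b * v x) *\<^sub>R grad \<phi> x \<partial>\<mu>)
      = (\<integral>x. a *\<^sub>R (u x *\<^sub>R grad \<phi> x) + b *\<^sub>R (v x *\<^sub>R grad \<phi> x) \<partial>\<mu>)"
    by (simp add: algebra_simps)
  also have "\<dots> = a *\<^sub>R (\<integral>x. u x *\<^sub>R grad \<phi> x \<partial>\<mu>) + b *\<^sub>R (\<integral>x. v x *\<^sub>R grad \<phi> x \<partial>\<mu>)"
    using i by (simp del: scaleR_scaleR)
  also have "\<dots> = - (a *\<^sub>R (\<integral>x. \<phi> x *\<^sub>R G x \<partial>\<mu>) + b *\<^sub>R (\<integral>x. \<phi> x *\<^sub>R H x \<partial>\<mu>))"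
    using assms(3,4) \<phi> unfolding has_weak_gradient_def by simp
  also have "\<dots> = - (\<integral>x. a *\<^sub>R (\<phi> x *\<^sub>R G x) + b *\<^sub>R (\<phi> x *\<^sub>R H x) \<partial>\<mu>)"
    using i by (simp del: scaleR_scaleR)
  also have "\<dots> = - (\<integral>x. \<phi> x *\<^sub>R (a *\<^sub>R G x + b *\<^sub>R H x) \<partial>\<mu>)"
    by (simp add: algebra_simps)
  finally show "(\<integral>x. (a * u x + b * v x) *\<^sub>R grad \<phi> x \<partial>\<mu>)
    = - (\<integral>x. \<phi> x *\<^sub>R (a *\<^sub>R G x + b *\<^sub>R H x) \<partial>\<mu>)" .
qed

lemma H1_lincomb:
  assumes "u \<in> H1 E" "v \<in> H1 E"
  shows "(\<lambda>x. a * u x + b * v x) \<in> H1 E"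
    "AE x in \<mu>. wgrad E (\<lambda>x. a * u x + b * v x) x = a *\<^sub>R wgrad E u x + b *\<^sub>R wgrad E v x"
proof -
  note weak = has_weak_gradient_lincomb[OF H1_L2 H1_L2 wgrad_weak wgrad_weak, OF assms assms, of a b]
  show "(\<lambda>x. a * u x + b * v x) \<in> H1 E"
    using L2_add[OF L2_scaleR L2_scaleR, OF H1_L2 H1_L2, OF assms, of a b]
    by (intro H1I[OF _ weak]) simp
  show "AE x in \<mu>. wgrad E (\<lambda>x. a * u x + b * v x) x = a *\<^sub>R wgrad E u x + b *\<^sub>R wgrad E v x"
    by (rule wgrad_eq_AE[OF weak])
qed

lemma H1_diff:
  assumes "u \<in> H1 E" "v \<in> H1 E"
  shows "(\<lambda>x. u x - v x) \<in> H1 E"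
    "AE x in \<mu>. wgrad E (\<lambda>x. u x - v x) x = wgrad E u x - wgrad E v x"
  using H1_lincomb[OF assms, of 1 "-1"] by simp_all

lemma smooth_H1: "smooth \<phi> \<Longrightarrow> \<phi> \<in> H1 E"
  by (rule H1I[OF smooth_L2 has_weak_gradient_smooth])

lemma wgrad_smooth: "smooth \<phi> \<Longrightarrow> AE x in \<mu>. wgrad E \<phi> x = grad \<phi> x"
  by (rule wgrad_eq_AE[OF has_weak_gradient_smooth])

text \<open>Convergence in H1 split into values and gradients, with classical gradients for the
  approximants. This avoids the choice operator that \<open>H1_norm\<close> applies to each
  difference.\<close>

definition H1_lim :: "(nat \<Rightarrow> 'a \<Rightarrow> real) \<Rightarrow> ('a \<Rightarrow> real) \<Rightarrow> bool" where
  "H1_lim \<phi> u \<longleftrightarrow> (\<forall>n. smooth (\<phi> n)) \<and>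
     (\<lambda>n. L2_norm \<mu> (\<lambda>x. \<phi> n x - u x)) \<longlonglongrightarrow> 0 \<and>
     (\<lambda>n. L2_norm \<mu> (\<lambda>x. grad (\<phi> n) x - wgrad E u x)) \<longlonglongrightarrow> 0"

text \<open>The chosen weak gradient of the difference agrees almost everywhere with the classical
  gradient minus \<open>wgrad E u\<close>, and the root of a sum of two squares tends to 0 exactly
  when both terms do.\<close>

lemma H1_lim_iff:
  assumes u: "u \<in> H1 E" and sm: "\<And>n. smooth (\<phi> n)"
  shows "(\<lambda>n. H1_norm E (\<lambda>x. \<phi> n x - u x)) \<longlonglongrightarrow> 0 \<longleftrightarrow> H1_lim \<phi> u"
proof -
  let ?a = "\<lambda>n. L2_norm \<mu> (\<lambda>x. \<phi> n x - u x)"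
  let ?b = "\<lambda>n. L2_norm \<mu> (\<lambda>x. grad (\<phi> n) x - wgrad E u x)"
  have "L2_norm \<mu> (wgrad E (\<lambda>x. \<phi> n x - u x)) = ?b n" for n
  proof (rule L2_norm_cong_AE)
    have "AE x in \<mu>. wgrad E (\<lambda>x. \<phi> n x - u x) x = wgrad E (\<phi> n) x - wgrad E u x"
      using H1_lincomb(2)[OF smooth_H1[OF sm[of n]] u, of 1 "-1"] by simp
    then show "AE x in \<mu>. wgrad E (\<lambda>x. \<phi> n x - u x) x = grad (\<phi> n) x - wgrad E u x"
      using wgrad_smooth[OF sm[of n]] by eventually_elim simp
    have "(\<lambda>x. \<phi> n x - u x) \<in> H1 E"
      using H1_lincomb(1)[OF smooth_H1[OF sm[of n]] u, of 1 "-1"] by simp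
    then show "wgrad E (\<lambda>x. \<phi> n x - u x) \<in> borel_measurable \<mu>"
      by (intro L2_measurable wgrad_L2)
    show "(\<lambda>x. grad (\<phi> n) x - wgrad E u x) \<in> borel_measurable \<mu>"
      by (intro L2_measurable L2_diff smooth_grad_L2 sm wgrad_L2 u)
  qed
  then have eq: "H1_norm E (\<lambda>x. \<phi> n x - u x) = sqrt ((?a n)\<^sup>2 + (?b n)\<^sup>2)" for n
    by (simp add: H1_norm_def)
  show ?thesis
  proof
    assume "(\<lambda>n. H1_norm E (\<lambda>x. \<phi> n x - u x)) \<longlonglongrightarrow> 0"
    then have "?a \<longlonglongrightarrow> 0" "?b \<longlonglongrightarrow> 0"
      unfolding eq by (rule tendsto_zero_bound[rotated]; simp add: real_sqrt_sum_squares_ge1 real_sqrt_sum_squares_ge2)+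
    then show "H1_lim \<phi> u" using sm by (simp add: H1_lim_def)
  next
    assume "H1_lim \<phi> u"
    then have "(\<lambda>n. sqrt ((?a n)\<^sup>2 + (?b n)\<^sup>2)) \<longlonglongrightarrow> sqrt (0\<^sup>2 + 0\<^sup>2)"
      unfolding H1_lim_def by (intro tendsto_intros) auto
    then show "(\<lambda>n. H1_norm E (\<lambda>x. \<phi> n x - u x)) \<longlonglongrightarrow> 0" by (simp add: eq)
  qed
qed

lemma H1_lim_smooth: "H1_lim \<phi> u \<Longrightarrow> smooth (\<phi> n)"
  by (simp add: H1_lim_def)

lemma L2_norm_lincomb_tendsto_0:
  fixes f g :: "nat \<Rightarrow> 'a \<Rightarrow> 'b::euclidean_space"
  assumes "\<And>n. f n \<in> L2_space M" "\<And>n. g n \<in> L2_space M"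
    "(\<lambda>n. L2_norm M (f n)) \<longlonglongrightarrow> 0" "(\<lambda>n. L2_norm M (g n)) \<longlonglongrightarrow> 0"
  shows "(\<lambda>n. L2_norm M (\<lambda>x. a *\<^sub>R f n x + b *\<^sub>R g n x)) \<longlonglongrightarrow> 0"
proof (rule tendsto_zero_bound)
  show "\<bar>L2_norm M (\<lambda>x. a *\<^sub>R f n x + b *\<^sub>R g n x)\<bar> \<le> \<bar>a\<bar> * L2_norm M (f n) + \<bar>b\<bar> * L2_norm M (g n)" for n
    using L2_triangle[OF L2_scaleR[OF assms(1)] L2_scaleR[OF assms(2)]] by (simp add: L2_norm_scaleR)
  have "(\<lambda>n. \<bar>a\<bar> * L2_norm M (f n) + \<bar>b\<bar> * L2_norm M (g n)) \<longlonglongrightarrow> \<bar>a\<bar> * 0 + \<bar>b\<bar> * 0"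
    by (intro tendsto_intros assms)
  then show "(\<lambda>n. \<bar>a\<bar> * L2_norm M (f n) + \<bar>b\<bar> * L2_norm M (g n)) \<longlonglongrightarrow> 0" by simp
qed

lemma grad_lincomb:
  "smooth \<phi> \<Longrightarrow> smooth \<psi> \<Longrightarrow> grad (\<lambda>x. a * \<phi> x + b * \<psi> x) x = a *\<^sub>R grad \<phi> x + b *\<^sub>R grad \<psi> x"
  by (simp add: grad_add grad_cmult smooth_cmult)

lemma H1_lim_lincomb:
  assumes u: "u \<in> H1 E" and v: "v \<in> H1 E" and \<phi>: "H1_lim \<phi> u" and \<psi>: "H1_lim \<psi> v"
  shows "H1_lim (\<lambda>n x. a * \<phi> n x + b * \<psi> n x) (\<lambda>x. a * u x + b * v x)"
proof -
  have sm: "smooth (\<phi> n)" "smooth (\<psi> n)" for n using \<phi> \<psi> by (auto simp: H1_lim_def)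
  have "(\<lambda>n. L2_norm \<mu> (\<lambda>x. a *\<^sub>R (\<phi> n x - u x) + b *\<^sub>R (\<psi> n x - v x))) \<longlonglongrightarrow> 0"
    using \<phi> \<psi> unfolding H1_lim_def
    by (intro L2_norm_lincomb_tendsto_0 L2_diff smooth_L2 sm H1_L2 u v) auto
  moreover have "(\<lambda>n. L2_norm \<mu>
      (\<lambda>x. a *\<^sub>R (grad (\<phi> n) x - wgrad E u x) + b *\<^sub>R (grad (\<psi> n) x - wgrad E v x))) \<longlonglongrightarrow> 0"
    using \<phi> \<psi> unfolding H1_lim_def
    by (intro L2_norm_lincomb_tendsto_0 L2_diff smooth_grad_L2 sm wgrad_L2 u v) auto
  moreover have "L2_norm \<mu> (\<lambda>x. grad (\<lambda>x. a * \<phi> n x + b * \<psi> n x) x - wgrad E (\<lambda>x. a * u x + b * v x) x)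
    = L2_norm \<mu> (\<lambda>x. a *\<^sub>R (grad (\<phi> n) x - wgrad E u x) + b *\<^sub>R (grad (\<psi> n) x - wgrad E v x))" for n
  proof (rule L2_norm_cong_AE)
    show "AE x in \<mu>. grad (\<lambda>x. a * \<phi> n x + b * \<psi> n x) x - wgrad E (\<lambda>x. a * u x + b * v x) x
      = a *\<^sub>R (grad (\<phi> n) x - wgrad E u x) + b *\<^sub>R (grad (\<psi> n) x - wgrad E v x)"
      using H1_lincomb(2)[OF u v, of a b]
      by eventually_elim (simp add: grad_lincomb sm algebra_simps)
    show "(\<lambda>x. grad (\<lambda>x. a * \<phi> n x + b * \<psi> n x) x - wgrad E (\<lambda>x. a * u x + b * v x) x) \<in> borel_measurable \<mu>"
      by (intro L2_measurable L2_diff smooth_grad_L2 smooth_add smooth_cmult sm wgrad_L2 H1_lincomb u v)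
    show "(\<lambda>x. a *\<^sub>R (grad (\<phi> n) x - wgrad E u x) + b *\<^sub>R (grad (\<psi> n) x - wgrad E v x)) \<in> borel_measurable \<mu>"
      by (intro L2_measurable L2_diff L2_add L2_scaleR smooth_grad_L2 sm wgrad_L2 u v)
  qed
  moreover have "(\<lambda>x. a * \<phi> n x + b * \<psi> n x - (a * u x + b * v x)) = (\<lambda>x. a *\<^sub>R (\<phi> n x - u x) + b *\<^sub>R (\<psi> n x - v x))" for n
    by (auto simp: algebra_simps)
  ultimately show ?thesis
    using sm by (simp add: H1_lim_def smooth_add smooth_cmult)
qed

lemma H10_iff: "u \<in> H10 E \<longleftrightarrow> u \<in> H1 E \<and> (\<exists>\<phi>. (\<forall>n. \<phi> n \<in> test_functions E) \<and> H1_lim \<phi> u)"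
proof -
  have "(\<lambda>n. H1_norm E (\<lambda>x. \<phi> n x - u x)) \<longlonglongrightarrow> 0 \<longleftrightarrow> H1_lim \<phi> u"
    if "u \<in> H1 E" "\<forall>n. \<phi> n \<in> test_functions E" for \<phi>
    using that by (intro H1_lim_iff) (auto intro: test_functions_smooth)
  then show ?thesis unfolding H10_def by auto
qed

lemma H10_H1: "u \<in> H10 E \<Longrightarrow> u \<in> H1 E" by (simp add: H10_iff)

section \<open>Weak Laplacians tested with \<open>H10\<close>\<close>

lemma weak_laplacian_lincomb:
  assumes "u \<in> H1 E" "v \<in> H1 E" "has_weak_laplacian E u f" "has_weak_laplacian E v g"
  shows "has_weak_laplacian E (\<lambda>x. a * u x + b * v x) (\<lambda>x. a * f x + b * g x)"
  unfolding has_weak_laplacian_def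
proof (intro conjI ballI)
  have L2: "f \<in> L2_space \<mu>" "g \<in> L2_space \<mu>"
    using assms by (auto simp: has_weak_laplacian_def)
  show "(\<lambda>x. a * f x + b * g x) \<in> L2_space \<mu>"
    using L2_add[OF L2_scaleR[OF L2(1), of a] L2_scaleR[OF L2(2), of b]] by simp
  fix \<phi> assume \<phi>: "\<phi> \<in> test_functions E"
  have gr: "grad \<phi> \<in> L2_space \<mu>" by (rule test_grad_L2[OF \<phi>])
  note [measurable] = L2_measurable[OF wgrad_L2[OF assms(1)]] L2_measurable[OF wgrad_L2[OF assms(2)]]
    L2_measurable[OF wgrad_L2[OF H1_lincomb(1)[OF assms(1,2)]]] L2_measurable[OF gr]
  have i: "integrable \<mu> (\<lambda>x. wgrad E u x \<bullet> grad \<phi> x)" "integrable \<mu> (\<lambda>x. wgrad E v x \<bullet> grad \<phi> x)"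
    "integrable \<mu> (\<lambda>x. f x * \<phi> x)" "integrable \<mu> (\<lambda>x. g x * \<phi> x)"
    by (intro L2_inner_integrable L2_mult_integrable wgrad_L2 assms gr L2 test_L2 \<phi>)+
  have "(\<integral>x. wgrad E (\<lambda>x. a * u x + b * v x) x \<bullet> grad \<phi> x \<partial>\<mu>)
    = (\<integral>x. a * (wgrad E u x \<bullet> grad \<phi> x) + b * (wgrad E v x \<bullet> grad \<phi> x) \<partial>\<mu>)"
    using H1_lincomb(2)[OF assms(1,2), of a b]
    by (intro integral_cong_AE) (auto elim!: eventually_mono simp: inner_simps)
  also have "\<dots> = a * (\<integral>x. wgrad E u x \<bullet> grad \<phi> x \<partial>\<mu>) + b * (\<integral>x. wgrad E v x \<bullet> grad \<phi> x \<partial>\<mu>)"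
    using i by simp
  also have "\<dots> = - (a * (\<integral>x. f x * \<phi> x \<partial>\<mu>) + b * (\<integral>x. g x * \<phi> x \<partial>\<mu>))"
  proof -
    have "(\<integral>x. wgrad E u x \<bullet> grad \<phi> x \<partial>\<mu>) = - (\<integral>x. f x * \<phi> x \<partial>\<mu>)"
      "(\<integral>x. wgrad E v x \<bullet> grad \<phi> x \<partial>\<mu>) = - (\<integral>x. g x * \<phi> x \<partial>\<mu>)"
      using assms(3,4) \<phi> unfolding has_weak_laplacian_def by (metis minus_minus)+
    then show ?thesis by simp
  qed
  also have "a * (\<integral>x. f x * \<phi> x \<partial>\<mu>) + b * (\<integral>x. g x * \<phi> x \<partial>\<mu>)
      = (\<integral>x. (a * f x + b * g x) * \<phi> x \<partial>\<mu>)"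
    using i by (simp add: distrib_right mult.assoc)
  finally show "- (\<integral>x. wgrad E (\<lambda>x. a * u x + b * v x) x \<bullet> grad \<phi> x \<partial>\<mu>)
      = (\<integral>x. (a * f x + b * g x) * \<phi> x \<partial>\<mu>)" by simp
qed

text \<open>Both sides of the weak equation are continuous along an approximating sequence of test
  functions. With \<open>u = z\<close> this becomes the energy identity.\<close>

lemma weak_laplacian_H10:
  assumes "u \<in> H1 E" "has_weak_laplacian E u f" "z \<in> H10 E"
  shows "(\<integral>x. wgrad E u x \<bullet> wgrad E z x \<partial>\<mu>) = - (\<integral>x. f x * z x \<partial>\<mu>)"
proof -
  obtain \<phi> where \<phi>: "\<And>n. \<phi> n \<in> test_functions E" "H1_lim \<phi> z" and z: "z \<in> H1 E"
    using assms(3) unfolding H10_iff by blast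
  have f: "f \<in> L2_space \<mu>" using assms(2) by (simp add: has_weak_laplacian_def)
  have "(\<lambda>n. \<integral>x. wgrad E u x \<bullet> grad (\<phi> n) x \<partial>\<mu>) \<longlonglongrightarrow> (\<integral>x. wgrad E u x \<bullet> wgrad E z x \<partial>\<mu>)"
    using \<phi>(2) by (intro L2_inner_tendsto test_grad_L2 \<phi>(1) wgrad_L2 z assms(1)) (simp add: H1_lim_def)
  moreover have "(\<lambda>n. \<integral>x. f x \<bullet> \<phi> n x \<partial>\<mu>) \<longlonglongrightarrow> (\<integral>x. f x \<bullet> z x \<partial>\<mu>)"
    using \<phi>(2) by (intro L2_inner_tendsto test_L2 \<phi>(1) H1_L2 z f) (simp add: H1_lim_def)
  moreover have "(\<integral>x. wgrad E u x \<bullet> grad (\<phi> n) x \<partial>\<mu>) = - (\<integral>x. f x \<bullet> \<phi> n x \<partial>\<mu>)" for n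
    using assms(2) \<phi>(1)[of n] unfolding has_weak_laplacian_def by (metis inner_real_def minus_minus)
  ultimately have "(\<lambda>n. - (\<integral>x. f x \<bullet> \<phi> n x \<partial>\<mu>)) \<longlonglongrightarrow> (\<integral>x. wgrad E u x \<bullet> wgrad E z x \<partial>\<mu>)"
    "(\<lambda>n. - (\<integral>x. f x \<bullet> \<phi> n x \<partial>\<mu>)) \<longlonglongrightarrow> - (\<integral>x. f x \<bullet> z x \<partial>\<mu>)"
    by (auto intro: tendsto_minus)
  then show ?thesis using LIMSEQ_unique by fastforce
qed

text \<open>Test functions have gradients of mean zero, and this survives the limit. It is the
  reason why the projection onto affine functions cannot see an \<open>H10\<close>
  perturbation.\<close>

lemma integral_wgrad_H10:
  assumes "z \<in> H10 E"
  shows "(\<integral>x. b \<bullet> wgrad E z x \<partial>\<mu>) = 0"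
proof -
  obtain \<phi> where \<phi>: "\<And>n. \<phi> n \<in> test_functions E" "H1_lim \<phi> z" and z: "z \<in> H1 E"
    using assms unfolding H10_iff by blast
  have "(\<lambda>n. \<integral>x. b \<bullet> grad (\<phi> n) x \<partial>\<mu>) \<longlonglongrightarrow> (\<integral>x. b \<bullet> wgrad E z x \<partial>\<mu>)"
    using \<phi>(2) by (intro L2_inner_tendsto test_grad_L2 \<phi>(1) wgrad_L2 z continuous_L2) (auto simp: H1_lim_def)
  moreover have "(\<integral>x. b \<bullet> grad (\<phi> n) x \<partial>\<mu>) = 0" for n
    using integral_grad_inner_test[OF \<phi>(1)] by (simp add: inner_commute)
  ultimately show ?thesis by (simp add: LIMSEQ_const_iff)
qed

text \<open>The weak gradient is a closed operator: after taking components, each side of the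
  defining identity is an L2 inner product with a fixed function.\<close>

lemma has_weak_gradient_limit:
  assumes "\<And>n. u n \<in> L2_space \<mu>" "v \<in> L2_space \<mu>" "G \<in> L2_space \<mu>"
    "\<And>n. has_weak_gradient E (u n) (H n)"
    "(\<lambda>n. L2_norm \<mu> (\<lambda>x. u n x - v x)) \<longlonglongrightarrow> 0"
    "(\<lambda>n. L2_norm \<mu> (\<lambda>x. H n x - G x)) \<longlonglongrightarrow> 0"
  shows "has_weak_gradient E v G"
  unfolding has_weak_gradient_def
proof (intro conjI ballI assms(3), rule euclidean_eqI)
  fix \<phi> and i :: 'a assume \<phi>: "\<phi> \<in> test_functions E"
  have H: "H n \<in> L2_space \<mu>" for n using assms(4) by (rule weak_gradient_L2)
  have gi: "(\<lambda>x. grad \<phi> x \<bullet> i) \<in> L2_space \<mu>"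
    using \<phi> by (intro smooth_L2 smooth_grad_inner test_functions_smooth)
  have pi: "(\<lambda>x. \<phi> x *\<^sub>R i) \<in> L2_space \<mu>"
    using \<phi> by (intro continuous_L2 continuous_on_scaleR smooth_continuous test_functions_smooth) auto
  have 1: "(\<lambda>n. \<integral>x. (grad \<phi> x \<bullet> i) \<bullet> u n x \<partial>\<mu>) \<longlonglongrightarrow> (\<integral>x. (grad \<phi> x \<bullet> i) \<bullet> v x \<partial>\<mu>)"
    by (intro L2_inner_tendsto assms gi)
  have 2: "(\<lambda>n. \<integral>x. (\<phi> x *\<^sub>R i) \<bullet> H n x \<partial>\<mu>) \<longlonglongrightarrow> (\<integral>x. (\<phi> x *\<^sub>R i) \<bullet> G x \<partial>\<mu>)"
    by (intro L2_inner_tendsto assms H pi)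
  have eqL: "(\<integral>x. w x *\<^sub>R grad \<phi> x \<partial>\<mu>) \<bullet> i = (\<integral>x. (grad \<phi> x \<bullet> i) \<bullet> w x \<partial>\<mu>)"
    if "w \<in> L2_space \<mu>" for w
    by (subst integral_inner_left[symmetric, OF integrable_scaleR_L2[OF that test_grad_L2[OF \<phi>]]]) (simp add: mult.commute)
  have eqR: "(\<integral>x. \<phi> x *\<^sub>R K x \<partial>\<mu>) \<bullet> i = (\<integral>x. (\<phi> x *\<^sub>R i) \<bullet> K x \<partial>\<mu>)"
    if "K \<in> L2_space \<mu>" for K
    by (subst integral_inner_left[symmetric, OF integrable_scaleR_L2[OF test_L2[OF \<phi>] that]]) (simp add: inner_commute)
  have "(\<integral>x. (grad \<phi> x \<bullet> i) \<bullet> u n x \<partial>\<mu>) = - (\<integral>x. (\<phi> x *\<^sub>R i) \<bullet> H n x \<partial>\<mu>)" for n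
    unfolding eqL[OF assms(1), symmetric] eqR[OF H, symmetric]
    using assms(4)[of n] \<phi> unfolding has_weak_gradient_def by simp
  with 1 have "(\<lambda>n. - (\<integral>x. (\<phi> x *\<^sub>R i) \<bullet> H n x \<partial>\<mu>)) \<longlonglongrightarrow> (\<integral>x. (grad \<phi> x \<bullet> i) \<bullet> v x \<partial>\<mu>)"
    by simp
  with tendsto_minus[OF 2] have "(\<integral>x. (grad \<phi> x \<bullet> i) \<bullet> v x \<partial>\<mu>) = - (\<integral>x. (\<phi> x *\<^sub>R i) \<bullet> G x \<partial>\<mu>)"
    using LIMSEQ_unique by blast
  then show "(\<integral>x. v x *\<^sub>R grad \<phi> x \<partial>\<mu>) \<bullet> i = - (\<integral>x. \<phi> x *\<^sub>R G x \<partial>\<mu>) \<bullet> i"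
    unfolding inner_minus_left eqL[OF assms(2)] eqR[OF assms(3)] .
qed

end

section \<open>Solving the Dirichlet problem by energy minimisation\<close>

lemma L2_parallelogram:
  assumes "f \<in> L2_space M" "g \<in> L2_space M"
  shows "(L2_norm M (\<lambda>x. f x - g x))\<^sup>2 + (L2_norm M (\<lambda>x. f x + g x))\<^sup>2
    = 2 * (L2_norm M f)\<^sup>2 + 2 * (L2_norm M g)\<^sup>2"
  using L2_norm_add_sq[OF assms] L2_norm_add_sq[OF assms(1) L2_minus[OF assms(2)]]
  by (simp add: L2_norm_minus)

text \<open>The first-variation argument: at its minimiser t = A/b the quadratic equals -A^2/b, so
  nonnegativity forces A = 0. For b = 0 the choice t = A gives -2 A^2.\<close>

lemma quadratic_nonneg_imp_zero:
  fixes A b :: real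
  assumes nonneg: "\<And>t. 0 \<le> t\<^sup>2 * b - 2 * t * A" and "0 \<le> b"
  shows "A = 0"
proof (cases "b = 0")
  case True
  then have "A\<^sup>2 \<le> 0" using nonneg[of A] by (simp add: power2_eq_square)
  then show ?thesis by simp
next
  case False
  then have "b > 0" using \<open>0 \<le> b\<close> by simp
  then have "A\<^sup>2 \<le> 0" using nonneg[of "A / b"] by (simp add: power2_eq_square field_simps)
  then show ?thesis by simp
qed

context bounded_domain
begin

lemma test_functions_lincomb:
  "\<phi> \<in> test_functions E \<Longrightarrow> \<psi> \<in> test_functions E \<Longrightarrow> (\<lambda>x. a * \<phi> x + b * \<psi> x) \<in> test_functions E"
  by (intro test_functions_add test_functions_cmult)

text \<open>A sequence of test functions minimising the distance of gradients to that of \<open>v\<close> is Cauchy by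
  the parallelogram law and the Poincare inequality.\<close>

lemma Dirichlet_projection:
  assumes v: "v \<in> H1 E"
  obtains z where "z \<in> H10 E"
    "\<And>\<phi>. \<phi> \<in> test_functions E \<Longrightarrow>
      (\<integral>x. wgrad E z x \<bullet> grad \<phi> x \<partial>\<mu>) = (\<integral>x. wgrad E v x \<bullet> grad \<phi> x \<partial>\<mu>)"
proof -
  define G where "G = wgrad E v"
  have G: "G \<in> L2_space \<mu>" unfolding G_def by (rule wgrad_L2[OF v])
  define J where "J \<phi> = (L2_norm \<mu> (\<lambda>x. G x - grad \<phi> x))\<^sup>2" for \<phi>
  define m where "m = Inf (J ` test_functions E)"
  have bdd: "bdd_below (J ` test_functions E)" by (rule bdd_belowI[of _ 0]) (auto simp: J_def)
  have mle: "m \<le> J \<phi>" if "\<phi> \<in> test_functions E" for \<phi>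
    unfolding m_def using that by (intro cInf_lower bdd) auto
  have "\<exists>\<phi>\<in>test_functions E. J \<phi> < m + 1 / real (Suc n)" for n
    using cInf_lessD[of "J ` test_functions E" "m + 1 / real (Suc n)"] test_functions_zero
    unfolding m_def by auto
  then obtain \<phi> where \<phi>: "\<And>n. \<phi> n \<in> test_functions E" "\<And>n. J (\<phi> n) < m + 1 / real (Suc n)"
    by metis
  have sm: "smooth (\<phi> n)" for n using \<phi>(1) by (rule test_functions_smooth)
  let ?N = "L2_norm \<mu>"
  have close: "(L2_norm \<mu> (\<lambda>x. grad (\<phi> n) x - grad (\<phi> k) x))\<^sup>2 \<le> 2 / real (Suc n) + 2 / real (Suc k)" for n k
  proof -
    let ?a = "\<lambda>x. G x - grad (\<phi> n) x" and ?b = "\<lambda>x. G x - grad (\<phi> k) x"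
    let ?\<chi> = "\<lambda>x. (1/2) * \<phi> n x + (1/2) * \<phi> k x"
    have ab: "?a \<in> L2_space \<mu>" "?b \<in> L2_space \<mu>"
      by (intro L2_diff G test_grad_L2 \<phi>)+
    have "(\<lambda>x. ?a x + ?b x) = (\<lambda>x. 2 *\<^sub>R (G x - grad ?\<chi> x))"
      unfolding grad_lincomb[OF sm sm] by (simp add: scaleR_2 scaleR_diff_right scaleR_add_right fun_eq_iff)
    then have "(?N (\<lambda>x. ?a x + ?b x))\<^sup>2 = 4 * J ?\<chi>"
      by (simp only: L2_norm_scaleR J_def power_mult_distrib) simp
    \<comment> \<open>The average of two test functions is again a competitor, which bounds the sum
      term of the parallelogram law from below.\<close>
    moreover have "m \<le> J ?\<chi>" by (intro mle test_functions_lincomb \<phi>)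
    moreover have "(\<lambda>x. ?a x - ?b x) = (\<lambda>x. grad (\<phi> k) x - grad (\<phi> n) x)" by simp
    ultimately have "(?N (\<lambda>x. grad (\<phi> k) x - grad (\<phi> n) x))\<^sup>2 \<le> 2 * J (\<phi> n) + 2 * J (\<phi> k) - 4 * m"
      using L2_parallelogram[OF ab] by (simp add: J_def)
    also have "\<dots> \<le> 2 / real (Suc n) + 2 / real (Suc k)"
      using \<phi>(2)[of n] \<phi>(2)[of k] by simp
    finally show ?thesis by (simp add: L2_norm_diff_commute[of _ "grad (\<phi> k)"])
  qed
  obtain R where R: "0 < R" "\<And>\<phi>. \<phi> \<in> test_functions E \<Longrightarrow> ?N \<phi> \<le> R * L2_norm \<mu> (grad \<phi>)"
    by (rule Poincare) blast
  \<comment> \<open>Values are paired with gradients so that one limit delivers both the function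
    \<open>z\<close> and its weak gradient.\<close>
  let ?U = "\<lambda>n x. (\<phi> n x, grad (\<phi> n) x)"
  have UL2: "?U n \<in> L2_space \<mu>" for n
    by (intro L2_Pair test_L2 test_grad_L2 \<phi>)
  have pair_close: "(L2_norm \<mu> (\<lambda>x. ?U n x - ?U k x))\<^sup>2 \<le> (R\<^sup>2 + 1) * (2 / real (Suc n) + 2 / real (Suc k))" for n k
  proof -
    let ?d = "\<lambda>x. 1 * \<phi> n x + (-1) * \<phi> k x"
    have d: "?d \<in> test_functions E" by (intro test_functions_lincomb \<phi>)
    have gd: "grad ?d = (\<lambda>x. grad (\<phi> n) x - grad (\<phi> k) x)"
      by (rule ext, subst grad_lincomb[OF sm sm]) simp
    have "(\<lambda>x. ?U n x - ?U k x) = (\<lambda>x. (?d x, grad ?d x))" unfolding gd by simp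
    then have "(L2_norm \<mu> (\<lambda>x. ?U n x - ?U k x))\<^sup>2 = (?N ?d)\<^sup>2 + (L2_norm \<mu> (grad ?d))\<^sup>2"
      by (simp only: L2_Pair(2)[OF test_L2[OF d] test_grad_L2[OF d]])
    also have "\<dots> \<le> (R * L2_norm \<mu> (grad ?d))\<^sup>2 + (L2_norm \<mu> (grad ?d))\<^sup>2"
      by (intro add_right_mono power_mono R(2) d) simp
    also have "\<dots> = (R\<^sup>2 + 1) * (L2_norm \<mu> (grad ?d))\<^sup>2"
      by (simp add: power_mult_distrib algebra_simps)
    also have "\<dots> \<le> (R\<^sup>2 + 1) * (2 / real (Suc n) + 2 / real (Suc k))"
      unfolding gd by (intro mult_left_mono close) simp
    finally show ?thesis .
  qed
  have "\<exists>U\<in>L2_space \<mu>. (\<lambda>n. L2_norm \<mu> (\<lambda>x. ?U n x - U x)) \<longlonglongrightarrow> 0"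
  proof (rule L2_complete[OF finite_measure_E UL2])
    fix e :: real assume e: "e > 0"
    then have "0 < e\<^sup>2 / (4 * (R\<^sup>2 + 1))" by (simp add: add_nonneg_pos)
    then obtain N where N: "1 / real (Suc N) < e\<^sup>2 / (4 * (R\<^sup>2 + 1))" using nat_approx_posE by blast
    have R1: "0 < R\<^sup>2 + 1" by (simp add: add_nonneg_pos)
    have "L2_norm \<mu> (\<lambda>x. ?U n x - ?U k x) < e" if "n \<ge> N" "k \<ge> N" for n k
    proof (rule power2_less_imp_less)
      have "2 / real (Suc n) + 2 / real (Suc k) \<le> 2 / real (Suc N) + 2 / real (Suc N)"
        using that by (intro add_mono divide_left_mono) auto
      also have "\<dots> = 4 * (1 / real (Suc N))" by simp
      also have "\<dots> < 4 * (e\<^sup>2 / (4 * (R\<^sup>2 + 1)))" using N by (rule mult_strict_left_mono) simp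
      also have "\<dots> = e\<^sup>2 / (R\<^sup>2 + 1)" using R1 by (simp add: divide_simps)
      finally have "(R\<^sup>2 + 1) * (2 / real (Suc n) + 2 / real (Suc k)) < e\<^sup>2"
        using R1 by (simp add: pos_less_divide_eq mult.commute)
      with pair_close[of n k] show "(L2_norm \<mu> (\<lambda>x. ?U n x - ?U k x))\<^sup>2 < e\<^sup>2"
        by (rule order_le_less_trans)
    qed (use e in simp)
    then show "\<exists>N. \<forall>m\<ge>N. \<forall>n\<ge>N. L2_norm \<mu> (\<lambda>x. ?U m x - ?U n x) < e" by blast
  qed
  then obtain U where U: "U \<in> L2_space \<mu>"
    "(\<lambda>n. L2_norm \<mu> (\<lambda>x. ?U n x - U x)) \<longlonglongrightarrow> 0" by blast
  define z where "z x = fst (U x)" for x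
  define Z where "Z x = snd (U x)" for x
  have [measurable]: "U \<in> borel_measurable \<mu>" using U(1) by (rule L2_measurable)
  have zm [measurable]: "z \<in> borel_measurable \<mu>" unfolding z_def[abs_def]
    by (rule measurable_compose[of U _ borel], fact) (intro borel_measurable_continuous_onI continuous_on_fst continuous_on_id)
  have Zm [measurable]: "Z \<in> borel_measurable \<mu>" unfolding Z_def[abs_def]
    by (rule measurable_compose[of U _ borel], fact) (intro borel_measurable_continuous_onI continuous_on_snd continuous_on_id)
  have zL2: "z \<in> L2_space \<mu>"
    using norm_fst_le[of "fst (U x)" "snd (U x)" for x]
    by (intro L2_dominated(1)[OF zm U(1)] AE_I2) (simp add: z_def)
  have ZL2: "Z \<in> L2_space \<mu>"
    using norm_snd_le[of "snd (U x)" "fst (U x)" for x]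
    by (intro L2_dominated(1)[OF Zm U(1)] AE_I2) (simp add: Z_def)
  have UUL2: "(\<lambda>x. ?U n x - U x) \<in> L2_space \<mu>" for n by (intro L2_diff UL2 U)
  have lim1: "(\<lambda>n. ?N (\<lambda>x. \<phi> n x - z x)) \<longlonglongrightarrow> 0"
  proof (rule tendsto_zero_bound[OF _ U(2)])
    have "norm (\<phi> n x - z x) \<le> norm (?U n x - U x)" for n x
      using norm_fst_le[of "\<phi> n x - z x" "grad (\<phi> n) x - Z x"] by (simp add: z_def Z_def minus_prod_def)
    then show "\<bar>?N (\<lambda>x. \<phi> n x - z x)\<bar> \<le> L2_norm \<mu> (\<lambda>x. ?U n x - U x)" for n
      using L2_dominated(2)[OF L2_measurable[OF L2_diff[OF test_L2[OF \<phi>(1)] zL2]] UUL2, of n n] by simp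
  qed
  have lim2: "(\<lambda>n. L2_norm \<mu> (\<lambda>x. grad (\<phi> n) x - Z x)) \<longlonglongrightarrow> 0"
  proof (rule tendsto_zero_bound[OF _ U(2)])
    have "norm (grad (\<phi> n) x - Z x) \<le> norm (?U n x - U x)" for n x
      using norm_snd_le[of "grad (\<phi> n) x - Z x" "\<phi> n x - z x"] by (simp add: z_def Z_def minus_prod_def)
    then show "\<bar>L2_norm \<mu> (\<lambda>x. grad (\<phi> n) x - Z x)\<bar> \<le> L2_norm \<mu> (\<lambda>x. ?U n x - U x)" for n
      using L2_dominated(2)[OF L2_measurable[OF L2_diff[OF test_grad_L2[OF \<phi>(1)] ZL2]] UUL2, of n n] by simp
  qed
  have weak: "has_weak_gradient E z Z"
    by (rule has_weak_gradient_limit[OF _ zL2 ZL2 has_weak_gradient_smooth lim1 lim2]) (intro test_L2 \<phi> sm)+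
  have zH1: "z \<in> H1 E" by (rule H1I[OF zL2 weak])
  have ae: "AE x in \<mu>. wgrad E z x = Z x" by (rule wgrad_eq_AE[OF weak])
  have "L2_norm \<mu> (\<lambda>x. grad (\<phi> n) x - wgrad E z x) = L2_norm \<mu> (\<lambda>x. grad (\<phi> n) x - Z x)" for n
    by (rule L2_norm_cong_AE; (intro L2_measurable L2_diff test_grad_L2 \<phi> wgrad_L2 zH1 ZL2)?)
      (use ae in \<open>auto elim: eventually_mono\<close>)
  then have Hlim: "H1_lim \<phi> z" using lim1 lim2 sm by (simp add: H1_lim_def)
  have z10: "z \<in> H10 E" using zH1 Hlim \<phi>(1) by (auto simp: H10_iff)
  have "(\<integral>x. wgrad E z x \<bullet> grad \<psi> x \<partial>\<mu>) = (\<integral>x. wgrad E v x \<bullet> grad \<psi> x \<partial>\<mu>)"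
    if \<psi>: "\<psi> \<in> test_functions E" for \<psi>
  proof -
    have g\<psi>: "grad \<psi> \<in> L2_space \<mu>" by (rule test_grad_L2[OF \<psi>])
    let ?a = "\<lambda>n. \<integral>x. grad \<psi> x \<bullet> (G x - grad (\<phi> n) x) \<partial>\<mu>"
    let ?b = "(L2_norm \<mu> (grad \<psi>))\<^sup>2"
    let ?A = "\<integral>x. grad \<psi> x \<bullet> (G x - wgrad E z x) \<partial>\<mu>"
    \<comment> \<open>Each member of the sequence minimises \<open>J\<close> up to 1/(n+1).
      Comparing it with its variation along \<open>\<psi>\<close> gives a quadratic inequality whose
      defect disappears in the limit.\<close>
    have var: "0 \<le> 1 / real (Suc n) - 2 * t * ?a n + t\<^sup>2 * ?b" for n t
    proof -
      have "m \<le> J (\<lambda>x. 1 * \<phi> n x + t * \<psi> x)" by (intro mle test_functions_lincomb \<phi> \<psi>)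
      also have "J (\<lambda>x. 1 * \<phi> n x + t * \<psi> x) = (L2_norm \<mu> (\<lambda>x. (G x - grad (\<phi> n) x) + (- t) *\<^sub>R grad \<psi> x))\<^sup>2"
        unfolding J_def grad_lincomb[OF sm test_functions_smooth[OF \<psi>]] by (simp add: algebra_simps)
      also have "\<dots> = J (\<phi> n) - 2 * t * ?a n + t\<^sup>2 * ?b"
        by (subst L2_norm_add_sq[OF L2_diff[OF G test_grad_L2[OF \<phi>(1)]] L2_scaleR[OF g\<psi>]])
          (simp add: J_def L2_norm_scaleR L2_norm_minus power_mult_distrib inner_commute)
      finally show ?thesis using \<phi>(2)[of n] by simp
    qed
    have limA: "?a \<longlonglongrightarrow> ?A"
    proof (rule L2_inner_tendsto[OF _ _ _ g\<psi>])
      show "(\<lambda>x. G x - grad (\<phi> n) x) \<in> L2_space \<mu>" for n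
        by (intro L2_diff G test_grad_L2 \<phi>)
      show "(\<lambda>x. G x - wgrad E z x) \<in> L2_space \<mu>"
        by (intro L2_diff G wgrad_L2 zH1)
      have "(\<lambda>x. G x - grad (\<phi> n) x - (G x - wgrad E z x)) = (\<lambda>x. wgrad E z x - grad (\<phi> n) x)" for n
        by auto
      then show "(\<lambda>n. L2_norm \<mu> (\<lambda>x. G x - grad (\<phi> n) x - (G x - wgrad E z x))) \<longlonglongrightarrow> 0"
        using Hlim by (simp add: H1_lim_def L2_norm_diff_commute[of _ "wgrad E z"])
    qed
    have var0: "0 \<le> 0 - 2 * t * ?A + t\<^sup>2 * ?b" for t
    proof (rule LIMSEQ_le_const)
      show "(\<lambda>n. 1 / real (Suc n) - 2 * t * ?a n + t\<^sup>2 * ?b) \<longlonglongrightarrow> 0 - 2 * t * ?A + t\<^sup>2 * ?b"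
        using LIMSEQ_inverse_real_of_nat by (intro tendsto_intros limA) (simp add: inverse_eq_divide)
    qed (use var in auto)
    have "?A = 0" by (rule quadratic_nonneg_imp_zero[where b = ?b]) (use var0 in auto)
    then have "(\<integral>x. wgrad E v x \<bullet> grad \<psi> x - wgrad E z x \<bullet> grad \<psi> x \<partial>\<mu>) = 0"
      by (simp add: G_def inner_diff_right inner_diff_left inner_commute)
    then show ?thesis
      using L2_inner_integrable[OF wgrad_L2[OF v] g\<psi>] L2_inner_integrable[OF wgrad_L2[OF zH1] g\<psi>] by simp
  qed
  then show ?thesis using that z10 by blast
qed

text \<open>Along an almost everywhere convergent subsequence the gradient error splits in two. One
  part is the bounded factor \<open>deriv bump\<close> times the error of the gradients; the other
  is the change of this factor against the fixed field \<open>wgrad E u\<close>, which tends to 0 by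
  dominated convergence.\<close>

lemma bump_H1_lim:
  assumes u: "u \<in> H1 E" and \<phi>: "H1_lim \<phi> u"
  obtains r where "strict_mono r"
    "(\<lambda>n. L2_norm \<mu> (\<lambda>x. bump (\<phi> (r n) x - M) - bump (u x - M))) \<longlonglongrightarrow> 0"
    "(\<lambda>n. L2_norm \<mu> (\<lambda>x. grad (\<lambda>x. bump (\<phi> (r n) x - M)) x - deriv bump (u x - M) *\<^sub>R wgrad E u x)) \<longlonglongrightarrow> 0"
proof -
  have sm: "smooth (\<phi> n)" for n using \<phi> by (rule H1_lim_smooth)
  obtain r where r: "strict_mono r" "AE x in \<mu>. (\<lambda>n. \<phi> (r n) x) \<longlonglongrightarrow> u x"
    using L2_AE_subseq[of \<phi> "\<mu>" u, OF smooth_L2[OF sm] H1_L2[OF u]] \<phi>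
    unfolding H1_lim_def by blast
  have [measurable]: "u \<in> borel_measurable \<mu>" by (intro L2_measurable H1_L2 u)
  have [measurable]: "\<phi> n \<in> borel_measurable \<mu>" for n by (intro L2_measurable smooth_L2 sm)
  have [measurable]: "grad (\<phi> n) \<in> borel_measurable \<mu>" for n by (intro L2_measurable smooth_grad_L2 sm)
  have [measurable]: "wgrad E u \<in> borel_measurable \<mu>" by (intro L2_measurable wgrad_L2 u)
  have [measurable]: "bump \<in> borel_measurable borel" "deriv bump \<in> borel_measurable borel"
    by (intro smooth_borel smooth_bump smooth_deriv)+
  have cont: "isCont bump t" "isCont (deriv bump) t" for t
    using smooth_continuous[OF smooth_bump, of UNIV] smooth_continuous[OF smooth_deriv[OF smooth_bump], of UNIV]
    by (auto simp: continuous_on_eq_continuous_at)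
  have one: "(\<lambda>_. 1::real) \<in> L2_space \<mu>" by (intro continuous_L2) simp
  have lim1: "(\<lambda>n. L2_norm \<mu> (\<lambda>x. bump (\<phi> (r n) x - M) - bump (u x - M))) \<longlonglongrightarrow> 0"
  proof (rule L2_dominated_convergence[OF _ _ one])
    show "norm (bump (\<phi> (r n) x - M)) \<le> norm (1::real)" for n x using bump_range by simp
    show "AE x in \<mu>. (\<lambda>n. bump (\<phi> (r n) x - M)) \<longlonglongrightarrow> bump (u x - M)"
      using r(2) by eventually_elim (intro isCont_tendsto_compose[OF cont(1)] tendsto_intros)
  qed measurable
  have lim2: "(\<lambda>n. L2_norm \<mu> (\<lambda>x. deriv bump (\<phi> (r n) x - M) *\<^sub>R wgrad E u x - deriv bump (u x - M) *\<^sub>R wgrad E u x)) \<longlonglongrightarrow> 0"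
  proof (rule L2_dominated_convergence[OF _ _ L2_scaleR[OF wgrad_L2[OF u], of 2]])
    show "norm (deriv bump (\<phi> (r n) x - M) *\<^sub>R wgrad E u x) \<le> norm (2 *\<^sub>R wgrad E u x)" for n x
      using deriv_bump_range by (simp add: mult_right_mono)
    show "AE x in \<mu>. (\<lambda>n. deriv bump (\<phi> (r n) x - M) *\<^sub>R wgrad E u x) \<longlonglongrightarrow> deriv bump (u x - M) *\<^sub>R wgrad E u x"
      using r(2) by eventually_elim (intro tendsto_scaleR isCont_tendsto_compose[OF cont(2)] tendsto_intros)
  qed measurable
  have lim3: "(\<lambda>n. L2_norm \<mu> (\<lambda>x. grad (\<phi> (r n)) x - wgrad E u x)) \<longlonglongrightarrow> 0"
    using \<phi> LIMSEQ_subseq_LIMSEQ[OF _ r(1)] unfolding H1_lim_def comp_def by blast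
  have lim4: "(\<lambda>n. L2_norm \<mu> (\<lambda>x. grad (\<lambda>x. bump (\<phi> (r n) x - M)) x - deriv bump (u x - M) *\<^sub>R wgrad E u x)) \<longlonglongrightarrow> 0"
  proof (rule tendsto_zero_bound)
    let ?c = "\<lambda>n x. deriv bump (\<phi> (r n) x - M)"
    have cm: "?c n \<in> borel_measurable \<mu>" and cb: "\<bar>?c n x\<bar> \<le> 2" for n x
      using deriv_bump_range by (measurable, simp)
    have gr: "grad (\<lambda>x. bump (\<phi> (r n) x - M)) x = ?c n x *\<^sub>R grad (\<phi> (r n)) x" for n x
      using grad_comp[OF smooth_bump smooth_diff[OF sm smooth_const]] grad_diff[OF sm smooth_const]
      by (simp add: grad_const)
    have L: "(\<lambda>x. ?c n x *\<^sub>R grad (\<phi> (r n)) x) \<in> L2_space \<mu>"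
      "(\<lambda>x. ?c n x *\<^sub>R wgrad E u x) \<in> L2_space \<mu>" for n
      by (intro L2_bounded_scaleR(1)[OF cm _ cb] smooth_grad_L2 sm wgrad_L2 u)+
    have "\<bar>deriv bump (u x - M)\<bar> \<le> 2" for x using deriv_bump_range[of "u x - M"] by simp
    then have L': "(\<lambda>x. deriv bump (u x - M) *\<^sub>R wgrad E u x) \<in> L2_space \<mu>"
      by (intro L2_bounded_scaleR(1)[of _ _ _ 2] wgrad_L2 u) measurable
    have step: "L2_norm \<mu> (\<lambda>x. ?c n x *\<^sub>R grad (\<phi> (r n)) x - ?c n x *\<^sub>R wgrad E u x)
        \<le> 2 * L2_norm \<mu> (\<lambda>x. grad (\<phi> (r n)) x - wgrad E u x)" for n
      using L2_bounded_scaleR(2)[OF cm L2_diff[OF smooth_grad_L2[OF sm] wgrad_L2[OF u]] cb]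
      by (simp add: scaleR_diff_right)
    show "\<bar>L2_norm \<mu> (\<lambda>x. grad (\<lambda>x. bump (\<phi> (r n) x - M)) x - deriv bump (u x - M) *\<^sub>R wgrad E u x)\<bar>
      \<le> 2 * L2_norm \<mu> (\<lambda>x. grad (\<phi> (r n)) x - wgrad E u x) +
        L2_norm \<mu> (\<lambda>x. ?c n x *\<^sub>R wgrad E u x - deriv bump (u x - M) *\<^sub>R wgrad E u x)" for n
      using L2_triangle_diff[OF L(1)[of n] L(2)[of n] L'] step[of n]
      unfolding gr abs_of_nonneg[OF L2_norm_nonneg] by linarith
    have "(\<lambda>n. 2 * L2_norm \<mu> (\<lambda>x. grad (\<phi> (r n)) x - wgrad E u x) +
        L2_norm \<mu> (\<lambda>x. ?c n x *\<^sub>R wgrad E u x - deriv bump (u x - M) *\<^sub>R wgrad E u x)) \<longlonglongrightarrow> 2 * 0 + 0"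
      by (intro tendsto_intros lim2 lim3)
    then show "(\<lambda>n. 2 * L2_norm \<mu> (\<lambda>x. grad (\<phi> (r n)) x - wgrad E u x) +
        L2_norm \<mu> (\<lambda>x. ?c n x *\<^sub>R wgrad E u x - deriv bump (u x - M) *\<^sub>R wgrad E u x)) \<longlonglongrightarrow> 0"
      by simp
  qed
  show ?thesis by (rule that[OF r(1) lim1 lim4])
qed

end

section \<open>Skew coordinates in the plane and the trace inequality on strips\<close>

lemma nn_integral_lborel_real2:
  fixes g :: "real^2 \<Rightarrow> ennreal"
  assumes [measurable]: "g \<in> borel_measurable borel"
  shows "(\<integral>\<^sup>+x. g x \<partial>lborel) = (\<integral>\<^sup>+y. \<integral>\<^sup>+x. g (vector [x, y]) \<partial>lborel \<partial>lborel)"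
proof -
  let ?f = "\<lambda>z::real \<times> real. vector [fst z, snd z] :: real^2"
  have vec: "(vector [a, b] :: real^2) = a *\<^sub>R axis 1 1 + b *\<^sub>R axis 2 1" for a b :: real
    by (simp add: vec_eq_iff forall_2 axis_def)
  have fm [measurable]: "?f \<in> (lborel \<Otimes>\<^sub>M lborel) \<rightarrow>\<^sub>M borel"
    unfolding vec by measurable
  have Basis2: "(Basis :: (real^2) set) = {axis 1 1, axis 2 1}"
    by (auto simp: Basis_vec_def UNIV_2)
  have ax: "(axis 1 1 :: real^2) \<noteq> axis 2 1" by (simp add: axis_eq_axis)
  have "lborel = distr (lborel \<Otimes>\<^sub>M lborel) borel ?f"
  proof (rule lborel_eqI)
    fix l u :: "real^2"
    assume lu: "\<And>b. b \<in> Basis \<Longrightarrow> l \<bullet> b \<le> u \<bullet> b"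
    have le: "l $ 1 \<le> u $ 1" "l $ 2 \<le> u $ 2"
      using lu[of "axis 1 1"] lu[of "axis 2 1"] by (simp_all add: Basis2 inner_axis)
    have pre: "?f -` box l u \<inter> space (lborel \<Otimes>\<^sub>M lborel) = {l$1<..<u$1} \<times> {l$2<..<u$2}"
      by (auto simp: mem_box Basis2 inner_axis space_pair_measure)
    have "emeasure (distr (lborel \<Otimes>\<^sub>M lborel) borel ?f) (box l u) = emeasure (lborel \<Otimes>\<^sub>M lborel) ({l$1<..<u$1} \<times> {l$2<..<u$2})"
      by (subst emeasure_distr) (auto simp: pre)
    also have "\<dots> = emeasure lborel {l$1<..<u$1} * emeasure lborel {l$2<..<u$2}"
      by (subst lborel.emeasure_pair_measure_Times) auto
    also have "\<dots> = ennreal ((u$1 - l$1) * (u$2 - l$2))"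
      using le by (simp add: ennreal_mult)
    also have "\<dots> = (\<Prod>b\<in>Basis. (u - l) \<bullet> b)"
      using ax by (simp add: Basis2 inner_axis)
    finally show "emeasure (distr (lborel \<Otimes>\<^sub>M lborel) borel ?f) (box l u) = (\<Prod>b\<in>Basis. (u - l) \<bullet> b)" .
  qed simp
  then have "(\<integral>\<^sup>+x. g x \<partial>lborel) = (\<integral>\<^sup>+x. g x \<partial>distr (lborel \<Otimes>\<^sub>M lborel) borel ?f)"
    by simp
  also have "\<dots> = (\<integral>\<^sup>+z. g (?f z) \<partial>(lborel \<Otimes>\<^sub>M lborel))"
    by (rule nn_integral_distr) measurable
  also have "\<dots> = (\<integral>\<^sup>+y. \<integral>\<^sup>+x. g (vector [x, y]) \<partial>lborel \<partial>lborel)"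
    by (subst lborel_pair.nn_integral_snd[symmetric]) (auto simp: case_prod_beta)
  finally show ?thesis .
qed

lemma nn_integral_scale:
  fixes f :: "real \<Rightarrow> ennreal"
  assumes "f \<in> borel_measurable borel" "c \<noteq> 0"
  shows "(\<integral>\<^sup>+x. f (t + c * x) \<partial>lborel) = ennreal (1 / \<bar>c\<bar>) * (\<integral>\<^sup>+x. f x \<partial>lborel)"
proof -
  have "ennreal (1 / \<bar>c\<bar>) * (\<integral>\<^sup>+x. f x \<partial>lborel) = ennreal (1 / \<bar>c\<bar>) * (ennreal \<bar>c\<bar> * (\<integral>\<^sup>+x. f (t + c * x) \<partial>lborel))"
    by (subst nn_integral_real_affine[OF assms, of t]) simp
  also have "\<dots> = (\<integral>\<^sup>+x. f (t + c * x) \<partial>lborel)"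
    using assms(2) by (simp add: mult.assoc[symmetric] ennreal_mult[symmetric])
  finally show ?thesis by simp
qed

text \<open>The affine change of variables is carried out by Fubini and two one-dimensional
  substitutions. Since the first substitution divides by the second component of \<open>m\<close>, a
  vector \<open>m\<close> parallel to the first axis is a separate case.\<close>

lemma nn_integral_parallelogram:
  fixes g :: "real^2 \<Rightarrow> ennreal" and p d m :: "real^2"
  assumes [measurable]: "g \<in> borel_measurable borel" and D: "d$1 * m$2 - d$2 * m$1 \<noteq> 0"
  shows "(\<integral>\<^sup>+s. \<integral>\<^sup>+t. g (p + s *\<^sub>R d + t *\<^sub>R m) \<partial>lborel \<partial>lborel)
    = ennreal (1 / \<bar>d$1 * m$2 - d$2 * m$1\<bar>) * (\<integral>\<^sup>+x. g x \<partial>lborel)"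
proof -
  let ?D = "d$1 * m$2 - d$2 * m$1"
  have vec: "(vector [a, b] :: real^2) = a *\<^sub>R axis 1 1 + b *\<^sub>R axis 2 1" for a b :: real
    by (simp add: vec_eq_iff forall_2 axis_def)
  have [measurable]: "(\<lambda>z::real\<times>real. g (vector [fst z, snd z])) \<in> borel_measurable (lborel \<Otimes>\<^sub>M lborel)"
    unfolding vec by measurable
  have G: "(\<lambda>t. g (vector [a t, b t])) \<in> borel_measurable M"
    if [measurable]: "a \<in> borel_measurable M" "b \<in> borel_measurable M" for a b :: "'c \<Rightarrow> real" and M
    unfolding vec by measurable
  have meas_inner [measurable]: "(\<lambda>y. \<integral>\<^sup>+x. g (vector [x, y]) \<partial>lborel) \<in> borel_measurable borel"
    by (rule lborel.borel_measurable_nn_integral) (unfold case_prod_beta, intro G; measurable)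
  have pt: "p + s *\<^sub>R d + t *\<^sub>R m = vector [p$1 + s * d$1 + t * m$1, p$2 + s * d$2 + t * m$2]" for s t
    by (simp add: vec_eq_iff forall_2)
  show ?thesis
  proof (cases "m$2 = 0")
    case False
    \<comment> \<open>For fixed \<open>s\<close> the second coordinate y replaces \<open>t\<close>.
      Solving for the first coordinate leaves \<open>s\<close> with the coefficient
      \<open>?D / m$2\<close>.\<close>
    define h where "h s y = g (vector [p$1 + m$1 * (y - p$2) / m$2 + (?D / m$2) * s, y])" for s y
    have [measurable]: "(\<lambda>y. h s y) \<in> borel_measurable borel" "(\<lambda>s. h s y) \<in> borel_measurable borel"
       "(\<lambda>(s, y). h s y) \<in> borel_measurable (lborel \<Otimes>\<^sub>M lborel)" for s y
      unfolding h_def case_prod_beta by (intro G; measurable)+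
    have "(\<integral>\<^sup>+t. g (p + s *\<^sub>R d + t *\<^sub>R m) \<partial>lborel) = ennreal (1 / \<bar>m$2\<bar>) * (\<integral>\<^sup>+y. h s y \<partial>lborel)" for s
    proof -
      have "g (p + s *\<^sub>R d + t *\<^sub>R m) = h s ((p$2 + s * d$2) + m$2 * t)" for t
      proof -
        have e1: "p$1 + s * d$1 + t * m$1 = p$1 + m$1 * (((p$2 + s * d$2) + m$2 * t) - p$2) / m$2 + (?D / m$2) * s"
          using False by (simp add: field_simps)
        show ?thesis unfolding pt h_def e1 by (simp add: mult.commute)
      qed
      then show ?thesis
        using nn_integral_scale[of "h s" "m$2" "p$2 + s * d$2"] False by simp
    qed
    then have "(\<integral>\<^sup>+s. \<integral>\<^sup>+t. g (p + s *\<^sub>R d + t *\<^sub>R m) \<partial>lborel \<partial>lborel)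
      = (\<integral>\<^sup>+s. ennreal (1 / \<bar>m$2\<bar>) * (\<integral>\<^sup>+y. h s y \<partial>lborel) \<partial>lborel)" by simp
    also have "\<dots> = ennreal (1 / \<bar>m$2\<bar>) * (\<integral>\<^sup>+s. \<integral>\<^sup>+y. h s y \<partial>lborel \<partial>lborel)"
      by (rule nn_integral_cmult) measurable
    also have "(\<integral>\<^sup>+s. \<integral>\<^sup>+y. h s y \<partial>lborel \<partial>lborel) = (\<integral>\<^sup>+y. \<integral>\<^sup>+s. h s y \<partial>lborel \<partial>lborel)"
      by (rule lborel_pair.Fubini'[symmetric]) measurable
    also have "\<dots> = (\<integral>\<^sup>+y. ennreal (\<bar>m$2\<bar> / \<bar>?D\<bar>) * (\<integral>\<^sup>+x. g (vector [x, y]) \<partial>lborel) \<partial>lborel)"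
    proof (rule nn_integral_cong)
      fix y
      show "(\<integral>\<^sup>+s. h s y \<partial>lborel) = ennreal (\<bar>m$2\<bar> / \<bar>?D\<bar>) * (\<integral>\<^sup>+x. g (vector [x, y]) \<partial>lborel)"
        unfolding h_def using False D
        by (subst nn_integral_scale[of "\<lambda>x. g (vector [x, y])"]) (auto intro!: G)
    qed
    also have "\<dots> = ennreal (\<bar>m$2\<bar> / \<bar>?D\<bar>) * (\<integral>\<^sup>+x. g x \<partial>lborel)"
      by (subst nn_integral_cmult) (simp_all add: nn_integral_lborel_real2 meas_inner)
    finally show ?thesis
      using False by (simp add: mult.assoc[symmetric] ennreal_mult[symmetric])
  next
    \<comment> \<open>Now the second coordinate does not depend on \<open>t\<close>, and the
      determinant reduces to \<open>- d$2 * m$1\<close>, so the two scalings are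
      independent.\<close>
    case True
    then have nz: "m$1 \<noteq> 0" "d$2 \<noteq> 0" using D by auto
    have "(\<integral>\<^sup>+t. g (p + s *\<^sub>R d + t *\<^sub>R m) \<partial>lborel) = ennreal (1 / \<bar>m$1\<bar>) * (\<integral>\<^sup>+x. g (vector [x, p$2 + d$2 * s]) \<partial>lborel)" for s
    proof -
      have "g (p + s *\<^sub>R d + t *\<^sub>R m) = g (vector [(p$1 + s * d$1) + m$1 * t, p$2 + d$2 * s])" for t
        by (simp add: pt True mult.commute)
      then show ?thesis
        using nn_integral_scale[of "\<lambda>x. g (vector [x, p$2 + d$2 * s])" "m$1" "p$1 + s * d$1"] nz
        by (simp add: G)
    qed
    then have "(\<integral>\<^sup>+s. \<integral>\<^sup>+t. g (p + s *\<^sub>R d + t *\<^sub>R m) \<partial>lborel \<partial>lborel)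
      = (\<integral>\<^sup>+s. ennreal (1 / \<bar>m$1\<bar>) * (\<integral>\<^sup>+x. g (vector [x, p$2 + d$2 * s]) \<partial>lborel) \<partial>lborel)" by simp
    also have "\<dots> = ennreal (1 / \<bar>d$2\<bar>) * (\<integral>\<^sup>+y. ennreal (1 / \<bar>m$1\<bar>) * (\<integral>\<^sup>+x. g (vector [x, y]) \<partial>lborel) \<partial>lborel)"
      by (rule nn_integral_scale[of "\<lambda>y. ennreal (1 / \<bar>m$1\<bar>) * (\<integral>\<^sup>+x. g (vector [x, y]) \<partial>lborel)"])
        (simp_all add: nz)
    also have "\<dots> = ennreal (1 / \<bar>d$2\<bar>) * (ennreal (1 / \<bar>m$1\<bar>) * (\<integral>\<^sup>+x. g x \<partial>lborel))"
      by (subst nn_integral_cmult) (simp_all add: nn_integral_lborel_real2 meas_inner)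
    finally show ?thesis
      using True nz by (simp add: mult.assoc[symmetric] ennreal_mult[symmetric] abs_mult)
  qed
qed

text \<open>The fundamental theorem of calculus and Cauchy-Schwarz bound the squared increment from
  0 by \<open>e\<close> times the integral of the squared derivative; a further integration over the
  interval gives the powers of \<open>e\<close>.\<close>

lemma trace_inequality_1d:
  fixes f f' :: "real \<Rightarrow> real"
  assumes f: "\<And>t. (f has_field_derivative f' t) (at t)" and f': "continuous_on UNIV f'"
    and e: "0 < e"
  shows "(\<integral>\<^sup>+t. indicator {0<..e} t * ennreal ((f t)\<^sup>2) \<partial>lborel)
    \<le> ennreal (2 * e * (f 0)\<^sup>2) + ennreal (2 * e\<^sup>2) * (\<integral>\<^sup>+t. indicator {0<..e} t * ennreal ((f' t)\<^sup>2) \<partial>lborel)"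
proof -
  have [measurable]: "f' \<in> borel_measurable borel" using f' by (rule borel_measurable_continuous_onI)
  have fc: "continuous_on UNIV f" using f by (meson DERIV_isCont continuous_at_imp_continuous_on)
  have [measurable]: "f \<in> borel_measurable borel" using fc by (rule borel_measurable_continuous_onI)
  let ?I = "\<integral>t. (f' t)\<^sup>2 * indicator {0..e} t \<partial>lborel"
  have intI: "integrable lborel (\<lambda>t. (f' t)\<^sup>2 * indicator {0..e} t)"
    using borel_integrable_atLeastAtMost'[of 0 e "\<lambda>t. (f' t)\<^sup>2"] f'
    by (auto simp: set_integrable_def mult.commute intro!: continuous_intros continuous_on_subset[OF f'])
  have I0: "0 \<le> ?I" by (intro integral_nonneg_AE) auto
  have pt: "(f t)\<^sup>2 \<le> 2 * (f 0)\<^sup>2 + 2 * e * ?I" if t: "0 < t" "t \<le> e" for t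
  proof -
    let ?M = "restrict_space lborel {0..t}"
    have fin: "finite_measure ?M"
      using t by (intro finite_measureI) (simp add: emeasure_restrict_space)
    have M: "f' \<in> borel_measurable ?M" by (intro measurable_restrict_space1) simp
    obtain B where B: "\<And>x. x \<in> {0..t} \<Longrightarrow> norm (f' x) \<le> B"
      using continuous_bounded_on_compact[OF f', of "{0..t}"] by (metis compact_Icc)
    then have f'L2: "f' \<in> L2_space ?M"
      by (intro L2_bounded(1)[OF fin M]) (auto simp: AE_restrict_space_iff)
    have oneL2: "(\<lambda>_. 1::real) \<in> L2_space ?M"
      by (intro L2_bounded(1)[OF fin, of _ 1]) auto
    have "(\<integral>x. f' x * indicator {0..t} x \<partial>lborel) = f t - f 0"
      using t f f' by (intro integral_FTC_Icc_real) (auto simp: continuous_on_eq_continuous_at)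
    then have "f t - f 0 = (\<integral>x. f' x \<bullet> 1 \<partial>?M)"
      by (simp add: integral_restrict_space mult.commute)
    then have "\<bar>f t - f 0\<bar> \<le> L2_norm ?M f' * L2_norm ?M (\<lambda>_. 1::real)"
      using L2_Cauchy_Schwarz[OF f'L2 oneL2] by simp
    then have "(f t - f 0)\<^sup>2 \<le> (L2_norm ?M f' * L2_norm ?M (\<lambda>_. 1::real))\<^sup>2"
      using power_mono[of "\<bar>f t - f 0\<bar>" _ 2] by simp
    also have "\<dots> = (\<integral>x. (f' x)\<^sup>2 * indicator {0..t} x \<partial>lborel) * t"
      using t by (simp add: power_mult_distrib L2_norm_sq integral_restrict_space measure_restrict_space mult.commute)
    also have "\<dots> \<le> ?I * e"
    proof (intro mult_mono I0)
      have "integrable lborel (\<lambda>x. (f' x)\<^sup>2 * indicator {0..t} x)"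
        by (rule Bochner_Integration.integrable_bound[OF intI]) (use t in \<open>auto simp: indicator_def\<close>)
      then show "(\<integral>x. (f' x)\<^sup>2 * indicator {0..t} x \<partial>lborel) \<le> ?I"
        using t by (intro integral_mono intI) (auto simp: indicator_def)
    qed (use t in auto)
    finally have *: "(f t - f 0)\<^sup>2 \<le> e * ?I" by (simp add: mult.commute)
    \<comment> \<open>The difference of the two sides is the square of
      \<open>f t - 2 * f 0\<close>.\<close>
    have "(f t)\<^sup>2 \<le> 2 * (f 0)\<^sup>2 + 2 * (f t - f 0)\<^sup>2"
      using zero_le_power2[of "f t - 2 * f 0"] by (simp add: power2_eq_square algebra_simps)
    with * show ?thesis by (simp add: mult.assoc)
  qed
  have "(\<integral>\<^sup>+t. indicator {0<..e} t * ennreal ((f t)\<^sup>2) \<partial>lborel) \<le> (\<integral>\<^sup>+t. indicator {0<..e} t * ennreal (2 * (f 0)\<^sup>2 + 2 * e * ?I) \<partial>lborel)"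
  proof (rule nn_integral_mono)
    show "indicator {0<..e} t * ennreal ((f t)\<^sup>2) \<le> indicator {0<..e} t * ennreal (2 * (f 0)\<^sup>2 + 2 * e * ?I)" for t
      by (cases "t \<in> {0<..e}") (use pt[of t, THEN ennreal_leI] in simp_all)
  qed
  also have "\<dots> = ennreal (2 * (f 0)\<^sup>2 + 2 * e * ?I) * ennreal e"
    using e by (subst nn_integral_multc) (auto simp: mult.commute)
  also have "\<dots> = ennreal (2 * e * (f 0)\<^sup>2 + 2 * e\<^sup>2 * ?I)"
    using e I0 by (subst ennreal_mult[symmetric]) (auto simp: algebra_simps power2_eq_square)
  also have "\<dots> = ennreal (2 * e * (f 0)\<^sup>2) + ennreal (2 * e\<^sup>2) * ennreal ?I"
    using e I0 by (simp add: ennreal_plus ennreal_mult)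
  also have "ennreal ?I = (\<integral>\<^sup>+t. ennreal ((f' t)\<^sup>2 * indicator {0..e} t) \<partial>lborel)"
    using intI by (intro nn_integral_eq_integral[symmetric]) auto
  also have "\<dots> = (\<integral>\<^sup>+t. indicator {0<..e} t * ennreal ((f' t)\<^sup>2) \<partial>lborel)"
  proof (rule nn_integral_cong_AE)
    have "AE t in lborel. t \<noteq> (0::real)" by (rule AE_lborel_singleton)
    then show "AE t in lborel. ennreal ((f' t)\<^sup>2 * indicator {0..e} t) = indicator {0<..e} t * ennreal ((f' t)\<^sup>2)"
      by eventually_elim (auto simp: indicator_def)
  qed
  finally show ?thesis .
qed

text \<open>Height 0 is left out so that a strip based on an edge can be disjoint from the boundary;
  the margin \<open>r\<close> keeps it away from the end points, where other edges meet.\<close>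

definition strip :: "real^2 \<Rightarrow> real^2 \<Rightarrow> real^2 \<Rightarrow> real \<Rightarrow> real \<Rightarrow> (real^2) set" where
  "strip p d m r e = (\<lambda>(s, t). p + s *\<^sub>R d + t *\<^sub>R m) ` ({r..1 - r} \<times> {0<..e})"

lemma strip_coordinates:
  fixes d m :: "real^2"
  assumes D: "d$1 * m$2 - d$2 * m$1 \<noteq> 0"
  shows "p + s *\<^sub>R d + t *\<^sub>R m \<in> strip p d m r e \<longleftrightarrow> s \<in> {r..1 - r} \<and> t \<in> {0<..e}"
proof -
  have "s = s' \<and> t = t'" if eq: "p + s *\<^sub>R d + t *\<^sub>R m = p + s' *\<^sub>R d + t' *\<^sub>R m" for s' t'
  proof -
    have "(s - s') * d$1 + (t - t') * m$1 = 0" "(s - s') * d$2 + (t - t') * m$2 = 0"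
      using eq by (simp_all add: vec_eq_iff forall_2 algebra_simps)
    \<comment> \<open>Elimination as in Cramer's rule: either unknown times the determinant is
      zero.\<close>
    then have "(s - s') * (d$1 * m$2 - d$2 * m$1) = 0" "(t - t') * (d$1 * m$2 - d$2 * m$1) = 0"
      by algebra+
    then show ?thesis using D by simp
  qed
  note inj = this
  show ?thesis
  proof
    assume "p + s *\<^sub>R d + t *\<^sub>R m \<in> strip p d m r e"
    then obtain s' t' where "s' \<in> {r..1 - r}" "t' \<in> {0<..e}" "p + s *\<^sub>R d + t *\<^sub>R m = p + s' *\<^sub>R d + t' *\<^sub>R m"
      unfolding strip_def by (elim imageE SigmaE) simp
    with inj[of s' t'] show "s \<in> {r..1 - r} \<and> t \<in> {0<..e}" by simp
  next
    assume "s \<in> {r..1 - r} \<and> t \<in> {0<..e}"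
    then show "p + s *\<^sub>R d + t *\<^sub>R m \<in> strip p d m r e"
      unfolding strip_def by (intro image_eqI[of _ _ "(s, t)"]) auto
  qed
qed

lemma strip_borel:
  assumes D: "d$1 * m$2 - d$2 * m$1 \<noteq> 0"
  shows "strip p d m r e \<in> sets borel"
proof -
  let ?D = "d$1 * m$2 - d$2 * m$1"
  let ?s = "\<lambda>x::real^2. ((x$1 - p$1) * m$2 - (x$2 - p$2) * m$1) / ?D"
  let ?t = "\<lambda>x::real^2. ((x$2 - p$2) * d$1 - (x$1 - p$1) * d$2) / ?D"
  have x: "x = p + ?s x *\<^sub>R d + ?t x *\<^sub>R m" for x
  proof -
    have "?s x * d$1 + ?t x * m$1 = ((x$1 - p$1) * ?D) / ?D"
      unfolding times_divide_eq_left add_divide_distrib[symmetric] by (rule arg_cong2[of _ _ _ _ "(/)"]) (simp_all add: algebra_simps)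
    moreover have "?s x * d$2 + ?t x * m$2 = ((x$2 - p$2) * ?D) / ?D"
      unfolding times_divide_eq_left add_divide_distrib[symmetric] by (rule arg_cong2[of _ _ _ _ "(/)"]) (simp_all add: algebra_simps)
    ultimately have "?s x * d$1 + ?t x * m$1 = x$1 - p$1" "?s x * d$2 + ?t x * m$2 = x$2 - p$2"
      using D by simp_all
    then show ?thesis by (simp only: vec_eq_iff forall_2 vector_add_component vector_scaleR_component real_scaleR_def) linarith
  qed
  have "x \<in> strip p d m r e \<longleftrightarrow> ?s x \<in> {r..1 - r} \<and> ?t x \<in> {0<..e}" for x
    using strip_coordinates[OF D, of p "?s x" "?t x" r e] x[of x] by simp
  then have "strip p d m r e = {x \<in> space borel. ?s x \<in> {r..1 - r} \<and> ?t x \<in> {0<..e}}" by auto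
  also have "\<dots> \<in> sets borel" by measurable
  finally show ?thesis .
qed

text \<open>The one-dimensional inequality is integrated over all segments across the strip. The
  determinant is the Jacobian: it remains in the trace term, which is an integral over the parameter
  \<open>s\<close>, and is used up in the gradient term, which is turned back into an area integral.
  Enlarging the range of \<open>s\<close> to the full edge in the trace term uses
  \<open>0 \<le> r\<close>.\<close>

lemma strip_inequality:
  fixes \<psi> :: "real^2 \<Rightarrow> real" and d m :: "real^2"
  assumes \<psi>: "smooth \<psi>" and D: "d$1 * m$2 - d$2 * m$1 \<noteq> 0" and e: "0 < e" and r: "0 \<le> r"
  shows "(\<integral>\<^sup>+x. indicator (strip p d m r e) x * ennreal ((\<psi> x)\<^sup>2) \<partial>lborel)
    \<le> ennreal (2 * e * \<bar>d$1 * m$2 - d$2 * m$1\<bar>) * (\<integral>\<^sup>+s. indicator {0..1} s * ennreal ((\<psi> (p + s *\<^sub>R d))\<^sup>2) \<partial>lborel)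
      + ennreal (2 * e\<^sup>2 * (norm m)\<^sup>2) * (\<integral>\<^sup>+x. indicator (strip p d m r e) x * ennreal ((norm (grad \<psi> x))\<^sup>2) \<partial>lborel)"
proof -
  let ?D = "\<bar>d$1 * m$2 - d$2 * m$1\<bar>"
  let ?S = "strip p d m r e"
  let ?T = "\<lambda>s t. p + s *\<^sub>R d + t *\<^sub>R m"
  have [measurable]: "\<psi> \<in> borel_measurable borel" "grad \<psi> \<in> borel_measurable borel"
    using \<psi> by (auto intro: smooth_borel smooth_grad_borel)
  have [measurable]: "?S \<in> sets borel" by (rule strip_borel[OF D])
  have D0: "0 < ?D" using D by simp
  have area: "(\<integral>\<^sup>+x. indicator ?S x * g x \<partial>lborel) = ennreal ?D * (\<integral>\<^sup>+s. indicator {r..1-r} s * (\<integral>\<^sup>+t. indicator {0<..e} t * g (?T s t) \<partial>lborel) \<partial>lborel)"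
    if [measurable]: "g \<in> borel_measurable borel" for g
  proof -
    have "(\<integral>\<^sup>+s. \<integral>\<^sup>+t. indicator ?S (?T s t) * g (?T s t) \<partial>lborel \<partial>lborel)
      = ennreal (1 / ?D) * (\<integral>\<^sup>+x. indicator ?S x * g x \<partial>lborel)"
      by (rule nn_integral_parallelogram[OF _ D]) measurable
    then have "ennreal ?D * (\<integral>\<^sup>+s. \<integral>\<^sup>+t. indicator ?S (?T s t) * g (?T s t) \<partial>lborel \<partial>lborel) = (\<integral>\<^sup>+x. indicator ?S x * g x \<partial>lborel)"
      using D0 by (simp add: mult.assoc[symmetric] ennreal_mult[symmetric])
    moreover have "(\<integral>\<^sup>+t. indicator ?S (?T s t) * g (?T s t) \<partial>lborel) = indicator {r..1-r} s * (\<integral>\<^sup>+t. indicator {0<..e} t * g (?T s t) \<partial>lborel)" for s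
    proof -
      have "indicator ?S (?T s t) * g (?T s t) = indicator {r..1-r} s * (indicator {0<..e} t * g (?T s t))" for t
        using strip_coordinates[OF D, of p s t r e] by (auto simp: indicator_def)
      then show ?thesis by (simp add: nn_integral_cmult)
    qed
    ultimately show ?thesis by simp
  qed
  have inner: "(\<integral>\<^sup>+t. indicator {0<..e} t * ennreal ((\<psi> (?T s t))\<^sup>2) \<partial>lborel)
    \<le> ennreal (2 * e) * ennreal ((\<psi> (p + s *\<^sub>R d))\<^sup>2) + ennreal (2 * e\<^sup>2 * (norm m)\<^sup>2) * (\<integral>\<^sup>+t. indicator {0<..e} t * ennreal ((norm (grad \<psi> (?T s t)))\<^sup>2) \<partial>lborel)" for s
  proof -
    have "((\<lambda>t. \<psi> (?T s t)) has_field_derivative grad \<psi> (?T s t) \<bullet> m) (at t)" for t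
    proof -
      have "((\<lambda>t. ?T s t) has_derivative (\<lambda>h. h *\<^sub>R m)) (at t)"
        by (auto intro!: derivative_eq_intros)
      from has_derivative_compose[OF this smooth_has_derivative[OF \<psi>]]
      have "((\<lambda>t. \<psi> (?T s t)) has_derivative (\<lambda>h. (grad \<psi> (?T s t) \<bullet> m) * h)) (at t)"
        by (simp add: mult.commute)
      then show ?thesis by (simp add: has_field_derivative_def)
    qed
    moreover have "continuous_on UNIV (\<lambda>t. grad \<psi> (?T s t) \<bullet> m)"
      by (rule continuous_on_compose2[OF smooth_continuous[OF smooth_grad_inner[OF \<psi>]], of UNIV])
        (auto intro!: continuous_intros)
    ultimately have "(\<integral>\<^sup>+t. indicator {0<..e} t * ennreal ((\<psi> (?T s t))\<^sup>2) \<partial>lborel)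
      \<le> ennreal (2 * e * (\<psi> (?T s 0))\<^sup>2) + ennreal (2 * e\<^sup>2) * (\<integral>\<^sup>+t. indicator {0<..e} t * ennreal ((grad \<psi> (?T s t) \<bullet> m)\<^sup>2) \<partial>lborel)"
      using e by (rule trace_inequality_1d)
    also have "\<dots> \<le> ennreal (2 * e * (\<psi> (?T s 0))\<^sup>2) + ennreal (2 * e\<^sup>2) * (\<integral>\<^sup>+t. ennreal ((norm m)\<^sup>2) * (indicator {0<..e} t * ennreal ((norm (grad \<psi> (?T s t)))\<^sup>2)) \<partial>lborel)"
    proof (intro add_left_mono mult_left_mono nn_integral_mono)
      fix t
      have "(grad \<psi> (?T s t) \<bullet> m)\<^sup>2 \<le> (norm (grad \<psi> (?T s t)) * norm m)\<^sup>2"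
        using power_mono[OF Cauchy_Schwarz_ineq2 abs_ge_zero, of "grad \<psi> (?T s t)" m 2] by simp
      then have "ennreal ((grad \<psi> (?T s t) \<bullet> m)\<^sup>2) \<le> ennreal ((norm m)\<^sup>2 * (norm (grad \<psi> (?T s t)))\<^sup>2)"
        by (intro ennreal_leI) (simp add: power_mult_distrib mult.commute)
      then show "indicator {0<..e} t * ennreal ((grad \<psi> (?T s t) \<bullet> m)\<^sup>2) \<le> ennreal ((norm m)\<^sup>2) * (indicator {0<..e} t * ennreal ((norm (grad \<psi> (?T s t)))\<^sup>2))"
        by (auto simp: indicator_def ennreal_mult)
    qed simp
    also have "\<dots> = ennreal (2 * e) * ennreal ((\<psi> (p + s *\<^sub>R d))\<^sup>2) + ennreal (2 * e\<^sup>2 * (norm m)\<^sup>2) * (\<integral>\<^sup>+t. indicator {0<..e} t * ennreal ((norm (grad \<psi> (?T s t)))\<^sup>2) \<partial>lborel)"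
      using e by (subst nn_integral_cmult) (simp_all add: ennreal_mult mult.assoc)
    finally show ?thesis .
  qed
  have "(\<integral>\<^sup>+x. indicator ?S x * ennreal ((\<psi> x)\<^sup>2) \<partial>lborel)
    = ennreal ?D * (\<integral>\<^sup>+s. indicator {r..1-r} s * (\<integral>\<^sup>+t. indicator {0<..e} t * ennreal ((\<psi> (?T s t))\<^sup>2) \<partial>lborel) \<partial>lborel)"
    by (rule area) measurable
  also have "\<dots> \<le> ennreal ?D * (\<integral>\<^sup>+s. ennreal (2 * e) * (indicator {0..1} s * ennreal ((\<psi> (p + s *\<^sub>R d))\<^sup>2))
      + ennreal (2 * e\<^sup>2 * (norm m)\<^sup>2) * (indicator {r..1-r} s * (\<integral>\<^sup>+t. indicator {0<..e} t * ennreal ((norm (grad \<psi> (?T s t)))\<^sup>2) \<partial>lborel)) \<partial>lborel)"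
    using inner r by (intro mult_left_mono nn_integral_mono) (auto simp: indicator_def)
  also have "\<dots> = ennreal ?D * (ennreal (2 * e) * (\<integral>\<^sup>+s. indicator {0..1} s * ennreal ((\<psi> (p + s *\<^sub>R d))\<^sup>2) \<partial>lborel)
      + ennreal (2 * e\<^sup>2 * (norm m)\<^sup>2) * (\<integral>\<^sup>+s. indicator {r..1-r} s * (\<integral>\<^sup>+t. indicator {0<..e} t * ennreal ((norm (grad \<psi> (?T s t)))\<^sup>2) \<partial>lborel) \<partial>lborel))"
    by (subst nn_integral_add) (auto simp: nn_integral_cmult case_prod_beta)
  also have "\<dots> = ennreal (2 * e * ?D) * (\<integral>\<^sup>+s. indicator {0..1} s * ennreal ((\<psi> (p + s *\<^sub>R d))\<^sup>2) \<partial>lborel)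
      + ennreal (2 * e\<^sup>2 * (norm m)\<^sup>2) * (\<integral>\<^sup>+x. indicator ?S x * ennreal ((norm (grad \<psi> x))\<^sup>2) \<partial>lborel)"
  proof -
    have "ennreal (2 * e * ?D) = ennreal ?D * ennreal (2 * e)"
      using e by (subst mult.commute) (simp add: ennreal_mult)
    then have 1: "ennreal ?D * (ennreal (2 * e) * X) = ennreal (2 * e * ?D) * X" for X
      by (simp only: mult.assoc)
    have 2: "ennreal ?D * (c * X) = c * (ennreal ?D * X)" for c X by (simp add: mult.left_commute)
    have 3: "ennreal ?D * (\<integral>\<^sup>+s. indicator {r..1-r} s * (\<integral>\<^sup>+t. indicator {0<..e} t * ennreal ((norm (grad \<psi> (?T s t)))\<^sup>2) \<partial>lborel) \<partial>lborel)
      = (\<integral>\<^sup>+x. indicator ?S x * ennreal ((norm (grad \<psi> x))\<^sup>2) \<partial>lborel)"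
      by (rule area[symmetric]) measurable
    show ?thesis unfolding distrib_left 1 by (subst 2, subst 3) simp
  qed
  finally show ?thesis .
qed

section \<open>Cutoff functions near the boundary\<close>

text \<open>Since \<open>g\<close> vanishes on the open set \<open>U\<close> around the frontier, so
  does its gradient. The class of functions glued to 0 in this way is therefore closed under
  directional derivatives, which is what coinduction requires.\<close>

lemma smooth_if:
  assumes E: "open E" and U: "open U" "frontier E \<subseteq> U"
    and g: "smooth g" "\<And>x. x \<in> U \<Longrightarrow> g x = 0"
  shows "smooth (\<lambda>x. if x \<in> E then g x else 0)"
proof -
  have "\<exists>g. f = (\<lambda>x. if x \<in> E then g x else 0) \<and> smooth g \<and> (\<forall>x\<in>U. g x = 0) \<Longrightarrow> smooth f" for f
  proof (coinduction arbitrary: f rule: smooth.coinduct)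
    case (smooth f)
    then obtain g where f: "f = (\<lambda>x. if x \<in> E then g x else 0)" and g: "smooth g" "\<And>x. x \<in> U \<Longrightarrow> g x = 0"
      by blast
    have g0: "grad g x = 0" if "x \<in> U" for x
      using grad_eq_0_outside[of "- U" g 0 x] U g(2) that by auto
    have "(f has_derivative (\<lambda>h. if x \<in> E then grad g x \<bullet> h else 0)) (at x)" for x
    proof -
      \<comment> \<open>Three open sets cover the plane of arguments, and on each of them
        \<open>f\<close> is locally a smooth function: 0, \<open>g\<close> and 0.\<close>
      consider "x \<in> U" | "x \<in> E" | "x \<notin> closure E" using U(2) by (auto simp: frontier_def interior_open[OF E])
      then show ?thesis
      proof cases
        case 1
        have "((\<lambda>_. 0) has_derivative (\<lambda>h. if x \<in> E then grad g x \<bullet> h else 0)) (at x)"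
          using g0[OF 1] by (cases "x \<in> E") simp_all
        then show ?thesis
          by (rule has_derivative_transform_within_open[OF _ U(1) 1]) (simp add: f g(2))
      next
        case 2
        then show ?thesis
          using has_derivative_transform_within_open[OF smooth_has_derivative[OF g(1), of x] E 2, of f] by (simp add: f)
      next
        case 3
        then have "x \<notin> E" using closure_subset by blast
        then have "((\<lambda>_. 0) has_derivative (\<lambda>h. if x \<in> E then grad g x \<bullet> h else 0)) (at x)" by simp
        moreover have "open (- closure E)" by (rule open_Compl[OF closed_closure])
        ultimately show ?thesis
          by (rule has_derivative_transform_within_open[of _ _ _ _ "- closure E"])
            (use 3 closure_subset[of E] in \<open>auto simp: f\<close>)
      qed
    qed
    moreover have "smooth (\<lambda>x. grad g x \<bullet> h)" for h by (rule smooth_grad_inner[OF g(1)])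
    ultimately show ?case
      using g0
      by (intro exI[of _ f] exI[of _ "\<lambda>x h. if x \<in> E then grad g x \<bullet> h else 0"])
        (auto intro!: exI[of _ "\<lambda>x. grad g x \<bullet> h" for h])
  qed
  then show ?thesis using g by blast
qed

text \<open>Factors with values in the unit interval never increase an error already made. So each
  factor contributes its own gradient times \<bar>\<psi>\<bar>, with no constant growing with the
  number of factors.\<close>

lemma grad_prod_error:
  assumes "finite J" "smooth \<psi>" "\<And>j. j \<in> J \<Longrightarrow> smooth (c j)" "\<And>j x. j \<in> J \<Longrightarrow> c j x \<in> {0..1}"
  shows "norm (grad (\<lambda>x. \<psi> x * (\<Prod>j\<in>J. c j x)) x - (\<Prod>j\<in>J. c j x) *\<^sub>R grad \<psi> x)
    \<le> \<bar>\<psi> x\<bar> * (\<Sum>j\<in>J. norm (grad (c j) x))"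
  using assms
proof (induction J rule: finite_induct)
  case empty
  then show ?case by simp
next
  case (insert i J)
  let ?P = "\<lambda>x. \<Prod>j\<in>J. c j x"
  have sP: "smooth ?P" using insert by (intro smooth_prod) auto
  have ci: "smooth (c i)" "c i x \<in> {0..1}" using insert by auto
  have P01: "0 \<le> ?P x" "?P x \<le> 1" using insert.prems(3) by (auto intro!: prod_nonneg prod_le_1)
  have feq: "(\<lambda>x. \<psi> x * (\<Prod>j\<in>insert i J. c j x)) = (\<lambda>x. c i x * (\<psi> x * ?P x))"
    using insert by (simp add: ac_simps)
  have "grad (\<lambda>x. \<psi> x * (\<Prod>j\<in>insert i J. c j x)) x - (\<Prod>j\<in>insert i J. c j x) *\<^sub>R grad \<psi> x
    = c i x *\<^sub>R (grad (\<lambda>x. \<psi> x * ?P x) x - ?P x *\<^sub>R grad \<psi> x) + (\<psi> x * ?P x) *\<^sub>R grad (c i) x"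
    unfolding feq grad_mult[OF ci(1) smooth_mult[OF insert.prems(1) sP]]
    using insert.hyps by (simp add: algebra_simps)
  also have "norm \<dots> \<le> norm (c i x *\<^sub>R (grad (\<lambda>x. \<psi> x * ?P x) x - ?P x *\<^sub>R grad \<psi> x)) + norm ((\<psi> x * ?P x) *\<^sub>R grad (c i) x)"
    by (rule norm_triangle_ineq)
  also have "\<dots> \<le> \<bar>\<psi> x\<bar> * (\<Sum>j\<in>J. norm (grad (c j) x)) + \<bar>\<psi> x\<bar> * norm (grad (c i) x)"
  proof (rule add_mono)
    have "norm (c i x *\<^sub>R (grad (\<lambda>x. \<psi> x * ?P x) x - ?P x *\<^sub>R grad \<psi> x)) \<le> 1 * norm (grad (\<lambda>x. \<psi> x * ?P x) x - ?P x *\<^sub>R grad \<psi> x)"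
      unfolding norm_scaleR using ci(2) by (intro mult_right_mono) auto
    also have "\<dots> \<le> \<bar>\<psi> x\<bar> * (\<Sum>j\<in>J. norm (grad (c j) x))" using insert by simp
    finally show "norm (c i x *\<^sub>R (grad (\<lambda>x. \<psi> x * ?P x) x - ?P x *\<^sub>R grad \<psi> x)) \<le> \<bar>\<psi> x\<bar> * (\<Sum>j\<in>J. norm (grad (c j) x))" .
    have "\<bar>\<psi> x * ?P x\<bar> \<le> \<bar>\<psi> x\<bar> * 1"
      unfolding abs_mult using P01 by (intro mult_left_mono) auto
    then show "norm ((\<psi> x * ?P x) *\<^sub>R grad (c i) x) \<le> \<bar>\<psi> x\<bar> * norm (grad (c i) x)"
      unfolding norm_scaleR by (intro mult_right_mono) auto
  qed
  also have "\<dots> = \<bar>\<psi> x\<bar> * (\<Sum>j\<in>insert i J. norm (grad (c j) x))"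
    using insert.hyps by (simp add: algebra_simps)
  finally show ?case .
qed

context bounded_domain
begin

lemma test_function_if:
  assumes "open U" "frontier E \<subseteq> U" "smooth g" "\<And>x. x \<in> U \<Longrightarrow> g x = 0"
  shows "(\<lambda>x. if x \<in> E then g x else 0) \<in> test_functions E"
    "x \<in> E \<Longrightarrow> grad (\<lambda>x. if x \<in> E then g x else 0) x = grad g x"
proof -
  show "(\<lambda>x. if x \<in> E then g x else 0) \<in> test_functions E"
  proof (rule test_functionsI[OF smooth_if[OF open_E assms], of "closure E - U"])
    show "compact (closure E - U)"
      using bounded_E assms(1) by (intro compact_diff) (simp_all add: compact_closure)
    show "closure E - U \<subseteq> E"
      using assms(2) by (auto simp: frontier_def interior_open[OF open_E])
  qed (use assms(4) closure_subset[of E] in auto)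
  assume x: "x \<in> E"
  show "grad (\<lambda>x. if x \<in> E then g x else 0) x = grad g x"
    by (intro grad_eqI has_derivative_transform_within_open[OF smooth_has_derivative[OF assms(3)] open_E x]) simp
qed

text \<open>The product of \<open>\<psi>\<close> with all cutoffs vanishes near the frontier and is
  admissible in the weak equation. What separates this from testing with \<open>\<psi>\<close> under
  cut-off data is the gradient of the cutoffs, and that of \<open>c j\<close> lives on
  \<open>N j\<close>, so Cauchy-Schwarz is applied on each \<open>N j\<close> separately.\<close>

lemma cutoff_estimate:
  fixes c :: "'j \<Rightarrow> 'a \<Rightarrow> real"
  assumes F: "F \<in> L2_space \<mu>" and h: "h \<in> L2_space \<mu>"
    and Fh: "\<And>\<phi>. \<phi> \<in> test_functions E \<Longrightarrow> (\<integral>x. F x \<bullet> grad \<phi> x \<partial>\<mu>) = (\<integral>x. h x * \<phi> x \<partial>\<mu>)"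
    and \<psi>: "smooth \<psi>"
    and J: "finite J" and c: "\<And>j. j \<in> J \<Longrightarrow> smooth (c j)" "\<And>j x. j \<in> J \<Longrightarrow> c j x \<in> {0..1}"
    and N: "\<And>j. j \<in> J \<Longrightarrow> closed (N j)" "\<And>j x. j \<in> J \<Longrightarrow> x \<notin> N j \<Longrightarrow> c j x = 1"
    and b: "\<And>j x. j \<in> J \<Longrightarrow> norm (grad (c j) x) \<le> b j"
    and U: "open U" "frontier E \<subseteq> U" "\<And>x. x \<in> U \<Longrightarrow> \<exists>j\<in>J. c j x = 0"
  shows "\<bar>(\<integral>x. ((\<Prod>j\<in>J. c j x) *\<^sub>R F x) \<bullet> grad \<psi> x \<partial>\<mu>) - (\<integral>x. ((\<Prod>j\<in>J. c j x) * h x) * \<psi> x \<partial>\<mu>)\<bar>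
    \<le> (\<Sum>j\<in>J. b j * (L2_norm \<mu> (\<lambda>x. indicator (N j) x *\<^sub>R F x) * L2_norm \<mu> (\<lambda>x. indicator (N j) x *\<^sub>R \<psi> x)))"
proof -
  let ?e = "\<lambda>x. \<Prod>j\<in>J. c j x"
  let ?g = "\<lambda>x. \<psi> x * ?e x"
  let ?\<theta> = "\<lambda>x. if x \<in> E then ?g x else 0"
  have se: "smooth ?e" by (intro smooth_prod c)
  have sg: "smooth ?g" by (intro smooth_mult \<psi> se)
  have g0: "?g x = 0" if "x \<in> U" for x
    using U(3)[OF that] J by (auto simp: prod_zero_iff)
  note \<theta> = test_function_if[OF U(1,2) sg g0]
  have gg: "grad ?g \<in> L2_space \<mu>" by (rule smooth_grad_L2[OF sg])
  have e01: "\<bar>?e x\<bar> \<le> 1" for x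
    using c(2) by (auto simp: abs_le_iff intro!: prod_le_1 order_trans[OF _ prod_nonneg])
  have em: "?e \<in> borel_measurable \<mu>" by (intro borel_measurable_lebesgue_on smooth_borel se)
  have eF: "(\<lambda>x. ?e x *\<^sub>R F x) \<in> L2_space \<mu>" by (rule L2_bounded_scaleR(1)[OF em F e01])
  have eG: "(\<lambda>x. ?e x *\<^sub>R grad \<psi> x) \<in> L2_space \<mu>"
    by (rule L2_bounded_scaleR(1)[OF em smooth_grad_L2[OF \<psi>] e01])
  \<comment> \<open>On \<open>E\<close> nothing changes when \<open>?g\<close> is replaced by its
    extension by 0, and only that extension is a test function.\<close>
  have "(\<integral>x. F x \<bullet> grad ?g x \<partial>\<mu>) = (\<integral>x. F x \<bullet> grad ?\<theta> x \<partial>\<mu>)"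
    by (intro Bochner_Integration.integral_cong refl) (simp add: \<theta>(2))
  also have "\<dots> = (\<integral>x. h x * ?\<theta> x \<partial>\<mu>)" by (rule Fh[OF \<theta>(1)])
  also have "\<dots> = (\<integral>x. (?e x * h x) * \<psi> x \<partial>\<mu>)"
    by (intro Bochner_Integration.integral_cong refl) (simp add: ac_simps)
  finally have 1: "(\<integral>x. F x \<bullet> grad ?g x \<partial>\<mu>) = (\<integral>x. (?e x * h x) * \<psi> x \<partial>\<mu>)" .
  have 2: "(\<integral>x. (?e x *\<^sub>R F x) \<bullet> grad \<psi> x \<partial>\<mu>) = (\<integral>x. F x \<bullet> (?e x *\<^sub>R grad \<psi> x) \<partial>\<mu>)"
    by simp
  have i: "integrable \<mu> (\<lambda>x. F x \<bullet> grad ?g x)" "integrable \<mu> (\<lambda>x. F x \<bullet> (?e x *\<^sub>R grad \<psi> x))"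
    by (intro L2_inner_integrable F gg eG)+
  let ?FN = "\<lambda>j x. norm (indicator (N j) x *\<^sub>R F x)" and ?\<psi>N = "\<lambda>j x. norm (indicator (N j) x *\<^sub>R \<psi> x)"
  have ind: "(indicator (N j) :: _ \<Rightarrow> real) \<in> borel_measurable \<mu>" if "j \<in> J" for j
    using N(1)[OF that] by (intro borel_measurable_lebesgue_on) simp
  have FN: "(\<lambda>x. indicator (N j) x *\<^sub>R F x) \<in> L2_space \<mu>" if "j \<in> J" for j
    by (rule L2_bounded_scaleR(1)[OF ind[OF that] F, of 1]) (auto simp: indicator_def)
  have \<psi>N: "(\<lambda>x. indicator (N j) x *\<^sub>R \<psi> x) \<in> L2_space \<mu>" if "j \<in> J" for j
    by (rule L2_bounded_scaleR(1)[OF ind[OF that] smooth_L2[OF \<psi>], of 1]) (auto simp: indicator_def)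
  have int: "integrable \<mu> (\<lambda>x. ?FN j x * ?\<psi>N j x)" if "j \<in> J" for j
    by (intro L2_mult_integrable L2_of_norm FN \<psi>N that)
  have "\<bar>(\<integral>x. F x \<bullet> (?e x *\<^sub>R grad \<psi> x) \<partial>\<mu>) - (\<integral>x. F x \<bullet> grad ?g x \<partial>\<mu>)\<bar>
    = \<bar>\<integral>x. F x \<bullet> (?e x *\<^sub>R grad \<psi> x) - F x \<bullet> grad ?g x \<partial>\<mu>\<bar>"
    using i by simp
  also have "\<dots> \<le> (\<integral>x. \<bar>F x \<bullet> (?e x *\<^sub>R grad \<psi> x) - F x \<bullet> grad ?g x\<bar> \<partial>\<mu>)"
    by (rule integral_abs_bound)
  also have "\<dots> \<le> (\<integral>x. (\<Sum>j\<in>J. b j * (?FN j x * ?\<psi>N j x)) \<partial>\<mu>)"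
  proof (rule integral_mono)
    show "integrable \<mu> (\<lambda>x. \<bar>F x \<bullet> (?e x *\<^sub>R grad \<psi> x) - F x \<bullet> grad ?g x\<bar>)"
      using i by (intro integrable_abs Bochner_Integration.integrable_diff)
    show "integrable \<mu> (\<lambda>x. \<Sum>j\<in>J. b j * (?FN j x * ?\<psi>N j x))"
      by (intro Bochner_Integration.integrable_sum integrable_mult_right int)
    fix x
    have "\<bar>F x \<bullet> (?e x *\<^sub>R grad \<psi> x) - F x \<bullet> grad ?g x\<bar> = \<bar>F x \<bullet> (grad ?g x - ?e x *\<^sub>R grad \<psi> x)\<bar>"
      by (simp add: inner_diff_right)
    also have "\<dots> \<le> norm (F x) * norm (grad ?g x - ?e x *\<^sub>R grad \<psi> x)" by (rule Cauchy_Schwarz_ineq2)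
    also have "\<dots> \<le> norm (F x) * (\<bar>\<psi> x\<bar> * (\<Sum>j\<in>J. norm (grad (c j) x)))"
      by (intro mult_left_mono grad_prod_error J \<psi> c) auto
    also have "\<dots> = (\<Sum>j\<in>J. norm (grad (c j) x) * (norm (F x) * \<bar>\<psi> x\<bar>))"
      by (simp add: sum_distrib_left sum_distrib_right ac_simps)
    also have "\<dots> \<le> (\<Sum>j\<in>J. b j * (?FN j x * ?\<psi>N j x))"
    proof (rule sum_mono)
      fix j assume j: "j \<in> J"
      show "norm (grad (c j) x) * (norm (F x) * \<bar>\<psi> x\<bar>) \<le> b j * (?FN j x * ?\<psi>N j x)"
      proof (cases "x \<in> N j")
        case True
        then show ?thesis using b[OF j, of x] by (simp add: mult_right_mono)
      next
        case False
        \<comment> \<open>\<open>N j\<close> is closed, so the cutoff is constant in a whole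
          neighbourhood of \<open>x\<close>.\<close>
        then have "grad (c j) x = 0" using grad_eq_0_outside[OF N(1)[OF j], of "c j" 1 x] N(2)[OF j] by blast
        then show ?thesis using False by simp
      qed
    qed
    finally show "\<bar>F x \<bullet> (?e x *\<^sub>R grad \<psi> x) - F x \<bullet> grad ?g x\<bar> \<le> (\<Sum>j\<in>J. b j * (?FN j x * ?\<psi>N j x))" .
  qed
  also have "\<dots> = (\<Sum>j\<in>J. b j * (\<integral>x. ?FN j x * ?\<psi>N j x \<partial>\<mu>))"
    by (subst Bochner_Integration.integral_sum)
      (intro integrable_mult_right int, assumption, simp only: integral_mult_right_zero)
  also have "\<dots> \<le> (\<Sum>j\<in>J. b j * (L2_norm \<mu> (\<lambda>x. indicator (N j) x *\<^sub>R F x) * L2_norm \<mu> (\<lambda>x. indicator (N j) x *\<^sub>R \<psi> x)))"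
  proof (intro sum_mono mult_left_mono)
    fix j assume j: "j \<in> J"
    show "(\<integral>x. ?FN j x * ?\<psi>N j x \<partial>\<mu>) \<le> L2_norm \<mu> (\<lambda>x. indicator (N j) x *\<^sub>R F x) * L2_norm \<mu> (\<lambda>x. indicator (N j) x *\<^sub>R \<psi> x)"
      using L2_norm_mult_integral[OF L2_of_norm[OF FN[OF j]] L2_of_norm[OF \<psi>N[OF j]]]
      by (simp only: L2_norm_of_norm abs_of_nonneg[OF mult_nonneg_nonneg[OF norm_ge_zero norm_ge_zero]])
    show "0 \<le> b j" using b[OF j] norm_ge_zero order_trans by blast
  qed
  finally show ?thesis unfolding 2 1[symmetric] .
qed

end

section \<open>The boundary of a polygon\<close>

definition rot :: "real^2 \<Rightarrow> real^2" where
  "rot d = vector [- (d$2), d$1]"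

lemma inner_real2: "(x::real^2) \<bullet> y = x$1 * y$1 + x$2 * y$2"
  by (simp add: inner_vec_def UNIV_2)

lemma norm_sq_real2: "(norm (x::real^2))\<^sup>2 = (x$1)\<^sup>2 + (x$2)\<^sup>2"
  unfolding power2_norm_eq_inner inner_real2 by (simp add: power2_eq_square)

lemma rot_simps: "d \<bullet> rot d = 0" "rot d \<bullet> d = 0" "norm (rot d) = norm d" "rot d \<bullet> rot d = d \<bullet> d"
proof -
  have "(norm (rot d))\<^sup>2 = (norm d)\<^sup>2" by (simp add: norm_sq_real2 rot_def)
  then show "norm (rot d) = norm d" by (simp add: power2_eq_iff_nonneg)
qed (simp_all add: inner_real2 rot_def)

lemma rot_decompose:
  assumes "d \<noteq> 0"
  shows "x = ((x \<bullet> d) / (norm d)\<^sup>2) *\<^sub>R d + ((x \<bullet> rot d) / (norm d)\<^sup>2) *\<^sub>R rot d"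
proof -
  have n: "(norm d)\<^sup>2 \<noteq> 0" using assms by simp
  have "((x \<bullet> d) * d$1 + (x \<bullet> rot d) * rot d$1) = x$1 * (norm d)\<^sup>2"
    "((x \<bullet> d) * d$2 + (x \<bullet> rot d) * rot d$2) = x$2 * (norm d)\<^sup>2"
    unfolding norm_sq_real2 by (simp_all add: inner_real2 rot_def power2_eq_square algebra_simps)
  then show ?thesis using n
    by (simp add: vec_eq_iff forall_2 add_divide_distrib[symmetric])
qed

lemma grad_step_affine_bound:
  assumes B: "\<And>t. \<bar>deriv smooth_step t\<bar> \<le> B"
  shows "norm (grad (\<lambda>x. smooth_step (a + (x - p) \<bullet> w)) x) \<le> B * norm w"
proof -
  have sm: "smooth (\<lambda>x. a + (x - p) \<bullet> w)" by (intro smooth_add smooth_const smooth_inner_diff)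
  have g: "grad (\<lambda>x. a + (x - p) \<bullet> w) x = w"
    by (rule grad_eqI) (auto intro!: derivative_eq_intros simp: inner_commute)
  show ?thesis
    unfolding grad_comp[OF smooth_smooth_step sm] g norm_scaleR by (intro mult_right_mono B) simp
qed

lemma grad_norm_sq: "grad (\<lambda>x. (norm (x - p))\<^sup>2) x = 2 *\<^sub>R (x - p)"
  by (rule grad_eqI)
    (auto intro!: derivative_eq_intros simp: power2_norm_eq_inner inner_commute inner_diff_left inner_diff_right)

lemma continuous_inner_quotient: "continuous (at x) (\<lambda>x. (x - p) \<bullet> w / (c::real))"
  unfolding divide_inverse by (intro continuous_intros)

text \<open>The argument is ((\<bar>x - p\<bar>/\<rho>)^2 - 1)/3, which rises from 0 at distance
  \<rho> to 1 at distance 2\<rho>. The squared distance is used because it is smooth at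
  \<open>p\<close> as well.\<close>

definition corner_cutoff :: "real^2 \<Rightarrow> real \<Rightarrow> real^2 \<Rightarrow> real" where
  "corner_cutoff p \<rho> x = smooth_step (1 / (3 * \<rho>\<^sup>2) * (norm (x - p))\<^sup>2 - 1 / 3)"

lemma corner_cutoff:
  assumes \<rho>: "0 < \<rho>" and B: "\<And>t. \<bar>deriv smooth_step t\<bar> \<le> B"
  shows "smooth (corner_cutoff p \<rho>)" "corner_cutoff p \<rho> x \<in> {0..1}"
    "x \<notin> cball p (2 * \<rho>) \<Longrightarrow> corner_cutoff p \<rho> x = 1"
    "x \<in> ball p \<rho> \<Longrightarrow> corner_cutoff p \<rho> x = 0"
    "norm (grad (corner_cutoff p \<rho>) x) \<le> 2 * B / \<rho>"
proof -
  let ?l = "\<lambda>x. 1 / (3 * \<rho>\<^sup>2) * (norm (x - p))\<^sup>2 - 1 / 3"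
  have sl: "smooth ?l" by (intro smooth_cmult smooth_diff smooth_const smooth_norm_sq)
  show sm: "smooth (corner_cutoff p \<rho>)"
    unfolding corner_cutoff_def[abs_def] by (rule smooth_comp[OF smooth_smooth_step sl])
  show "corner_cutoff p \<rho> x \<in> {0..1}" unfolding corner_cutoff_def using smooth_step_range by simp
  show far: "corner_cutoff p \<rho> x = 1" if "x \<notin> cball p (2 * \<rho>)" for x
    unfolding corner_cutoff_def
  proof (rule smooth_step_1)
    have "(2 * \<rho>)\<^sup>2 \<le> (norm (x - p))\<^sup>2"
      using that \<rho> by (intro power_mono) (auto simp: dist_norm norm_minus_commute)
    then show "1 \<le> ?l x" using \<rho> by (simp add: field_simps power_mult_distrib)
  qed
  show "corner_cutoff p \<rho> x = 0" if "x \<in> ball p \<rho>"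
    unfolding corner_cutoff_def
  proof (rule smooth_step_0)
    have "(norm (x - p))\<^sup>2 \<le> \<rho>\<^sup>2"
      using that \<rho> by (intro power_mono) (auto simp: dist_norm norm_minus_commute)
    then show "?l x \<le> 0" using \<rho> by (simp add: field_simps)
  qed
  have B0: "0 \<le> B" using B[of 0] by linarith
  show "norm (grad (corner_cutoff p \<rho>) x) \<le> 2 * B / \<rho>"
  proof (cases "x \<in> cball p (2 * \<rho>)")
    case True
    have "grad ?l x = (1 / (3 * \<rho>\<^sup>2)) *\<^sub>R 2 *\<^sub>R (x - p) - 0"
      by (simp only: grad_diff[OF smooth_cmult[OF smooth_norm_sq] smooth_const]
          grad_cmult[OF smooth_norm_sq] grad_norm_sq grad_const)
    then have "grad ?l x = (2 / (3 * \<rho>\<^sup>2)) *\<^sub>R (x - p)" by simp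
    then have "grad (corner_cutoff p \<rho>) x = deriv smooth_step (?l x) *\<^sub>R (2 / (3 * \<rho>\<^sup>2)) *\<^sub>R (x - p)"
      unfolding corner_cutoff_def[abs_def] using grad_comp[OF smooth_smooth_step sl] by simp
    then have "norm (grad (corner_cutoff p \<rho>) x) = \<bar>deriv smooth_step (?l x)\<bar> * (2 / (3 * \<rho>\<^sup>2) * norm (x - p))"
      by (simp add: abs_mult)
    \<comment> \<open>The gradient lives where the distance is at most 2\<rho>. This gives
      4B/(3\<rho>), which is then rounded up.\<close>
    also have "\<dots> \<le> B * (2 / (3 * \<rho>\<^sup>2) * (2 * \<rho>))"
      using True B0 B by (intro mult_mono) (auto simp: dist_norm norm_minus_commute)
    also have "\<dots> \<le> 2 * B / \<rho>" using \<rho> B0 by (simp add: field_simps power2_eq_square)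
    finally show ?thesis .
  next
    case False
    then have "grad (corner_cutoff p \<rho>) x = 0"
      using grad_eq_0_outside[of "cball p (2 * \<rho>)" "corner_cutoff p \<rho>" 1 x] far by auto
    then show ?thesis using \<rho> B0 by simp
  qed
qed

text \<open>In the coordinates \<open>s\<close> along and \<open>t\<close> across the edge from \<open>p\<close> to \<open>p + d\<close>, scaled by the length of the
  edge, the four factors cut off at \<open>t = - e\<close>, \<open>t = e\<close>, \<open>s = r\<close> and \<open>s = 1 - r\<close>.\<close>

definition edge_bump :: "real^2 \<Rightarrow> real^2 \<Rightarrow> real \<Rightarrow> real \<Rightarrow> nat \<Rightarrow> real^2 \<Rightarrow> real" where
  "edge_bump p d r e k x = smooth_step
     ([2, 2, - 1, (1 - r) / r] ! k + (x - p) \<bullet> ([2 / e, - 2 / e, 1 / r, - 1 / r] ! k / (norm d)\<^sup>2) *\<^sub>R ([rot d, rot d, d, d] ! k))"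

text \<open>The product is 1 along the middle of the edge and 0 outside the box, so its complement
  removes a neighbourhood of that part of the edge and leaves everything outside the box
  untouched.\<close>

definition edge_cutoff :: "real^2 \<Rightarrow> real^2 \<Rightarrow> real \<Rightarrow> real \<Rightarrow> real^2 \<Rightarrow> real" where
  "edge_cutoff p d r e x = 1 - (\<Prod>k<4. edge_bump p d r e k x)"

definition edge_box :: "real^2 \<Rightarrow> real^2 \<Rightarrow> real \<Rightarrow> real \<Rightarrow> (real^2) set" where
  "edge_box p d r e = {x. (x - p) \<bullet> d / (norm d)\<^sup>2 \<in> {r..1 - r} \<and> (x - p) \<bullet> rot d / (norm d)\<^sup>2 \<in> {- e..e}}"

text \<open>Half the height and twice the end margin of the box: here all four steps have already
  reached 1. The core is open so that cores and corner discs together form an open neighbourhood of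
  the boundary, whereas the box is closed.\<close>

definition edge_core :: "real^2 \<Rightarrow> real^2 \<Rightarrow> real \<Rightarrow> real \<Rightarrow> (real^2) set" where
  "edge_core p d r e = {x. (x - p) \<bullet> d / (norm d)\<^sup>2 \<in> {2 * r<..<1 - 2 * r} \<and> (x - p) \<bullet> rot d / (norm d)\<^sup>2 \<in> {- e / 2<..<e / 2}}"

lemma closed_edge_box: "closed (edge_box p d r e)"
proof -
  have "edge_box p d r e = (\<lambda>x. (x - p) \<bullet> d / (norm d)\<^sup>2) -` {r..1 - r} \<inter> (\<lambda>x. (x - p) \<bullet> rot d / (norm d)\<^sup>2) -` {- e..e}"
    by (auto simp: edge_box_def)
  also have "closed \<dots>"
    by (intro closed_Int continuous_closed_vimage closed_atLeastAtMost continuous_inner_quotient)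
  finally show ?thesis .
qed

lemma open_edge_core: "open (edge_core p d r e)"
proof -
  have "edge_core p d r e = (\<lambda>x. (x - p) \<bullet> d / (norm d)\<^sup>2) -` {2 * r<..<1 - 2 * r} \<inter> (\<lambda>x. (x - p) \<bullet> rot d / (norm d)\<^sup>2) -` {- e / 2<..<e / 2}"
    by (auto simp: edge_core_def)
  also have "open \<dots>"
    by (intro open_Int continuous_open_vimage open_greaterThanLessThan continuous_inner_quotient)
  finally show ?thesis .
qed

lemma prod4: "(\<Prod>k<4. f k) = f 0 * f 1 * f 2 * f (3::nat)" for f :: "nat \<Rightarrow> real"
  by (simp add: eval_nat_numeral)

lemma sum4: "(\<Sum>k<4. f k) = f 0 + f 1 + f 2 + f (3::nat)" for f :: "nat \<Rightarrow> real"
  by (simp add: eval_nat_numeral)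

lemma edge_cutoff:
  assumes d: "d \<noteq> 0" and r: "0 < r" and e: "0 < e" "e \<le> r" and B: "\<And>t. \<bar>deriv smooth_step t\<bar> \<le> B"
  shows "smooth (edge_cutoff p d r e)" "edge_cutoff p d r e x \<in> {0..1}"
    "x \<notin> edge_box p d r e \<Longrightarrow> edge_cutoff p d r e x = 1"
    "x \<in> edge_core p d r e \<Longrightarrow> edge_cutoff p d r e x = 0"
    "norm (grad (edge_cutoff p d r e) x) \<le> 6 * B / (e * norm d)"
proof -
  let ?b = "edge_bump p d r e"
  let ?s = "\<lambda>x. (x - p) \<bullet> d / (norm d)\<^sup>2" and ?t = "\<lambda>x. (x - p) \<bullet> rot d / (norm d)\<^sup>2"
  have L: "0 < norm d" using d by simp
  have B0: "0 \<le> B" using B[of 0] by linarith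
  have sb: "smooth (?b k)" for k
    unfolding edge_bump_def[abs_def]
    by (intro smooth_comp[OF smooth_smooth_step] smooth_add smooth_const smooth_inner_diff)
  have b01: "?b k x \<in> {0..1}" for k x unfolding edge_bump_def using smooth_step_range by simp
  have b: "?b 0 x = smooth_step (2 + 2 / e * ?t x)" "?b 1 x = smooth_step (2 - 2 / e * ?t x)"
    "?b 2 x = smooth_step ((?s x - r) / r)" "?b 3 x = smooth_step ((1 - r - ?s x) / r)" for x
    using r by (simp_all add: edge_bump_def diff_divide_distrib mult.commute)
  show sm: "smooth (edge_cutoff p d r e)"
    unfolding edge_cutoff_def[abs_def] by (intro smooth_diff smooth_const smooth_prod sb)
  show "edge_cutoff p d r e x \<in> {0..1}"
    using b01 unfolding edge_cutoff_def by (auto intro!: prod_nonneg prod_le_1)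
  show "edge_cutoff p d r e x = 1" if x: "x \<notin> edge_box p d r e"
  proof -
    consider "?s x < r" | "?s x > 1 - r" | "?t x < - e" | "?t x > e"
      using x unfolding edge_box_def by force
    then have "\<exists>k<4. ?b k x = 0"
    proof cases
      case 1
      then have "?b 2 x = 0" unfolding b using r by (intro smooth_step_0) (simp add: divide_nonpos_pos)
      then show ?thesis by (intro exI[of _ 2]) simp
    next
      case 2
      then have "?b 3 x = 0" unfolding b using r by (intro smooth_step_0) (simp add: divide_nonpos_pos)
      then show ?thesis by (intro exI[of _ 3]) simp
    next
      case 3
      then have "2 / e * ?t x \<le> 2 / e * (- e)" using e by (intro mult_left_mono) auto
      then have "?b 0 x = 0" unfolding b using e by (intro smooth_step_0) simp
      then show ?thesis by (intro exI[of _ 0]) simp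
    next
      case 4
      then have "2 / e * e \<le> 2 / e * ?t x" using e by (intro mult_left_mono) auto
      then have "?b 1 x = 0" unfolding b using e by (intro smooth_step_0) simp
      then show ?thesis by (intro exI[of _ 1]) simp
    qed
    then show ?thesis unfolding edge_cutoff_def by (simp add: prod_zero_iff Bex_def)
  qed
  show "edge_cutoff p d r e x = 0" if "x \<in> edge_core p d r e"
  proof -
    have s: "2 * r < ?s x" "?s x < 1 - 2 * r" and t: "- e / 2 < ?t x" "?t x < e / 2"
      using that by (auto simp: edge_core_def)
    have "2 / e * (- e / 2) \<le> 2 / e * ?t x" "2 / e * ?t x \<le> 2 / e * (e / 2)"
      using t e by (intro mult_left_mono; simp)+
    then have "?b 0 x = 1" "?b 1 x = 1"
      unfolding b using e by (intro smooth_step_1; simp)+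
    moreover have "?b 2 x = 1" "?b 3 x = 1"
      unfolding b using s r by (intro smooth_step_1; simp add: pos_le_divide_eq)+
    ultimately show ?thesis unfolding edge_cutoff_def prod4 by simp
  qed
  have gb: "norm (grad (?b k) x) \<le> B * norm (([2 / e, - 2 / e, 1 / r, - 1 / r] ! k / (norm d)\<^sup>2) *\<^sub>R ([rot d, rot d, d, d] ! k))" for k
    unfolding edge_bump_def[abs_def] by (rule grad_step_affine_bound[OF B])
  \<comment> \<open>The two steps across the edge have slope 2/e and the two along it slope 1/r, all
    divided by the length of the edge. Since \<open>e \<le> r\<close> the sum is at most 2 + 2 + 1 +
    1 = 6 times \<open>K\<close>.\<close>
  define K where "K = B * (1 / e / norm d)"
  have K: "B * (2 / e / norm d) = 2 * K" "B * (1 / r / norm d) \<le> K"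
    unfolding K_def using e r L B0
    by (simp, intro mult_left_mono divide_right_mono divide_left_mono) auto
  have "norm (grad (?b 0) x) \<le> B * (2 / e / norm d)" "norm (grad (?b 1) x) \<le> B * (2 / e / norm d)"
    "norm (grad (?b 2) x) \<le> B * (1 / r / norm d)" "norm (grad (?b 3) x) \<le> B * (1 / r / norm d)"
    using gb[of 0] gb[of 1] gb[of 2] gb[of 3] e r d unfolding norm_scaleR
    by (simp_all add: rot_simps power2_eq_square)
  then have "norm (grad (?b 0) x) \<le> 2 * K" "norm (grad (?b 1) x) \<le> 2 * K"
    "norm (grad (?b 2) x) \<le> K" "norm (grad (?b 3) x) \<le> K"
    unfolding K(1) using K(2) by (blast intro: order_trans)+
  then have sum: "(\<Sum>k<4. norm (grad (?b k) x)) \<le> 6 * K"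
    unfolding sum4 by linarith
  have gc: "grad (edge_cutoff p d r e) x = - grad (\<lambda>x. 1 * (\<Prod>k<4. ?b k x)) x"
    unfolding edge_cutoff_def[abs_def]
    by (subst grad_diff) (auto intro!: smooth_const smooth_prod sb simp: grad_const)
  have "norm (grad (edge_cutoff p d r e) x) \<le> \<bar>1::real\<bar> * (\<Sum>k<4. norm (grad (?b k) x))"
    using grad_prod_error[of "{..<4}" "\<lambda>_. 1" ?b x, OF _ smooth_const sb b01] by (simp add: gc grad_const)
  also have "\<dots> \<le> 6 * B / (e * norm d)" using sum by (simp add: K_def)
  finally show "norm (grad (edge_cutoff p d r e) x) \<le> 6 * B / (e * norm d)" .
qed

section \<open>The region enclosed by a simple polygon and its boundary measure\<close>

locale polygon_domain =
  fixes vs :: polygon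
  assumes simple: "simple_polygon vs"
begin

definition dir :: "nat \<Rightarrow> real^2" where
  "dir i = vert vs (Suc i) - vert vs i"

lemma length_ge: "3 \<le> length vs"
  using simple by (simp add: simple_polygon_def)

lemma dir_nonzero: assumes "i < length vs" shows "dir i \<noteq> 0"
proof -
  have n: "3 \<le> length vs" by (rule length_ge)
  have "Suc i mod length vs \<noteq> i mod length vs"
  proof (cases "Suc i = length vs")
    case True
    then have "i > 0" using n by simp
    then show ?thesis using True assms by simp
  next
    case False
    then show ?thesis using assms by simp
  qed
  moreover have "0 < length vs" using n by linarith
  then have "Suc i mod length vs < length vs" "i mod length vs < length vs" by simp_all
  moreover have "distinct vs" using simple by (simp add: simple_polygon_def)
  ultimately show ?thesis by (simp add: dir_def vert_def nth_eq_iff_index_eq)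
qed

lemma edge_eq: "edge vs i = (\<lambda>s. vert vs i + s *\<^sub>R dir i) ` {0..1}"
  by (auto simp: edge_def closed_segment_def dir_def algebra_simps)

lemma compact_bdry: "compact (bdry vs)"
  unfolding bdry_def edge_def by (intro compact_UN) auto

lemma region_disjoint_bdry: "x \<in> region vs \<Longrightarrow> x \<notin> bdry vs"
  unfolding region_def using inside_no_overlap by blast

sublocale bounded_domain "region vs"
proof
  show "open (region vs)" unfolding region_def
    by (rule open_inside[OF compact_imp_closed[OF compact_bdry]])
  show "bounded (region vs)" unfolding region_def
    by (rule bounded_inside) (use compact_bdry compact_imp_bounded in auto)
qed

abbreviation E where "E \<equiv> region vs"

abbreviation \<sigma> where "\<sigma> \<equiv> bdry_measure vs"

lemma frontier_region: "frontier E \<subseteq> bdry vs"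
  unfolding region_def by (rule frontier_inside_subset[OF compact_imp_closed[OF compact_bdry]])

lemma edge_subset_bdry: "i < length vs \<Longrightarrow> edge vs i \<subseteq> bdry vs"
  by (auto simp: bdry_def)

lemma space_bdry_measure: "space \<sigma> = bdry vs"
  by (simp add: bdry_measure_def space_restrict_space)

lemma sets_bdry_measure: "sets \<sigma> = sets (restrict_space borel (bdry vs))"
  by (simp add: bdry_measure_def)

lemma borel_measurable_bdry:
  "g \<in> borel_measurable borel \<Longrightarrow> g \<in> borel_measurable \<sigma>"
  by (subst measurable_cong_sets[OF sets_bdry_measure refl]) (rule measurable_restrict_space1)

text \<open>Unfolds image, density and product measure into one parametric integral per edge. For
  nonnegative integrands Fubini asks for measurability only.\<close>

lemma nn_integral_bdry:
  assumes g: "g \<in> borel_measurable borel"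
  shows "(\<integral>\<^sup>+x. g x \<partial>\<sigma>)
    = (\<Sum>i<length vs. ennreal (norm (dir i)) * (\<integral>\<^sup>+t. indicator {0..1} t * g (vert vs i + t *\<^sub>R dir i) \<partial>lborel))"
proof -
  let ?I = "restrict_space lborel {0..1::real}"
  let ?C = "count_space {..<length vs}"
  let ?w = "\<lambda>(i, t::real). ennreal (dist (vert vs i) (vert vs (Suc i)))"
  let ?f = "\<lambda>(i, t). linepath (vert vs i) (vert vs (Suc i)) t"
  interpret I: sigma_finite_measure ?I
    by (rule sigma_finite_measure_restrict_space) (auto intro: lborel.sigma_finite_measure_axioms)
  have lp: "linepath (vert vs i) (vert vs (Suc i)) t = vert vs i + t *\<^sub>R dir i" for i t
    by (simp add: linepath_def dir_def algebra_simps)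
  have ns: "dist (vert vs i) (vert vs (Suc i)) = norm (dir i)" for i
    by (simp add: dist_norm dir_def norm_minus_commute)
  have wm: "?w \<in> borel_measurable (?C \<Otimes>\<^sub>M ?I)"
    by (rule measurable_pair_measure_countable1) auto
  have tm: "(\<lambda>t. vert vs i + t *\<^sub>R dir i) \<in> borel_measurable ?I" for i
    by (rule measurable_restrict_space1) measurable
  have fm': "?f \<in> (?C \<Otimes>\<^sub>M ?I) \<rightarrow>\<^sub>M borel"
    by (rule measurable_pair_measure_countable1) (auto simp: lp intro: tm)
  have fm: "?f \<in> (?C \<Otimes>\<^sub>M ?I) \<rightarrow>\<^sub>M restrict_space borel (bdry vs)"
  proof (rule measurable_restrict_space2[OF _ fm'])
    show "?f \<in> space (?C \<Otimes>\<^sub>M ?I) \<rightarrow> bdry vs"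
      using edge_subset_bdry edge_eq by (fastforce simp: space_pair_measure lp space_restrict_space)
  qed
  have gm: "g \<in> borel_measurable (restrict_space borel (bdry vs))"
    by (rule measurable_restrict_space1[OF g])
  have gf: "(\<lambda>z. g (?f z)) \<in> borel_measurable (?C \<Otimes>\<^sub>M ?I)"
    by (rule measurable_compose[OF fm' g])
  have "(\<integral>\<^sup>+x. g x \<partial>\<sigma>) = (\<integral>\<^sup>+z. g (?f z) \<partial>density (?C \<Otimes>\<^sub>M ?I) ?w)"
    unfolding bdry_measure_def by (rule nn_integral_distr) (use fm gm in auto)
  also have "\<dots> = (\<integral>\<^sup>+z. ?w z * g (?f z) \<partial>(?C \<Otimes>\<^sub>M ?I))"
    by (rule nn_integral_density[OF wm gf])
  also have "\<dots> = (\<integral>\<^sup>+i. \<integral>\<^sup>+t. ?w (i, t) * g (?f (i, t)) \<partial>?I \<partial>?C)"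
    by (rule I.nn_integral_fst[symmetric]) (rule borel_measurable_times_ennreal[OF wm gf])
  also have "\<dots> = (\<Sum>i<length vs. \<integral>\<^sup>+t. ?w (i, t) * g (?f (i, t)) \<partial>?I)"
    by (rule nn_integral_count_space_finite) simp
  also have "\<dots> = (\<Sum>i<length vs. ennreal (norm (dir i)) * (\<integral>\<^sup>+t. indicator {0..1} t * g (vert vs i + t *\<^sub>R dir i) \<partial>lborel))"
  proof (rule sum.cong[OF refl])
    fix i
    have gt: "(\<lambda>t. g (vert vs i + t *\<^sub>R dir i)) \<in> borel_measurable ?I"
      by (rule measurable_compose[OF tm g])
    have "(\<integral>\<^sup>+t. ?w (i, t) * g (?f (i, t)) \<partial>?I) = ennreal (norm (dir i)) * (\<integral>\<^sup>+t. g (vert vs i + t *\<^sub>R dir i) \<partial>?I)"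
      using gt by (simp add: lp ns nn_integral_cmult)
    also have "(\<integral>\<^sup>+t. g (vert vs i + t *\<^sub>R dir i) \<partial>?I) = (\<integral>\<^sup>+t. indicator {0..1} t * g (vert vs i + t *\<^sub>R dir i) \<partial>lborel)"
      by (subst nn_integral_restrict_space) (auto simp: mult.commute)
    finally show "(\<integral>\<^sup>+t. ?w (i, t) * g (?f (i, t)) \<partial>?I) = ennreal (norm (dir i)) * (\<integral>\<^sup>+t. indicator {0..1} t * g (vert vs i + t *\<^sub>R dir i) \<partial>lborel)" .
  qed
  finally show ?thesis .
qed

lemma finite_measure_bdry: "finite_measure \<sigma>"
proof (rule finite_measureI)
  have "(\<integral>\<^sup>+x. 1 \<partial>\<sigma>) = (\<Sum>i<length vs. ennreal (norm (dir i)))"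
    by (subst nn_integral_bdry) (auto intro!: sum.cong)
  then show "emeasure \<sigma> (space \<sigma>) \<noteq> \<infinity>" by simp
qed

lemma continuous_L2_bdry:
  fixes f :: "real^2 \<Rightarrow> real"
  assumes "continuous_on UNIV f" shows "f \<in> L2_space \<sigma>"
proof -
  obtain B where "\<And>x. x \<in> bdry vs \<Longrightarrow> norm (f x) \<le> B"
    using continuous_bounded_on_compact[OF assms compact_bdry] by metis
  then have "AE x in \<sigma>. norm (f x) \<le> B"
    by (intro AE_I2) (simp add: space_bdry_measure)
  then show ?thesis
    by (intro L2_bounded(1)[OF finite_measure_bdry borel_measurable_bdry[OF borel_measurable_continuous_onI[OF assms]]])
qed

lemma edge_trace_le:
  assumes \<psi>: "smooth \<psi>" and i: "i < length vs"
  shows "ennreal (norm (dir i)) * (\<integral>\<^sup>+t. indicator {0..1} t * ennreal ((\<psi> (vert vs i + t *\<^sub>R dir i))\<^sup>2) \<partial>lborel)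
    \<le> ennreal ((L2_norm \<sigma> \<psi>)\<^sup>2)"
proof -
  let ?T = "\<lambda>i. ennreal (norm (dir i)) * (\<integral>\<^sup>+t. indicator {0..1} t * ennreal ((\<psi> (vert vs i + t *\<^sub>R dir i))\<^sup>2) \<partial>lborel)"
  have [measurable]: "\<psi> \<in> borel_measurable borel" by (rule smooth_borel[OF \<psi>])
  have "?T i \<le> (\<Sum>i<length vs. ?T i)" using i by (intro member_le_sum) auto
  also have "\<dots> = (\<integral>\<^sup>+x. ennreal ((\<psi> x)\<^sup>2) \<partial>\<sigma>)"
    by (rule nn_integral_bdry[symmetric]) measurable
  also have "\<dots> = ennreal ((L2_norm \<sigma> \<psi>)\<^sup>2)"
    unfolding L2_norm_sq
    using nn_integral_eq_integral[OF L2_integrable[OF continuous_L2_bdry[OF smooth_continuous[OF \<psi>]]]] by simp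
  finally show ?thesis .
qed

lemma L2_norm_nn_integral:
  fixes f :: "real^2 \<Rightarrow> 'b::euclidean_space"
  assumes "f \<in> borel_measurable borel" "f \<in> L2_space \<mu>"
  shows "ennreal ((L2_norm \<mu> f)\<^sup>2) = (\<integral>\<^sup>+x. indicator E x * ennreal ((norm (f x))\<^sup>2) \<partial>lborel)"
proof -
  have "ennreal ((L2_norm \<mu> f)\<^sup>2) = (\<integral>\<^sup>+x. ennreal ((norm (f x))\<^sup>2) \<partial>\<mu>)"
    unfolding L2_norm_sq by (rule nn_integral_eq_integral[symmetric, OF L2_integrable[OF assms(2)]]) simp
  also have "\<dots> = (\<integral>\<^sup>+x. indicator E x * ennreal ((norm (f x))\<^sup>2) \<partial>lebesgue)"
    by (subst nn_integral_restrict_space) (auto simp: sets_E mult.commute)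
  also have "\<dots> = (\<integral>\<^sup>+x. indicator E x * ennreal ((norm (f x))\<^sup>2) \<partial>lborel)"
    using assms(1) sets_E(1) by (intro nn_integral_completion) measurable
  finally show ?thesis .
qed

lemma connected_strip: "connected (strip p d m r e)"
  unfolding strip_def
proof (rule connected_continuous_image)
  show "continuous_on ({r..1 - r} \<times> {0<..e}) (\<lambda>(s, t). p + s *\<^sub>R d + t *\<^sub>R m)"
    unfolding case_prod_beta by (intro continuous_intros)
  show "connected ({r..1 - r} \<times> {0<..e})"
    by (intro convex_connected convex_Times) auto
qed

text \<open>The strip is connected, and the interior of a curve is a union of components of the
  complement. Thus both sides of an edge can be treated alike, whichever of them faces the
  region.\<close>

lemma strip_inside_or_outside:
  assumes "strip p d m r e \<inter> bdry vs = {}"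
  shows "strip p d m r e \<subseteq> E \<or> strip p d m r e \<inter> E = {}"
proof (rule disjCI)
  assume "strip p d m r e \<inter> E \<noteq> {}"
  then obtain x where x: "x \<in> strip p d m r e" "x \<in> inside (bdry vs)" by (auto simp: region_def)
  show "strip p d m r e \<subseteq> E"
  proof
    fix y assume "y \<in> strip p d m r e"
    then have "connected_component (- bdry vs) x y"
      using x connected_strip[of p d m r e] assms unfolding connected_component_def by blast
    then show "y \<in> E" using inside_same_component x(2) unfolding region_def by blast
  qed
qed

lemma det_rot: "d$1 * rot d$2 - d$2 * rot d$1 = (norm d)\<^sup>2" "d$1 * (- rot d)$2 - d$2 * (- rot d)$1 = - (norm d)\<^sup>2"
  unfolding norm_sq_real2 by (simp_all add: rot_def power2_eq_square)

text \<open>Distinct edges of a simple polygon meet only in end points, so the middle part of an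
  edge is compact and disjoint from the closed union of the others. Their positive distance limits
  the height of the strips.\<close>

lemma strips_avoid_bdry:
  assumes i: "i < length vs" and r: "0 < r" "r < 1"
  obtains e0 where "0 < e0"
    "\<And>e m. 0 < e \<Longrightarrow> e < e0 \<Longrightarrow> m \<in> {rot (dir i), - rot (dir i)} \<Longrightarrow> strip (vert vs i) (dir i) m r e \<inter> bdry vs = {}"
proof -
  let ?K = "(\<lambda>s. vert vs i + s *\<^sub>R dir i) ` {r..1 - r}"
  let ?O = "\<Union>j\<in>{..<length vs} - {i}. edge vs j"
  have L: "0 < norm (dir i)" using dir_nonzero[OF i] by simp
  have inj: "vert vs i + s *\<^sub>R dir i = vert vs i + s' *\<^sub>R dir i \<longleftrightarrow> s = s'" for s s'
    using dir_nonzero[OF i] by simp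
  have K: "compact ?K" by (intro compact_continuous_image continuous_intros) auto
  have O: "closed ?O" unfolding edge_def by (intro closed_UN) auto
  have "?K \<inter> ?O = {}"
  proof (rule ccontr)
    assume "?K \<inter> ?O \<noteq> {}"
    then obtain s where s: "s \<in> {r..1 - r}" and "vert vs i + s *\<^sub>R dir i \<in> ?O" by blast
    then obtain j where j: "j < length vs" "j \<noteq> i" "vert vs i + s *\<^sub>R dir i \<in> edge vs j" by blast
    moreover have "vert vs i + s *\<^sub>R dir i \<in> edge vs i"
      unfolding edge_eq using s r by (intro imageI) auto
    ultimately have "vert vs i + s *\<^sub>R dir i \<in> edge vs i \<inter> edge vs j" by blast
    also have "\<dots> = {vert vs i, vert vs (Suc i)} \<inter> {vert vs j, vert vs (Suc j)}"
      using simple i j by (auto simp: simple_polygon_def)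
    finally have "vert vs i + s *\<^sub>R dir i = vert vs i + 0 *\<^sub>R dir i \<or> vert vs i + s *\<^sub>R dir i = vert vs i + 1 *\<^sub>R dir i"
      by (auto simp: dir_def)
    then have "s = 0 \<or> s = 1" unfolding inj .
    then show False using s r by auto
  qed
  then obtain D where D: "0 < D" "\<And>x y. x \<in> ?K \<Longrightarrow> y \<in> ?O \<Longrightarrow> D \<le> dist x y"
    using separate_compact_closed[OF K O] by metis
  show ?thesis
  proof (rule that[of "D / norm (dir i)"])
    show "0 < D / norm (dir i)" using D(1) L by simp
    fix e m assume e: "0 < e" "e < D / norm (dir i)" and m: "m \<in> {rot (dir i), - rot (dir i)}"
    have nm: "norm m = norm (dir i)" using m by (auto simp: rot_simps)
    have det: "dir i$1 * m$2 - dir i$2 * m$1 \<noteq> 0" using m L det_rot[of "dir i"] by fastforce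
    show "strip (vert vs i) (dir i) m r e \<inter> bdry vs = {}"
    proof (rule ccontr)
      assume "strip (vert vs i) (dir i) m r e \<inter> bdry vs \<noteq> {}"
      then obtain x where xs: "x \<in> strip (vert vs i) (dir i) m r e" and xb: "x \<in> bdry vs" by blast
      from xs obtain s t where st: "s \<in> {r..1 - r}" "t \<in> {0<..e}" "x = vert vs i + s *\<^sub>R dir i + t *\<^sub>R m"
        by (auto simp: strip_def)
      from xb obtain j where j: "j < length vs" "x \<in> edge vs j" by (auto simp: bdry_def)
      show False
      proof (cases "j = i")
        case True
        \<comment> \<open>The edge itself consists of the points with second coordinate 0;
          coordinates being unique, it misses the strip, whose height parameter is positive.\<close>
        then obtain s' where "x = vert vs i + s' *\<^sub>R dir i + 0 *\<^sub>R m" using j(2) by (auto simp: edge_eq)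
        with xs strip_coordinates[OF det, of "vert vs i" s' 0 r e] show False by simp
      next
        case False
        then have "D \<le> dist (vert vs i + s *\<^sub>R dir i) x" using j st by (intro D(2)) auto
        also have "\<dots> = t * norm (dir i)" using st(2) by (simp add: st(3) dist_norm nm)
        also have "\<dots> \<le> e * norm (dir i)" using st(2) by (intro mult_right_mono) auto
        also have "\<dots> < D" using e L by (simp add: pos_less_divide_eq)
        finally show False by simp
      qed
    qed
  qed
qed

text \<open>A point of the box at height 0 lies on the edge, hence not in the region; the sign of
  the height decides between the two strips.\<close>

lemma edge_box_region_subset:
  assumes i: "i < length vs" and r: "0 < r"
  shows "edge_box (vert vs i) (dir i) r e \<inter> E
    \<subseteq> strip (vert vs i) (dir i) (rot (dir i)) r e \<union> strip (vert vs i) (dir i) (- rot (dir i)) r e"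
proof
  fix x assume x: "x \<in> edge_box (vert vs i) (dir i) r e \<inter> E"
  let ?p = "vert vs i" and ?d = "dir i"
  define s where "s = (x - ?p) \<bullet> ?d / (norm ?d)\<^sup>2"
  define t where "t = (x - ?p) \<bullet> rot ?d / (norm ?d)\<^sup>2"
  have st: "s \<in> {r..1 - r}" "t \<in> {- e..e}" using x by (auto simp: edge_box_def s_def t_def)
  have eq: "x = ?p + s *\<^sub>R ?d + t *\<^sub>R rot ?d"
    using rot_decompose[OF dir_nonzero[OF i], of "x - ?p"] by (simp add: s_def t_def algebra_simps)
  have "t \<noteq> 0"
  proof
    assume "t = 0"
    then have "x \<in> edge vs i" using st r by (auto simp: eq edge_eq)
    then show False using x edge_subset_bdry[OF i] region_disjoint_bdry by blast
  qed
  then consider "t \<in> {0<..e}" | "- t \<in> {0<..e}" using st by force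
  then show "x \<in> strip ?p ?d (rot ?d) r e \<union> strip ?p ?d (- rot ?d) r e"
  proof cases
    case 1
    then have "x \<in> strip ?p ?d (rot ?d) r e" unfolding strip_def by (intro image_eqI[of _ _ "(s, t)"]) (use st eq in simp_all)
    then show ?thesis ..
  next
    case 2
    moreover have "x = ?p + s *\<^sub>R ?d + (- t) *\<^sub>R (- rot ?d)" using eq by simp
    ultimately have "x \<in> strip ?p ?d (- rot ?d) r e" unfolding strip_def by (intro image_eqI[of _ _ "(s, - t)"]) (use st in simp_all)
    then show ?thesis ..
  qed
qed

text \<open>Each of the two strips is contained in the region, where the trace inequality applies,
  or contributes nothing. The quantity \<open>e * norm (dir i)\<close> is the actual height; its
  root accompanies the trace and its first power the gradient, which is just what offsets the
  gradient of the edge cutoff.\<close>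

lemma edge_box_L2:
  assumes i: "i < length vs" and r: "0 < r" and e: "0 < e" and \<psi>: "smooth \<psi>"
    and avoid: "\<And>m. m \<in> {rot (dir i), - rot (dir i)} \<Longrightarrow> strip (vert vs i) (dir i) m r e \<inter> bdry vs = {}"
  shows "L2_norm \<mu> (\<lambda>x. indicator (edge_box (vert vs i) (dir i) r e) x *\<^sub>R \<psi> x)
    \<le> 2 * sqrt (e * norm (dir i)) * L2_norm \<sigma> \<psi> + 2 * (e * norm (dir i)) * L2_norm \<mu> (grad \<psi>)"
proof -
  let ?p = "vert vs i" and ?d = "dir i"
  let ?L = "norm ?d"
  let ?A = "L2_norm \<sigma> \<psi>" and ?G = "L2_norm (lebesgue_on E) (grad \<psi>)"
  let ?N = "edge_box ?p ?d r e"
  have L: "0 < ?L" using dir_nonzero[OF i] by simp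
  have [measurable]: "\<psi> \<in> borel_measurable borel" "grad \<psi> \<in> borel_measurable borel"
    using \<psi> by (auto intro: smooth_borel smooth_grad_borel)
  have [measurable]: "?N \<in> sets borel" by (intro borel_closed closed_edge_box)
  have [measurable]: "E \<in> sets borel" by (rule sets_E(1))
  have S: "(\<integral>\<^sup>+x. indicator (E \<inter> strip ?p ?d m r e) x * ennreal ((\<psi> x)\<^sup>2) \<partial>lborel) \<le> ennreal (2 * (e * ?L) * ?A\<^sup>2 + 2 * (e * ?L)\<^sup>2 * ?G\<^sup>2)"
    if m: "m \<in> {rot ?d, - rot ?d}" for m
  proof -
    have "\<bar>?d$1 * m$2 - ?d$2 * m$1\<bar> = \<bar>?L\<^sup>2\<bar>"
      using m by (metis abs_minus_cancel det_rot insertE singletonD)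
    moreover have "norm m = ?L" using m by (auto simp: rot_simps)
    ultimately have det: "\<bar>?d$1 * m$2 - ?d$2 * m$1\<bar> = ?L\<^sup>2" "norm m = ?L" by simp_all
    then have det0: "?d$1 * m$2 - ?d$2 * m$1 \<noteq> 0" using L by fastforce
    let ?S = "strip ?p ?d m r e"
    have [measurable]: "?S \<in> sets borel" by (rule strip_borel[OF det0])
    show ?thesis
    proof (cases "?S \<inter> E = {}")
      case True
      then have "E \<inter> ?S = {}" by auto
      then show ?thesis by simp
    next
      case False
      then have sub: "?S \<subseteq> E" using strip_inside_or_outside[OF avoid[OF m]] by blast
      then have "E \<inter> ?S = ?S" by auto
      then have "(\<integral>\<^sup>+x. indicator (E \<inter> ?S) x * ennreal ((\<psi> x)\<^sup>2) \<partial>lborel)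
        \<le> ennreal (2 * e * ?L\<^sup>2) * (\<integral>\<^sup>+s. indicator {0..1} s * ennreal ((\<psi> (?p + s *\<^sub>R ?d))\<^sup>2) \<partial>lborel)
          + ennreal (2 * e\<^sup>2 * ?L\<^sup>2) * (\<integral>\<^sup>+x. indicator ?S x * ennreal ((norm (grad \<psi> x))\<^sup>2) \<partial>lborel)"
        using strip_inequality[OF \<psi> det0 e, of r ?p] r unfolding det by simp
      also have "\<dots> \<le> ennreal (2 * (e * ?L)) * ennreal (?A\<^sup>2) + ennreal (2 * (e * ?L)\<^sup>2) * ennreal (?G\<^sup>2)"
      proof (rule add_mono)
        \<comment> \<open>Of the Jacobian, the squared length of the edge, one factor joins
          \<open>e\<close> to form the height and the other converts the parameter integral into arc
          length.\<close>
        have "ennreal (2 * e * ?L\<^sup>2) = ennreal (2 * (e * ?L)) * ennreal ?L"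
          using e by (subst ennreal_mult[symmetric]) (auto simp: power2_eq_square mult.assoc)
        then show "ennreal (2 * e * ?L\<^sup>2) * (\<integral>\<^sup>+s. indicator {0..1} s * ennreal ((\<psi> (?p + s *\<^sub>R ?d))\<^sup>2) \<partial>lborel) \<le> ennreal (2 * (e * ?L)) * ennreal (?A\<^sup>2)"
          using mult_left_mono[OF edge_trace_le[OF \<psi> i], of "ennreal (2 * (e * ?L))"] by (simp add: mult.assoc)
        have "(\<integral>\<^sup>+x. indicator ?S x * ennreal ((norm (grad \<psi> x))\<^sup>2) \<partial>lborel) \<le> (\<integral>\<^sup>+x. indicator E x * ennreal ((norm (grad \<psi> x))\<^sup>2) \<partial>lborel)"
          using sub by (intro nn_integral_mono) (auto simp: indicator_def)
        also have "\<dots> = ennreal (?G\<^sup>2)"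
          by (rule L2_norm_nn_integral[symmetric]) (auto intro: smooth_grad_L2[OF \<psi>])
        finally show "ennreal (2 * e\<^sup>2 * ?L\<^sup>2) * (\<integral>\<^sup>+x. indicator ?S x * ennreal ((norm (grad \<psi> x))\<^sup>2) \<partial>lborel) \<le> ennreal (2 * (e * ?L)\<^sup>2) * ennreal (?G\<^sup>2)"
          by (simp add: power_mult_distrib mult.assoc mult_left_mono)
      qed
      also have "\<dots> = ennreal (2 * (e * ?L) * ?A\<^sup>2 + 2 * (e * ?L)\<^sup>2 * ?G\<^sup>2)"
        using e by (subst ennreal_plus) (auto simp: ennreal_mult)
      finally show ?thesis .
    qed
  qed
  let ?Sp = "E \<inter> strip ?p ?d (rot ?d) r e" and ?Sm = "E \<inter> strip ?p ?d (- rot ?d) r e"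
  have detp: "?d$1 * (rot ?d)$2 - ?d$2 * (rot ?d)$1 \<noteq> 0" "?d$1 * (- rot ?d)$2 - ?d$2 * (- rot ?d)$1 \<noteq> 0"
    unfolding det_rot using L by auto
  have [measurable]: "?Sp \<in> sets borel" "?Sm \<in> sets borel"
    by (auto intro!: sets.Int strip_borel[OF detp(1)] strip_borel[OF detp(2)])
  have fm: "(\<lambda>x. indicator ?N x *\<^sub>R \<psi> x) \<in> borel_measurable borel" by measurable
  have fL2: "(\<lambda>x. indicator ?N x *\<^sub>R \<psi> x) \<in> L2_space (lebesgue_on E)"
    by (rule L2_bounded_scaleR(1)[OF borel_measurable_lebesgue_on smooth_L2[OF \<psi>], of _ 1]) (auto simp: indicator_def)
  have "ennreal ((L2_norm (lebesgue_on E) (\<lambda>x. indicator ?N x *\<^sub>R \<psi> x))\<^sup>2) = (\<integral>\<^sup>+x. indicator E x * ennreal ((norm (indicator ?N x *\<^sub>R \<psi> x))\<^sup>2) \<partial>lborel)"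
    by (rule L2_norm_nn_integral[OF fm fL2])
  also have "\<dots> \<le> (\<integral>\<^sup>+x. indicator ?Sp x * ennreal ((\<psi> x)\<^sup>2) + indicator ?Sm x * ennreal ((\<psi> x)\<^sup>2) \<partial>lborel)"
  proof (rule nn_integral_mono)
    fix x
    show "indicator E x * ennreal ((norm (indicator ?N x *\<^sub>R \<psi> x))\<^sup>2) \<le> indicator ?Sp x * ennreal ((\<psi> x)\<^sup>2) + indicator ?Sm x * ennreal ((\<psi> x)\<^sup>2)"
      using edge_box_region_subset[OF i r, of e] by (cases "x \<in> ?N"; cases "x \<in> E") (auto simp: indicator_def)
  qed
  also have "\<dots> = (\<integral>\<^sup>+x. indicator ?Sp x * ennreal ((\<psi> x)\<^sup>2) \<partial>lborel) + (\<integral>\<^sup>+x. indicator ?Sm x * ennreal ((\<psi> x)\<^sup>2) \<partial>lborel)"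
    by (rule nn_integral_add) measurable
  also have "\<dots> \<le> ennreal (2 * (e * ?L) * ?A\<^sup>2 + 2 * (e * ?L)\<^sup>2 * ?G\<^sup>2) + ennreal (2 * (e * ?L) * ?A\<^sup>2 + 2 * (e * ?L)\<^sup>2 * ?G\<^sup>2)"
    by (intro add_mono S) auto
  also have "\<dots> = ennreal ((2 * (e * ?L) * ?A\<^sup>2 + 2 * (e * ?L)\<^sup>2 * ?G\<^sup>2) + (2 * (e * ?L) * ?A\<^sup>2 + 2 * (e * ?L)\<^sup>2 * ?G\<^sup>2))"
    using e by (intro ennreal_plus[symmetric]) auto
  also have "(2 * (e * ?L) * ?A\<^sup>2 + 2 * (e * ?L)\<^sup>2 * ?G\<^sup>2) + (2 * (e * ?L) * ?A\<^sup>2 + 2 * (e * ?L)\<^sup>2 * ?G\<^sup>2)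
    = 4 * (e * ?L) * ?A\<^sup>2 + 4 * (e * ?L)\<^sup>2 * ?G\<^sup>2" by simp
  finally have "(L2_norm (lebesgue_on E) (\<lambda>x. indicator ?N x *\<^sub>R \<psi> x))\<^sup>2 \<le> 4 * (e * ?L) * ?A\<^sup>2 + 4 * (e * ?L)\<^sup>2 * ?G\<^sup>2"
    using e by (subst (asm) ennreal_le_iff) auto
  also have "\<dots> = (2 * sqrt (e * ?L) * ?A)\<^sup>2 + (2 * (e * ?L) * ?G)\<^sup>2"
    using e by (simp add: power_mult_distrib)
  also have "\<dots> \<le> (2 * sqrt (e * ?L) * ?A + 2 * (e * ?L) * ?G)\<^sup>2"
    using e by (simp add: power2_sum)
  finally show ?thesis by (rule power2_le_imp_le) (use e in auto)
qed


section \<open>Cutting off along the whole boundary\<close>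

lemma vert_in_bdry: "vert vs i \<in> bdry vs"
proof -
  have n: "0 < length vs" using length_ge by linarith
  then have "vert vs i = vert vs (i mod length vs)" "i mod length vs < length vs" by (auto simp: vert_def)
  moreover have "vert vs (i mod length vs) \<in> edge vs (i mod length vs)" by (simp add: edge_def)
  ultimately show ?thesis using edge_subset_bdry by auto
qed

lemma edge_box_near_bdry:
  assumes i: "i < length vs" and r: "0 < r" and x: "x \<in> edge_box (vert vs i) (dir i) r e"
  shows "infdist x (bdry vs) \<le> e * norm (dir i)"
proof -
  let ?p = "vert vs i" and ?d = "dir i"
  define s where "s = (x - ?p) \<bullet> ?d / (norm ?d)\<^sup>2"
  define t where "t = (x - ?p) \<bullet> rot ?d / (norm ?d)\<^sup>2"
  have st: "s \<in> {r..1 - r}" "t \<in> {- e..e}" using x by (auto simp: edge_box_def s_def t_def)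
  have eq: "x = (?p + s *\<^sub>R ?d) + t *\<^sub>R rot ?d"
    using rot_decompose[OF dir_nonzero[OF i], of "x - ?p"] by (simp add: s_def t_def algebra_simps)
  have "?p + s *\<^sub>R ?d \<in> bdry vs"
    using edge_subset_bdry[OF i] unfolding edge_eq by (rule subsetD) (use st r in auto)
  then have "infdist x (bdry vs) \<le> dist x (?p + s *\<^sub>R ?d)" by (rule infdist_le)
  also have "\<dots> = \<bar>t\<bar> * norm ?d" by (subst eq) (simp add: dist_norm rot_simps)
  also have "\<dots> \<le> e * norm ?d" using st(2) by (intro mult_right_mono) auto
  finally show ?thesis .
qed

text \<open>The disc of radius 2\<rho> has area 4 pi \<rho>^2, which is at most (4\<rho>)^2.\<close>

lemma corner_L2:
  assumes \<rho>: "0 < \<rho>" and \<psi>: "smooth \<psi>" "\<And>x. \<bar>\<psi> x\<bar> \<le> 1"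
  shows "L2_norm \<mu> (\<lambda>x. indicator (cball p (2 * \<rho>)) x *\<^sub>R \<psi> x) \<le> 4 * \<rho>"
proof (rule power2_le_imp_le)
  let ?f = "\<lambda>x. indicator (cball p (2 * \<rho>)) x *\<^sub>R \<psi> x"
  have [measurable]: "\<psi> \<in> borel_measurable borel" by (rule smooth_borel[OF \<psi>(1)])
  have [measurable]: "cball p (2 * \<rho>) \<in> sets borel" by simp
  have fm: "?f \<in> borel_measurable borel" by measurable
  have "(indicator (cball p (2 * \<rho>)) :: _ \<Rightarrow> real) \<in> borel_measurable borel" by simp
  then have fL2: "?f \<in> L2_space \<mu>"
    by (rule L2_bounded_scaleR(1)[OF borel_measurable_lebesgue_on smooth_L2[OF \<psi>(1)], where B = 1])
      (simp add: indicator_def)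
  have "ennreal ((L2_norm \<mu> ?f)\<^sup>2) \<le> (\<integral>\<^sup>+x. indicator (cball p (2 * \<rho>)) x \<partial>lborel)"
    unfolding L2_norm_nn_integral[OF fm fL2]
  proof (rule nn_integral_mono)
    fix x
    have "(\<psi> x)\<^sup>2 \<le> 1" using \<psi>(2)[of x] by (simp add: abs_square_le_1)
    then show "indicator E x * ennreal ((norm (?f x))\<^sup>2) \<le> indicator (cball p (2 * \<rho>)) x"
      by (auto simp: indicator_def)
  qed
  also have "\<dots> = ennreal (pi * (2 * \<rho>)\<^sup>2)"
    using \<rho> by (simp add: emeasure_cball unit_ball_vol_2)
  also have "\<dots> \<le> ennreal ((4 * \<rho>)\<^sup>2)"
    using pi_less_4 by (intro ennreal_leI) (simp add: power_mult_distrib mult_right_mono)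
  finally show "(L2_norm \<mu> ?f)\<^sup>2 \<le> (4 * \<rho>)\<^sup>2"
    by (subst (asm) ennreal_le_iff) auto
qed (use \<rho> in simp)

text \<open>A corner contributes 2B/\<rho> times 4\<rho>, that is 8B. An edge of strip height q
  contributes 6B/q times 2 sqrt(q) A + 2 q G, where A is the trace norm and G the gradient norm of
  \<open>\<psi>\<close>. The coefficient 12B/sqrt(q) of A grows as the strips get thin and is
  collected in \<open>K\<close>; all other coefficients are independent of \<rho>.\<close>

lemma boundary_cutoff_aux:
  fixes F :: "real^2 \<Rightarrow> real^2" and h :: "real^2 \<Rightarrow> real"
  assumes F: "F \<in> L2_space \<mu>" and h: "h \<in> L2_space \<mu>"
    and Fh: "\<And>\<phi>. \<phi> \<in> test_functions E \<Longrightarrow>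
      (\<integral>x. F x \<bullet> grad \<phi> x \<partial>\<mu>) = (\<integral>x. h x * \<phi> x \<partial>\<mu>)"
    and B: "\<And>t. \<bar>deriv smooth_step t\<bar> \<le> B" and \<rho>: "0 < \<rho>"
    and r: "\<And>i. i < length vs \<Longrightarrow> 0 < r i" "\<And>i. i < length vs \<Longrightarrow> r i * norm (dir i) \<le> \<rho> / 4"
    and e: "\<And>i. i < length vs \<Longrightarrow> 0 < e i" "\<And>i. i < length vs \<Longrightarrow> e i \<le> r i"
      "\<And>i m. i < length vs \<Longrightarrow> m \<in> {rot (dir i), - rot (dir i)} \<Longrightarrow>
        strip (vert vs i) (dir i) m (r i) (e i) \<inter> bdry vs = {}"
  defines "Z \<equiv> {x. infdist x (bdry vs) \<le> 2 * \<rho>}"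
  shows "\<exists>\<eta> K. \<eta> \<in> borel_measurable borel \<and> (\<forall>x. \<eta> x \<in> {0..1}) \<and> (\<forall>x. x \<notin> Z \<longrightarrow> \<eta> x = 1) \<and>
    (\<forall>\<psi>. smooth \<psi> \<longrightarrow> (\<forall>x. \<bar>\<psi> x\<bar> \<le> 1) \<longrightarrow>
      \<bar>(\<integral>x. (\<eta> x *\<^sub>R F x) \<bullet> grad \<psi> x \<partial>\<mu>) - (\<integral>x. (\<eta> x * h x) * \<psi> x \<partial>\<mu>)\<bar>
      \<le> (real (length vs) * (8 * B) + K * L2_norm \<sigma> \<psi> +
          real (length vs) * (12 * B * L2_norm \<mu> (grad \<psi>))) *
        L2_norm \<mu> (\<lambda>x. indicator Z x *\<^sub>R F x))"
proof -
  let ?n = "length vs"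
  let ?L = "\<lambda>i. norm (dir i)"
  have B0: "0 \<le> B" using B[of 0] by linarith
  have L: "0 < ?L i" if "i < ?n" for i using dir_nonzero[OF that] by simp
  \<comment> \<open>The left summand indexes the corners, the right one the edges, so that both
    kinds of cutoff form one family.\<close>
  let ?J = "{..<?n} <+> {..<?n}"
  define c where "c = case_sum (\<lambda>i. corner_cutoff (vert vs i) \<rho>) (\<lambda>i. edge_cutoff (vert vs i) (dir i) (r i) (e i))"
  define N where "N = case_sum (\<lambda>i. cball (vert vs i) (2 * \<rho>)) (\<lambda>i. edge_box (vert vs i) (dir i) (r i) (e i))"
  define b where "b = case_sum (\<lambda>i::nat. 2 * B / \<rho>) (\<lambda>i::nat. 6 * B / (e i * ?L i))"
  define U where "U = (\<Union>i<?n. ball (vert vs i) \<rho>) \<union> (\<Union>i<?n. edge_core (vert vs i) (dir i) (r i) (e i))"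
  have J: "finite ?J" by simp
  note corner = corner_cutoff[OF \<rho> B]
  note edge = edge_cutoff[OF dir_nonzero r(1) e(1,2) B]
  have c1: "smooth (c j)" if "j \<in> ?J" for j using that by (auto simp: c_def intro: corner edge)
  have c2: "c j x \<in> {0..1}" if "j \<in> ?J" for j x
    using that corner(2) edge(2) unfolding c_def by (elim PlusE) (simp_all del: atLeastAtMost_iff)
  have N1: "closed (N j)" if "j \<in> ?J" for j using that by (auto simp: N_def intro: closed_edge_box)
  have N2: "c j x = 1" if "j \<in> ?J" "x \<notin> N j" for j x
    using that corner(3) edge(3) by (auto simp: N_def c_def simp del: mem_cball)
  have b1: "norm (grad (c j) x) \<le> b j" if "j \<in> ?J" for j x
    using that corner(5) edge(5) by (auto simp: b_def c_def)
  have U1: "open U" unfolding U_def by (intro open_Un open_UN ballI open_ball open_edge_core)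
  have U2: "frontier E \<subseteq> U"
  proof (rule order_trans[OF frontier_region], rule subsetI)
    fix x assume "x \<in> bdry vs"
    then obtain i s where i: "i < ?n" and s: "0 \<le> s" "s \<le> 1" and x: "x = vert vs i + s *\<^sub>R dir i"
      by (auto simp: bdry_def edge_eq)
    have rL: "2 * r i * ?L i < \<rho>" using r(2)[OF i] \<rho> by simp
    \<comment> \<open>Along an edge the core leaves out pieces of relative length
      \<open>2 * r i\<close> at both ends. Their actual length is at most \<rho>/2, so the corner
      discs cover them.\<close>
    consider "s \<le> 2 * r i" | "1 - 2 * r i \<le> s" | "2 * r i < s" "s < 1 - 2 * r i" by linarith
    then show "x \<in> U"
    proof cases
      case 1
      have "dist (vert vs i) x = s * ?L i" using s by (simp add: x dist_norm)
      also have "\<dots> \<le> 2 * r i * ?L i" using 1 by (intro mult_right_mono) auto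
      finally have "x \<in> ball (vert vs i) \<rho>" using rL by simp
      then show ?thesis using i by (auto simp: U_def)
    next
      case 2
      \<comment> \<open>The last edge ends at the vertex with index 0, so the index of the end point
        is reduced modulo the number of vertices.\<close>
      let ?j = "Suc i mod ?n"
      have "0 < ?n" using i by linarith
      then have j: "?j < ?n" "vert vs ?j = vert vs (Suc i)" by (simp_all add: vert_def)
      have "x = vert vs (Suc i) - (1 - s) *\<^sub>R dir i" by (simp add: x dir_def algebra_simps)
      then have "dist (vert vs ?j) x = (1 - s) * ?L i" using s j by (simp add: dist_norm)
      also have "\<dots> \<le> 2 * r i * ?L i" using 2 by (intro mult_right_mono) auto
      finally have "x \<in> ball (vert vs ?j) \<rho>" using rL by simp
      then show ?thesis using j(1) unfolding U_def by blast
    next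
      case 3
      have "x \<in> edge_core (vert vs i) (dir i) (r i) (e i)"
        using 3 e(1)[OF i] dir_nonzero[OF i] by (simp add: edge_core_def x rot_simps power2_norm_eq_inner)
      then show ?thesis using i by (auto simp: U_def)
    qed
  qed
  have U3: "\<exists>j\<in>?J. c j x = 0" if "x \<in> U" for x
  proof -
    from that consider i where "i < ?n" "x \<in> ball (vert vs i) \<rho>" | i where "i < ?n" "x \<in> edge_core (vert vs i) (dir i) (r i) (e i)"
      unfolding U_def by blast
    then show ?thesis
    proof cases
      case 1
      then show ?thesis using corner(4) by (intro bexI[of _ "Inl i"]) (auto simp: c_def simp del: mem_ball)
    next
      case 2
      then show ?thesis using edge(4) by (intro bexI[of _ "Inr i"]) (auto simp: c_def)
    qed
  qed
  let ?\<eta> = "\<lambda>x. \<Prod>j\<in>?J. c j x"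
  define K where "K = (\<Sum>i<?n. 12 * B / sqrt (e i * ?L i))"
  let ?\<omega> = "L2_norm (lebesgue_on E) (\<lambda>x. indicator Z x *\<^sub>R F x)"
  have NZ: "N j \<subseteq> Z" if "j \<in> ?J" for j
    using that
  proof (elim PlusE)
    fix i assume "j = Inl i" "i \<in> {..<?n}"
    then show ?thesis
      by (auto simp: N_def Z_def dist_commute intro!: order_trans[OF infdist_le[OF vert_in_bdry[of i]]])
  next
    fix i assume i: "j = Inr i" "i \<in> {..<?n}"
    then have "e i * ?L i \<le> 2 * \<rho>"
      using mult_right_mono[OF e(2), of i "?L i"] r(2)[of i] \<rho> by simp
    then show ?thesis
      using i edge_box_near_bdry[OF _ r(1), of i] by (auto simp: N_def Z_def intro: order_trans)
  qed
  have closedZ: "closed Z" unfolding Z_def by (intro closed_Collect_le continuous_intros)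
  have FN: "L2_norm (lebesgue_on E) (\<lambda>x. indicator (N j) x *\<^sub>R F x) \<le> ?\<omega>" if j: "j \<in> ?J" for j
  proof (rule L2_dominated(2))
    have "(indicator (N j) :: _ \<Rightarrow> real) \<in> borel_measurable (lebesgue_on E)"
      using N1[OF j] by (intro borel_measurable_lebesgue_on) simp
    then show "(\<lambda>x. indicator (N j) x *\<^sub>R F x) \<in> borel_measurable (lebesgue_on E)"
      using L2_measurable[OF F] by (rule borel_measurable_scaleR)
    have "(indicator Z :: _ \<Rightarrow> real) \<in> borel_measurable (lebesgue_on E)"
      using closedZ by (intro borel_measurable_lebesgue_on) simp
    then show "(\<lambda>x. indicator Z x *\<^sub>R F x) \<in> L2_space (lebesgue_on E)"
      by (rule L2_bounded_scaleR(1)[OF _ F, of _ 1]) (auto simp: indicator_def)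
    show "AE x in lebesgue_on E. norm (indicator (N j) x *\<^sub>R F x) \<le> norm (indicator Z x *\<^sub>R F x)"
      using NZ[OF j] by (intro AE_I2) (auto simp: indicator_def)
  qed
  have \<omega>0: "0 \<le> ?\<omega>" by simp
  have "\<bar>(\<integral>x. (?\<eta> x *\<^sub>R F x) \<bullet> grad \<psi> x \<partial>lebesgue_on E) - (\<integral>x. (?\<eta> x * h x) * \<psi> x \<partial>lebesgue_on E)\<bar>
      \<le> (real ?n * (8 * B) + K * L2_norm \<sigma> \<psi> + real ?n * (12 * B * L2_norm (lebesgue_on E) (grad \<psi>))) * ?\<omega>"
    if \<psi>: "smooth \<psi>" "\<And>x. \<bar>\<psi> x\<bar> \<le> 1" for \<psi>
  proof -
    let ?A = "L2_norm \<sigma> \<psi>" and ?G = "L2_norm (lebesgue_on E) (grad \<psi>)"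
    let ?T = "\<lambda>j. b j * (L2_norm (lebesgue_on E) (\<lambda>x. indicator (N j) x *\<^sub>R F x) * L2_norm (lebesgue_on E) (\<lambda>x. indicator (N j) x *\<^sub>R \<psi> x))"
    have "\<bar>(\<integral>x. (?\<eta> x *\<^sub>R F x) \<bullet> grad \<psi> x \<partial>lebesgue_on E) - (\<integral>x. (?\<eta> x * h x) * \<psi> x \<partial>lebesgue_on E)\<bar> \<le> (\<Sum>j\<in>?J. ?T j)"
      by (rule cutoff_estimate[OF F h Fh \<psi>(1) J c1 c2 N1 N2 b1 U1 U2 U3])
    also have "\<dots> = (\<Sum>i<?n. ?T (Inl i)) + (\<Sum>i<?n. ?T (Inr i))"
      by (subst sum.Plus) simp_all
    \<comment> \<open>Every neighbourhood \<open>N j\<close> lies in \<open>Z\<close>, so the norm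
      of \<open>F\<close> on it is bounded by \<open>?\<omega>\<close>, a factor common to all
      terms.\<close>
    also have "\<dots> \<le> (\<Sum>i<?n. 8 * B * ?\<omega>) + (\<Sum>i<?n. (12 * B / sqrt (e i * ?L i) * ?A + 12 * B * ?G) * ?\<omega>)"
    proof (intro add_mono sum_mono)
      fix i assume i: "i \<in> {..<?n}"
      have "?T (Inl i) \<le> 2 * B / \<rho> * (?\<omega> * (4 * \<rho>))"
        unfolding b_def sum.case
        using FN[of "Inl i"] corner_L2[OF \<rho> \<psi>, of "vert vs i"] i B0 \<rho>
        by (intro mult_left_mono mult_mono) (auto simp: N_def)
      then show "?T (Inl i) \<le> 8 * B * ?\<omega>" using \<rho> by simp
    next
      fix i assume "i \<in> {..<?n}"
      then have i: "i < ?n" by simp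
      let ?q = "e i * ?L i"
      have q: "0 < ?q" using e(1)[OF i] L[OF i] by simp
      have "?T (Inr i) \<le> 6 * B / ?q * (?\<omega> * (2 * sqrt ?q * ?A + 2 * ?q * ?G))"
        unfolding b_def sum.case
        using FN[of "Inr i"] edge_box_L2[OF i r(1)[OF i] e(1)[OF i] \<psi>(1) e(3)[OF i]] i B0 q
        by (intro mult_left_mono mult_mono) (auto simp: N_def)
      also have "\<dots> = (12 * B * (sqrt ?q / ?q) * ?A + 12 * B * (?q / ?q) * ?G) * ?\<omega>"
        by (simp add: algebra_simps add_divide_distrib)
      also have "sqrt ?q / ?q = 1 / sqrt ?q" using q by (subst sqrt_divide_self_eq) (auto simp: inverse_eq_divide)
      finally show "?T (Inr i) \<le> (12 * B / sqrt ?q * ?A + 12 * B * ?G) * ?\<omega>"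
        unfolding divide_self[OF less_imp_neq[OF q, symmetric]] by simp
    qed
    also have "\<dots> = (real ?n * (8 * B) + K * ?A + real ?n * (12 * B * ?G)) * ?\<omega>"
      unfolding sum_distrib_right[symmetric] sum.distrib K_def[symmetric] sum_constant card_lessThan
      by (simp add: algebra_simps)
    finally show ?thesis .
  qed
  moreover have "?\<eta> \<in> borel_measurable borel" by (intro smooth_borel smooth_prod c1)
  moreover have "?\<eta> x \<in> {0..1}" for x using c2 by (auto intro!: prod_nonneg prod_le_1)
  moreover have "?\<eta> x = 1" if "x \<notin> Z" for x
    using that NZ N2 by (intro prod.neutral) blast
  ultimately show ?thesis by (intro exI[of _ ?\<eta>] exI[of _ K]) blast
qed

lemma boundary_cutoff:
  fixes F :: "real^2 \<Rightarrow> real^2" and h :: "real^2 \<Rightarrow> real"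
  assumes F: "F \<in> L2_space \<mu>" and h: "h \<in> L2_space \<mu>"
    and Fh: "\<And>\<phi>. \<phi> \<in> test_functions E \<Longrightarrow>
      (\<integral>x. F x \<bullet> grad \<phi> x \<partial>\<mu>) = (\<integral>x. h x * \<phi> x \<partial>\<mu>)"
    and B: "\<And>t. \<bar>deriv smooth_step t\<bar> \<le> B" and \<rho>: "0 < \<rho>"
  defines "Z \<equiv> {x. infdist x (bdry vs) \<le> 2 * \<rho>}"
  shows "\<exists>\<eta> K. \<eta> \<in> borel_measurable borel \<and> (\<forall>x. \<eta> x \<in> {0..1}) \<and> (\<forall>x. x \<notin> Z \<longrightarrow> \<eta> x = 1) \<and>
    (\<forall>\<psi>. smooth \<psi> \<longrightarrow> (\<forall>x. \<bar>\<psi> x\<bar> \<le> 1) \<longrightarrow>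
      \<bar>(\<integral>x. (\<eta> x *\<^sub>R F x) \<bullet> grad \<psi> x \<partial>\<mu>) - (\<integral>x. (\<eta> x * h x) * \<psi> x \<partial>\<mu>)\<bar>
      \<le> (real (length vs) * (8 * B) + K * L2_norm \<sigma> \<psi> +
          real (length vs) * (12 * B * L2_norm \<mu> (grad \<psi>))) *
        L2_norm \<mu> (\<lambda>x. indicator Z x *\<^sub>R F x))"
proof -
  let ?n = "length vs"
  let ?L = "\<lambda>i. norm (dir i)"
  have L: "0 < ?L i" if "i < ?n" for i using dir_nonzero[OF that] by simp
  \<comment> \<open>The cap 1/8 keeps \<open>r i\<close> below 1, and the other bound makes the
    uncovered ends of each edge fit into the corner discs.\<close>
  define r where "r i = min (1 / 8) (\<rho> / (4 * ?L i))" for i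
  have r: "0 < r i" "r i \<le> 1 / 8" "r i * ?L i \<le> \<rho> / 4" if "i < ?n" for i
  proof -
    show "0 < r i" "r i \<le> 1 / 8" using L[OF that] \<rho> by (auto simp: r_def)
    have "r i * ?L i \<le> (\<rho> / (4 * ?L i)) * ?L i" unfolding r_def by (intro mult_right_mono) auto
    then show "r i * ?L i \<le> \<rho> / 4" using L[OF that] by simp
  qed
  have "\<exists>e. 0 < e \<and> e \<le> r i \<and>
    (\<forall>m\<in>{rot (dir i), - rot (dir i)}. strip (vert vs i) (dir i) m (r i) e \<inter> bdry vs = {})" if i: "i < ?n" for i
  proof -
    obtain e0 where e0: "0 < e0"
      "\<And>e m. 0 < e \<Longrightarrow> e < e0 \<Longrightarrow> m \<in> {rot (dir i), - rot (dir i)} \<Longrightarrow> strip (vert vs i) (dir i) m (r i) e \<inter> bdry vs = {}"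
      by (rule strips_avoid_bdry[OF i, of "r i"]) (use r[OF i] in auto)
    show ?thesis
      \<comment> \<open>Halving \<open>e0\<close> makes the inequality strict, and the minimum with
        \<open>r i\<close> secures the relation between the slopes of the edge cutoff.\<close>
      by (intro exI[of _ "min (r i) (e0 / 2)"]) (use r(1)[OF i] e0 in auto)
  qed
  then obtain e where "\<And>i. i < ?n \<Longrightarrow> 0 < e i \<and> e i \<le> r i \<and>
    (\<forall>m\<in>{rot (dir i), - rot (dir i)}. strip (vert vs i) (dir i) m (r i) (e i) \<inter> bdry vs = {})"
    by metis
  then have e: "\<And>i. i < ?n \<Longrightarrow> 0 < e i" "\<And>i. i < ?n \<Longrightarrow> e i \<le> r i"
    "\<And>i m. i < ?n \<Longrightarrow> m \<in> {rot (dir i), - rot (dir i)} \<Longrightarrow>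
      strip (vert vs i) (dir i) m (r i) (e i) \<inter> bdry vs = {}"
    by blast+
  show ?thesis
    unfolding Z_def by (rule boundary_cutoff_aux[OF F h Fh B \<rho> r(1,3) e])
qed

text \<open>The bound on \<open>f n\<close> serves to control the corners: a disc of radius \<open>\<rho>\<close> has area of order
  \<open>\<rho>\<^sup>2\<close>, which offsets the gradient \<open>1/\<rho>\<close> of the cutoff.\<close>

lemma test_with_vanishing_trace:
  fixes F \<Psi> :: "real^2 \<Rightarrow> real^2" and h \<psi> :: "real^2 \<Rightarrow> real"
  assumes F: "F \<in> L2_space \<mu>" and h: "h \<in> L2_space \<mu>"
    and Fh: "\<And>\<phi>. \<phi> \<in> test_functions E \<Longrightarrow>
      (\<integral>x. F x \<bullet> grad \<phi> x \<partial>\<mu>) = (\<integral>x. h x * \<phi> x \<partial>\<mu>)"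
    and f: "\<And>n. smooth (f n)" "\<And>n x. \<bar>f n x\<bar> \<le> 1"
    and L2: "\<psi> \<in> L2_space \<mu>" "\<Psi> \<in> L2_space \<mu>"
    and lim: "(\<lambda>n. L2_norm \<mu> (\<lambda>x. f n x - \<psi> x)) \<longlonglongrightarrow> 0"
      "(\<lambda>n. L2_norm \<mu> (\<lambda>x. grad (f n) x - \<Psi> x)) \<longlonglongrightarrow> 0"
      "(\<lambda>n. L2_norm \<sigma> (f n)) \<longlonglongrightarrow> 0"
  shows "(\<integral>x. F x \<bullet> \<Psi> x \<partial>\<mu>) = (\<integral>x. h x * \<psi> x \<partial>\<mu>)"
proof -
  obtain B where B: "0 \<le> B" "\<And>t. \<bar>deriv smooth_step t\<bar> \<le> B" by (rule smooth_step_deriv_bounded) blast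
  define \<rho> where "\<rho> k = 1 / real (Suc k)" for k
  define Z where "Z k = {x. infdist x (bdry vs) \<le> 2 * \<rho> k}" for k
  let ?\<omega> = "\<lambda>k. L2_norm \<mu> (\<lambda>x. indicator (Z k) x *\<^sub>R F x)"
  let ?n = "real (length vs)"
  define P where "P k \<eta> K \<longleftrightarrow> \<eta> \<in> borel_measurable borel \<and> (\<forall>x. \<eta> x \<in> {0..1}) \<and> (\<forall>x. x \<notin> Z k \<longrightarrow> \<eta> x = 1) \<and>
    (\<forall>\<psi>. smooth \<psi> \<longrightarrow> (\<forall>x. \<bar>\<psi> x\<bar> \<le> 1) \<longrightarrow>
      \<bar>(\<integral>x. (\<eta> x *\<^sub>R F x) \<bullet> grad \<psi> x \<partial>\<mu>) - (\<integral>x. (\<eta> x * h x) * \<psi> x \<partial>\<mu>)\<bar>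
      \<le> (?n * (8 * B) + K * L2_norm \<sigma> \<psi> + ?n * (12 * B * L2_norm \<mu> (grad \<psi>))) * ?\<omega> k)" for k \<eta> K
  have "\<exists>\<eta> K. P k \<eta> K" for k
    unfolding P_def Z_def by (intro boundary_cutoff[OF F h Fh B(2)]) (auto simp: \<rho>_def)
  then obtain \<eta> K where P: "\<And>k. P k (\<eta> k) (K k)" by metis
  have \<eta>: "\<And>k. \<eta> k \<in> borel_measurable borel" "\<And>k x. \<eta> k x \<in> {0..1}" "\<And>k x. x \<notin> Z k \<Longrightarrow> \<eta> k x = 1"
    using P unfolding P_def by blast+
  have est: "\<And>k \<psi>. smooth \<psi> \<Longrightarrow> (\<And>x. \<bar>\<psi> x\<bar> \<le> 1) \<Longrightarrow>
      \<bar>(\<integral>x. (\<eta> k x *\<^sub>R F x) \<bullet> grad \<psi> x \<partial>\<mu>) - (\<integral>x. (\<eta> k x * h x) * \<psi> x \<partial>\<mu>)\<bar>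
      \<le> (?n * (8 * B) + K k * L2_norm \<sigma> \<psi> + ?n * (12 * B * L2_norm \<mu> (grad \<psi>))) * ?\<omega> k"
    using P unfolding P_def by blast
  have \<eta>m: "\<eta> k \<in> borel_measurable \<mu>" for k by (intro borel_measurable_lebesgue_on \<eta>)
  have \<eta>1: "\<bar>\<eta> k x\<bar> \<le> 1" for k x using \<eta>(2)[of k x] by simp
  have \<eta>F: "(\<lambda>x. \<eta> k x *\<^sub>R F x) \<in> L2_space \<mu>" for k by (rule L2_bounded_scaleR(1)[OF \<eta>m F \<eta>1])
  have \<eta>h: "(\<lambda>x. \<eta> k x * h x) \<in> L2_space \<mu>" for k using L2_bounded_scaleR(1)[OF \<eta>m h \<eta>1] by simp
  have fL2: "f n \<in> L2_space \<mu>" "grad (f n) \<in> L2_space \<mu>" for n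
    by (intro smooth_L2 smooth_grad_L2 f)+
  let ?C = "?n * (8 * B) + ?n * (12 * B * L2_norm \<mu> \<Psi>)"
  \<comment> \<open>Here \<open>k\<close> is fixed and \<open>n\<close> tends to infinity: however
    large \<open>K k\<close> may be, it multiplies trace norms that tend to 0. What is left is a
    constant independent of \<open>k\<close> times \<open>?\<omega> k\<close>.\<close>
  have bound: "\<bar>(\<integral>x. (\<eta> k x *\<^sub>R F x) \<bullet> \<Psi> x \<partial>\<mu>) - (\<integral>x. (\<eta> k x * h x) \<bullet> \<psi> x \<partial>\<mu>)\<bar> \<le> ?C * ?\<omega> k" for k
  proof (rule LIMSEQ_le)
    show "(\<lambda>n. \<bar>(\<integral>x. (\<eta> k x *\<^sub>R F x) \<bullet> grad (f n) x \<partial>\<mu>) - (\<integral>x. (\<eta> k x * h x) \<bullet> f n x \<partial>\<mu>)\<bar>)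
      \<longlonglongrightarrow> \<bar>(\<integral>x. (\<eta> k x *\<^sub>R F x) \<bullet> \<Psi> x \<partial>\<mu>) - (\<integral>x. (\<eta> k x * h x) \<bullet> \<psi> x \<partial>\<mu>)\<bar>"
      by (intro tendsto_rabs tendsto_diff L2_inner_tendsto fL2 L2 lim \<eta>F \<eta>h)
    have "(\<lambda>n. (?n * (8 * B) + K k * L2_norm \<sigma> (f n) + ?n * (12 * B * L2_norm \<mu> (grad (f n)))) * ?\<omega> k)
      \<longlonglongrightarrow> (?n * (8 * B) + K k * 0 + ?n * (12 * B * L2_norm \<mu> \<Psi>)) * ?\<omega> k"
      by (intro tendsto_mult tendsto_add tendsto_const lim L2_norm_tendsto[OF fL2(2) L2(2)])
    then show "(\<lambda>n. (?n * (8 * B) + K k * L2_norm \<sigma> (f n) + ?n * (12 * B * L2_norm \<mu> (grad (f n)))) * ?\<omega> k)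
      \<longlonglongrightarrow> ?C * ?\<omega> k" by simp
    show "\<exists>N. \<forall>n\<ge>N. \<bar>(\<integral>x. (\<eta> k x *\<^sub>R F x) \<bullet> grad (f n) x \<partial>\<mu>) - (\<integral>x. (\<eta> k x * h x) \<bullet> f n x \<partial>\<mu>)\<bar>
      \<le> (?n * (8 * B) + K k * L2_norm \<sigma> (f n) + ?n * (12 * B * L2_norm \<mu> (grad (f n)))) * ?\<omega> k"
      using est[OF f] by (simp only: inner_real_def) blast
  qed
  \<comment> \<open>A point of the open region has positive distance from the boundary, so the
    shrinking neighbourhoods \<open>Z k\<close> eventually miss it. Hence \<open>?\<omega>\<close>
    tends to 0 and the cutoffs tend to 1.\<close>
  have far: "\<forall>\<^sub>F k in sequentially. x \<notin> Z k" if x: "x \<in> E" for x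
  proof -
    have ne: "bdry vs \<noteq> {}" using vert_in_bdry by blast
    have "infdist x (bdry vs) > 0"
      using in_closed_iff_infdist_zero[OF compact_imp_closed[OF compact_bdry] ne, of x]
        region_disjoint_bdry[OF x] infdist_nonneg[of x "bdry vs"] by linarith
    moreover have "(\<lambda>k. 2 * \<rho> k) \<longlonglongrightarrow> 2 * 0"
      unfolding \<rho>_def using LIMSEQ_inverse_real_of_nat by (intro tendsto_intros) (simp add: inverse_eq_divide)
    ultimately have "\<forall>\<^sub>F k in sequentially. 2 * \<rho> k < infdist x (bdry vs)"
      by (intro order_tendstoD(2)[of _ 0]) simp_all
    then show ?thesis by eventually_elim (simp add: Z_def)
  qed
  have Zm: "(indicator (Z k) :: _ \<Rightarrow> real) \<in> borel_measurable \<mu>" for k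
  proof -
    have "closed (Z k)" unfolding Z_def by (intro closed_Collect_le continuous_intros)
    then show ?thesis by (intro borel_measurable_lebesgue_on) simp
  qed
  have "(\<lambda>k. L2_norm \<mu> (\<lambda>x. indicator (Z k) x *\<^sub>R F x - 0)) \<longlonglongrightarrow> 0"
  proof (rule L2_dominated_convergence[OF _ _ F])
    show "AE x in \<mu>. (\<lambda>k. indicator (Z k) x *\<^sub>R F x) \<longlonglongrightarrow> 0"
    proof (rule AE_I2)
      fix x assume "x \<in> space \<mu>"
      then have "\<forall>\<^sub>F k in sequentially. indicator (Z k) x *\<^sub>R F x = 0"
        using far[of x] by (auto elim: eventually_mono)
      then show "(\<lambda>k. indicator (Z k) x *\<^sub>R F x) \<longlonglongrightarrow> 0" by (rule tendsto_eventually)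
    qed
  qed (auto simp: indicator_def intro!: borel_measurable_scaleR Zm[unfolded indicator_def] L2_measurable[OF F])
  then have \<omega>0: "?\<omega> \<longlonglongrightarrow> 0" by simp
  have conv: "(\<lambda>k. L2_norm \<mu> (\<lambda>x. \<eta> k x *\<^sub>R G x - G x)) \<longlonglongrightarrow> 0" if G: "G \<in> L2_space \<mu>" for G :: "real^2 \<Rightarrow> 'b::euclidean_space"
  proof (rule L2_dominated_convergence[OF L2_measurable[OF G] _ G])
    show "(\<lambda>x. \<eta> k x *\<^sub>R G x) \<in> borel_measurable \<mu>" for k
      by (rule borel_measurable_scaleR[OF \<eta>m L2_measurable[OF G]])
    show "norm (\<eta> k x *\<^sub>R G x) \<le> norm (G x)" for k x
      using \<eta>1[of k x] by (simp add: mult_left_le_one_le)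
    show "AE x in \<mu>. (\<lambda>k. \<eta> k x *\<^sub>R G x) \<longlonglongrightarrow> G x"
    proof (rule AE_I2)
      fix x assume "x \<in> space \<mu>"
      then have "\<forall>\<^sub>F k in sequentially. \<eta> k x *\<^sub>R G x = G x"
        using far[of x] by (auto elim!: eventually_mono simp: \<eta>(3))
      then show "(\<lambda>k. \<eta> k x *\<^sub>R G x) \<longlonglongrightarrow> G x" by (rule tendsto_eventually)
    qed
  qed
  have "(\<lambda>k. (\<integral>x. (\<eta> k x *\<^sub>R F x) \<bullet> \<Psi> x \<partial>\<mu>) - (\<integral>x. (\<eta> k x * h x) \<bullet> \<psi> x \<partial>\<mu>))
    \<longlonglongrightarrow> (\<integral>x. F x \<bullet> \<Psi> x \<partial>\<mu>) - (\<integral>x. h x \<bullet> \<psi> x \<partial>\<mu>)"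
  proof (intro tendsto_diff)
    show "(\<lambda>k. \<integral>x. (\<eta> k x *\<^sub>R F x) \<bullet> \<Psi> x \<partial>\<mu>) \<longlonglongrightarrow> (\<integral>x. F x \<bullet> \<Psi> x \<partial>\<mu>)"
      using L2_inner_tendsto[OF \<eta>F F conv[OF F] L2(2)] by (simp add: inner_commute)
    show "(\<lambda>k. \<integral>x. (\<eta> k x * h x) \<bullet> \<psi> x \<partial>\<mu>) \<longlonglongrightarrow> (\<integral>x. h x \<bullet> \<psi> x \<partial>\<mu>)"
      using L2_inner_tendsto[of "\<lambda>k x. \<eta> k x * h x" \<mu> h \<psi>] \<eta>h h conv[OF h] L2(1) by (simp add: mult.commute)
  qed
  moreover have "(\<lambda>k. (\<integral>x. (\<eta> k x *\<^sub>R F x) \<bullet> \<Psi> x \<partial>\<mu>) - (\<integral>x. (\<eta> k x * h x) \<bullet> \<psi> x \<partial>\<mu>)) \<longlonglongrightarrow> 0"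
    by (rule tendsto_zero_bound[OF bound tendsto_mult_right_zero[OF \<omega>0]])
  ultimately have "(\<integral>x. F x \<bullet> \<Psi> x \<partial>\<mu>) - (\<integral>x. h x \<bullet> \<psi> x \<partial>\<mu>) = 0" by (rule LIMSEQ_unique)
  then show ?thesis by simp
qed


section \<open>Traces and the maximum principle\<close>

lemma has_trace_iff:
  "has_trace vs v g \<longleftrightarrow> v \<in> H1 E \<and> g \<in> L2_space \<sigma> \<and>
    (\<exists>\<phi>. H1_lim \<phi> v \<and> (\<lambda>n. L2_norm \<sigma> (\<lambda>x. \<phi> n x - g x)) \<longlonglongrightarrow> 0)"
proof -
  have "(\<forall>n. smooth (\<phi> n)) \<and> (\<lambda>n. H1_norm E (\<lambda>x. \<phi> n x - v x)) \<longlonglongrightarrow> 0 \<longleftrightarrow> H1_lim \<phi> v"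
    if "v \<in> H1 E" for \<phi>
    using H1_lim_iff[OF that, of \<phi>] H1_lim_smooth[of \<phi> v] by blast
  then show ?thesis unfolding has_trace_def by (metis (no_types, lifting))
qed

lemma has_trace_lincomb:
  assumes "has_trace vs u g" "has_trace vs v k"
  shows "has_trace vs (\<lambda>x. a * u x + b * v x) (\<lambda>x. a * g x + b * k x)"
proof -
  obtain \<phi> \<psi> where \<phi>: "H1_lim \<phi> u" "(\<lambda>n. L2_norm \<sigma> (\<lambda>x. \<phi> n x - g x)) \<longlonglongrightarrow> 0"
    and \<psi>: "H1_lim \<psi> v" "(\<lambda>n. L2_norm \<sigma> (\<lambda>x. \<psi> n x - k x)) \<longlonglongrightarrow> 0"
    and H: "u \<in> H1 E" "v \<in> H1 E"
    and L2: "g \<in> L2_space \<sigma>" "k \<in> L2_space \<sigma>"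
    using assms unfolding has_trace_iff by blast
  have "(\<lambda>x. a * g x + b * k x) \<in> L2_space \<sigma>"
    using L2_add[OF L2_scaleR[OF L2(1), of a] L2_scaleR[OF L2(2), of b]] by simp
  moreover have "(\<lambda>n. L2_norm \<sigma> (\<lambda>x. a *\<^sub>R (\<phi> n x - g x) + b *\<^sub>R (\<psi> n x - k x))) \<longlonglongrightarrow> 0"
    by (intro L2_norm_lincomb_tendsto_0 L2_diff continuous_L2_bdry smooth_continuous L2 \<phi>(2) \<psi>(2)
        H1_lim_smooth[OF \<phi>(1)] H1_lim_smooth[OF \<psi>(1)])
  moreover have "(\<lambda>x. a *\<^sub>R (\<phi> n x - g x) + b *\<^sub>R (\<psi> n x - k x)) = (\<lambda>x. a * \<phi> n x + b * \<psi> n x - (a * g x + b * k x))" for n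
    by (auto simp: algebra_simps)
  ultimately show ?thesis
    using H1_lim_lincomb[OF H \<phi>(1) \<psi>(1), of a b] H1_lincomb(1)[OF H, of a b] unfolding has_trace_iff by auto
qed

text \<open>The supports of the approximating test functions lie in the region, which misses the
  boundary, so their boundary norms are all 0.\<close>

lemma has_trace_H10:
  assumes "z \<in> H10 E" shows "has_trace vs z (\<lambda>_. 0)"
proof -
  obtain \<phi> where \<phi>: "\<And>n. \<phi> n \<in> test_functions E" "H1_lim \<phi> z" and z: "z \<in> H1 E"
    using assms unfolding H10_iff by blast
  have "L2_norm \<sigma> (\<lambda>x. \<phi> n x - 0) = L2_norm \<sigma> (\<lambda>_. 0::real)" for n
    unfolding L2_norm_def
    by (intro arg_cong[where f = sqrt] Bochner_Integration.integral_cong refl)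
      (use test_functions_outside(1)[OF \<phi>(1)] region_disjoint_bdry in \<open>force simp: space_bdry_measure\<close>)
  moreover have "L2_norm \<sigma> (\<lambda>_. 0::real) = 0" by (simp add: L2_norm_def)
  ultimately show ?thesis using z \<phi>(2) unfolding has_trace_iff by auto
qed

text \<open>Tested with the truncation, the equation of \<open>u\<close> gives a nonnegative
  integral, that of \<open>deriv bump (u - M)\<close> times the squared gradient, a nonpositive
  value. So the truncated gradient is zero. The function \<open>t\<close> then takes over the role
  of a Poincare inequality for functions of vanishing trace.\<close>

lemma maximum_principle:
  assumes lap: "has_weak_laplacian E u f" "AE x in \<mu>. 0 \<le> f x"
    and trace: "has_trace vs u g" "AE x in \<sigma>. g x \<le> M"
    and t: "t \<in> H1 E" "has_weak_laplacian E t (\<lambda>_. - 1)"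
  shows "AE x in \<mu>. u x \<le> M"
proof -
  obtain \<phi> where \<phi>: "H1_lim \<phi> u" "(\<lambda>n. L2_norm \<sigma> (\<lambda>x. \<phi> n x - g x)) \<longlonglongrightarrow> 0"
    and u: "u \<in> H1 E" and g: "g \<in> L2_space \<sigma>"
    using trace(1) unfolding has_trace_iff by blast
  have f: "f \<in> L2_space \<mu>" using lap(1) by (simp add: has_weak_laplacian_def)
  have sm: "smooth (\<phi> n)" for n using \<phi>(1) by (rule H1_lim_smooth)
  let ?\<psi> = "\<lambda>x. bump (u x - M)" and ?\<Psi> = "\<lambda>x. deriv bump (u x - M) *\<^sub>R wgrad E u x"
  obtain r where r: "strict_mono r"
    "(\<lambda>n. L2_norm \<mu> (\<lambda>x. bump (\<phi> (r n) x - M) - ?\<psi> x)) \<longlonglongrightarrow> 0"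
    "(\<lambda>n. L2_norm \<mu> (\<lambda>x. grad (\<lambda>x. bump (\<phi> (r n) x - M)) x - ?\<Psi> x)) \<longlonglongrightarrow> 0"
    by (rule bump_H1_lim[OF u \<phi>(1)])
  have sb: "smooth (\<lambda>x. bump (\<phi> (r n) x - M))" for n
    by (intro smooth_comp[OF smooth_bump] smooth_diff smooth_const sm)
  have b1: "\<bar>bump (\<phi> (r n) x - M)\<bar> \<le> 1" for n x using bump_range[of "\<phi> (r n) x - M"] by simp
  have [measurable]: "u \<in> borel_measurable \<mu>" by (intro L2_measurable H1_L2 u)
  have [measurable]: "bump \<in> borel_measurable borel" "deriv bump \<in> borel_measurable borel"
    by (intro smooth_borel smooth_bump smooth_deriv)+
  have \<psi>L2: "?\<psi> \<in> L2_space \<mu>"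
    by (rule L2_bounded(1)[OF finite_measure_E, of _ 1]) (auto simp: bump_range)
  have "\<bar>deriv bump (u x - M)\<bar> \<le> 2" for x using deriv_bump_range[of "u x - M"] by simp
  then have \<Psi>L2: "?\<Psi> \<in> L2_space \<mu>"
    by (intro L2_bounded_scaleR(1)[where B = 2] wgrad_L2 u) measurable
  \<comment> \<open>Where the trace is at most \<open>M\<close>, a positive value of \<phi> - M is
    at most \<phi> - g, so the truncations are dominated on the boundary by the trace error of
    \<phi>.\<close>
  have blim: "(\<lambda>n. L2_norm \<sigma> (\<lambda>x. bump (\<phi> (r n) x - M))) \<longlonglongrightarrow> 0"
  proof (rule tendsto_zero_bound)
    show "(\<lambda>n. L2_norm \<sigma> (\<lambda>x. \<phi> (r n) x - g x)) \<longlonglongrightarrow> 0"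
      using LIMSEQ_subseq_LIMSEQ[OF \<phi>(2) r(1)] by (simp add: comp_def)
    fix n
    have "L2_norm \<sigma> (\<lambda>x. bump (\<phi> (r n) x - M)) \<le> L2_norm \<sigma> (\<lambda>x. \<phi> (r n) x - g x)"
    proof (rule L2_dominated(2))
      show "(\<lambda>x. bump (\<phi> (r n) x - M)) \<in> borel_measurable \<sigma>"
        by (intro borel_measurable_bdry smooth_borel sb)
      show "(\<lambda>x. \<phi> (r n) x - g x) \<in> L2_space \<sigma>"
        by (intro L2_diff g continuous_L2_bdry smooth_continuous sm)
      show "AE x in \<sigma>. norm (bump (\<phi> (r n) x - M)) \<le> norm (\<phi> (r n) x - g x)"
        using trace(2)
      proof eventually_elim
        case (elim x)
        then show ?case using bump_le[of "\<phi> (r n) x - M"] bump_range(1)[of "\<phi> (r n) x - M"] by (auto simp: max_def split: if_splits)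
      qed
    qed
    then show "\<bar>L2_norm \<sigma> (\<lambda>x. bump (\<phi> (r n) x - M))\<bar> \<le> L2_norm \<sigma> (\<lambda>x. \<phi> (r n) x - g x)" by simp
  qed
  have "(\<integral>x. wgrad E u x \<bullet> ?\<Psi> x \<partial>\<mu>) = (\<integral>x. - f x * ?\<psi> x \<partial>\<mu>)"
  proof (rule test_with_vanishing_trace[OF wgrad_L2[OF u] L2_minus[OF f] _ sb b1 \<psi>L2 \<Psi>L2 r(2,3) blim])
    fix \<theta> assume "\<theta> \<in> test_functions E"
    then have "- (\<integral>x. wgrad E u x \<bullet> grad \<theta> x \<partial>\<mu>) = (\<integral>x. f x * \<theta> x \<partial>\<mu>)"
      using lap(1) by (simp add: has_weak_laplacian_def)
    then show "(\<integral>x. wgrad E u x \<bullet> grad \<theta> x \<partial>\<mu>) = (\<integral>x. - f x * \<theta> x \<partial>\<mu>)" by simp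
  qed
  also have "\<dots> \<le> 0"
  proof -
    have "0 \<le> (\<integral>x. f x * ?\<psi> x \<partial>\<mu>)"
      using lap(2) by (intro integral_nonneg_AE) (auto elim!: eventually_mono intro!: mult_nonneg_nonneg bump_range)
    then show ?thesis by simp
  qed
  finally have le0: "(\<integral>x. wgrad E u x \<bullet> ?\<Psi> x \<partial>\<mu>) \<le> 0" .
  have nn: "0 \<le> wgrad E u x \<bullet> ?\<Psi> x" for x using deriv_bump_range(1) by simp
  have "(\<integral>x. wgrad E u x \<bullet> ?\<Psi> x \<partial>\<mu>) = 0"
    by (intro antisym le0 integral_nonneg_AE AE_I2 nn)
  then have "AE x in \<mu>. wgrad E u x \<bullet> ?\<Psi> x = 0"
    using integral_nonneg_eq_0_iff_AE[OF L2_inner_integrable[OF wgrad_L2[OF u] \<Psi>L2]] nn by simp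
  then have \<Psi>0: "AE x in \<mu>. ?\<Psi> x = 0" by eventually_elim auto
  \<comment> \<open>The right-hand side -1 of \<open>t\<close> produces exactly the integral of the
    truncation, while the left side vanishes with the truncated gradient.\<close>
  have "(\<integral>x. wgrad E t x \<bullet> ?\<Psi> x \<partial>\<mu>) = (\<integral>x. 1 * ?\<psi> x \<partial>\<mu>)"
  proof (rule test_with_vanishing_trace[OF wgrad_L2[OF t(1)] continuous_L2 _ sb b1 \<psi>L2 \<Psi>L2 r(2,3) blim])
    fix \<theta> assume "\<theta> \<in> test_functions E"
    then have "- (\<integral>x. wgrad E t x \<bullet> grad \<theta> x \<partial>\<mu>) = (\<integral>x. (- 1) * \<theta> x \<partial>\<mu>)"
      using t(2) unfolding has_weak_laplacian_def by blast
    then show "(\<integral>x. wgrad E t x \<bullet> grad \<theta> x \<partial>\<mu>) = (\<integral>x. 1 * \<theta> x \<partial>\<mu>)" by simp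
  qed simp
  moreover have "(\<integral>x. wgrad E t x \<bullet> ?\<Psi> x \<partial>\<mu>) = 0"
    by (rule integral_eq_zero_AE) (use \<Psi>0 in \<open>eventually_elim, simp only: inner_zero_right\<close>)
  ultimately have "(\<integral>x. ?\<psi> x \<partial>\<mu>) = 0" by simp
  then have "AE x in \<mu>. ?\<psi> x = 0"
    using integral_nonneg_eq_0_iff_AE[OF L2_imp_integrable[OF finite_measure_E \<psi>L2]] bump_range by simp
  then show ?thesis
  proof eventually_elim
    case (elim x)
    then show ?case using bump_pos[of "u x - M"] by (cases "u x \<le> M") auto
  qed
qed

text \<open>The maximum principle is applied to \<open>w\<close> and to its negative; the latter is
  written as a linear combination with a zero second coefficient to fit the lemmas on traces and
  Laplacians.\<close>

lemma harmonic_bound: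
  assumes lap: "has_weak_laplacian E w (\<lambda>_. 0)"
    and trace: "has_trace vs w g" "AE x in \<sigma>. \<bar>g x\<bar> \<le> M"
    and t: "t \<in> H1 E" "has_weak_laplacian E t (\<lambda>_. - 1)"
  shows "AE x in \<mu>. \<bar>w x\<bar> \<le> M"
proof -
  have w: "w \<in> H1 E" using trace(1) by (simp add: has_trace_def)
  have "AE x in \<mu>. w x \<le> M"
    by (rule maximum_principle[OF lap _ trace(1) _ t]) (use trace(2) in \<open>auto elim: eventually_mono\<close>)
  moreover have "AE x in \<mu>. - 1 * w x + 0 * w x \<le> M"
    by (rule maximum_principle[OF weak_laplacian_lincomb[OF w w lap lap, of "-1" 0] _ has_trace_lincomb[OF trace(1,1), of "-1" 0] _ t])
      (use trace(2) in \<open>auto elim: eventually_mono\<close>)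
  ultimately show ?thesis by eventually_elim auto
qed

text \<open>Both \<open>z - K t\<close> and \<open>- z - K t\<close> have zero trace, and their
  Laplacians \<open>f + K\<close> and \<open>- f + K\<close> are nonnegative almost
  everywhere.\<close>

lemma torsion_bound:
  assumes z: "z \<in> H10 E" "has_weak_laplacian E z f"
    and K: "AE x in \<mu>. \<bar>f x\<bar> \<le> K"
    and t: "t \<in> H10 E" "has_weak_laplacian E t (\<lambda>_. - 1)"
  shows "AE x in \<mu>. \<bar>z x\<bar> \<le> K * t x"
proof -
  note H = H10_H1[OF z(1)] H10_H1[OF t(1)]
  have *: "AE x in \<mu>. a * z x + (- K) * t x \<le> 0" if "a = 1 \<or> a = - 1" for a
  proof (rule maximum_principle[OF weak_laplacian_lincomb[OF H z(2) t(2), of a "- K"] _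
        has_trace_lincomb[OF has_trace_H10[OF z(1)] has_trace_H10[OF t(1)], of a "- K"] _ H(2) t(2)])
    show "AE x in \<mu>. 0 \<le> a * f x + (- K) * (- 1)"
      using K that by (auto elim!: eventually_mono)
  qed simp
  have "AE x in \<mu>. z x \<le> K * t x" "AE x in \<mu>. - z x \<le> K * t x"
    using *[of 1] *[of "- 1"] by simp_all
  then show ?thesis by eventually_elim auto
qed

section \<open>The projection onto affine functions\<close>

lemma P1_smooth: "q \<in> P1 \<Longrightarrow> smooth q"
proof -
  assume "q \<in> P1"
  then obtain a b where "q = (\<lambda>x. a + b \<bullet> x)" by (auto simp: P1_def)
  then show ?thesis
    by (simp only:) (intro smooth_add smooth_const smooth_bounded_linear[OF bounded_linear_inner_right])
qed

lemma P1_wgrad: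
  assumes "q \<in> P1" obtains b where "AE x in \<mu>. wgrad E q x = b"
proof -
  obtain a b where q: "q = (\<lambda>x. a + b \<bullet> x)" using assms by (auto simp: P1_def)
  have "grad q x = b" for x
    unfolding q by (rule grad_eqI) (auto intro!: derivative_eq_intros)
  then show ?thesis using that[of b] wgrad_smooth[OF P1_smooth[OF assms]] by simp
qed

lemma measure_bdry_pos: "0 < measure \<sigma> (space \<sigma>)"
proof -
  interpret B: finite_measure "\<sigma>" by (rule finite_measure_bdry)
  have n: "0 < length vs" using length_ge by linarith
  have "(\<integral>\<^sup>+x. 1 \<partial>\<sigma>) = (\<Sum>i<length vs. ennreal (norm (dir i)))"
    by (subst nn_integral_bdry) (auto intro!: sum.cong)
  moreover have "0 < (\<Sum>i<length vs. norm (dir i))"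
    using n dir_nonzero by (intro sum_pos) auto
  ultimately have "0 < emeasure \<sigma> (space \<sigma>)" by simp
  then show ?thesis by (simp add: B.emeasure_eq_measure)
qed

text \<open>\<open>Pi_nabla\<close> is a definite description, so nothing can be said about it
  before existence and uniqueness are shown. A region of positive measure lets the gradient
  condition determine the slope.\<close>

lemma Pi_nabla_P1:
  assumes v: "v \<in> H1 E" and trace: "bdry_trace vs v \<in> L2_space \<sigma>"
    and pos: "0 < measure \<mu> (space \<mu>)"
  shows "Pi_nabla vs v \<in> P1"
proof -
  let ?g = "bdry_trace vs v"
  let ?m = "measure \<mu> (space \<mu>)" and ?b = "measure \<sigma> (space \<sigma>)"
  interpret B: finite_measure \<sigma> by (rule finite_measure_bdry)
  interpret M: finite_measure \<mu> by (rule finite_measure_E)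
  let ?G = "wgrad E v"
  have Gi: "integrable \<mu> ?G" by (intro L2_imp_integrable finite_measure_E wgrad_L2 v)
  have gi: "integrable \<sigma> ?g" by (rule L2_imp_integrable[OF finite_measure_bdry trace])
  have li: "integrable \<sigma> (\<lambda>x. b \<bullet> x)" for b
    by (intro L2_imp_integrable[OF finite_measure_bdry] continuous_L2_bdry continuous_intros)
  let ?P = "\<lambda>p. p \<in> P1 \<and> (\<forall>q\<in>P1. (\<integral>x. wgrad E (\<lambda>x. v x - p x) x \<bullet> wgrad E q x \<partial>\<mu>) = 0) \<and>
    (\<integral>x. (?g x - p x) \<partial>\<sigma>) = 0"
  \<comment> \<open>For an affine candidate the two conditions decouple: affine test functions have
    constant gradients, so the slope \<open>b\<close> must be the mean gradient of \<open>v\<close>,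
    and then the boundary mean fixes \<open>a\<close>.\<close>
  have affine: "?P (\<lambda>x. a + b \<bullet> x) \<longleftrightarrow> ?m *\<^sub>R b = (\<integral>x. ?G x \<partial>\<mu>) \<and> a * ?b = (\<integral>x. ?g x \<partial>\<sigma>) - (\<integral>x. b \<bullet> x \<partial>\<sigma>)" for a b
  proof -
    have pP: "(\<lambda>x. a + b \<bullet> x) \<in> P1" by (auto simp: P1_def)
    have wg: "AE x in \<mu>. wgrad E (\<lambda>x. c + d \<bullet> x) x = d" for c d
    proof -
      have "grad (\<lambda>x. c + d \<bullet> x) x = d" for x
        by (rule grad_eqI) (auto intro!: derivative_eq_intros)
      moreover have "(\<lambda>x. c + d \<bullet> x) \<in> P1" by (auto simp: P1_def)
      ultimately show ?thesis using wgrad_smooth[OF P1_smooth] by fastforce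
    qed
    have diff: "(\<lambda>x. v x - (a + b \<bullet> x)) \<in> H1 E"
      "AE x in \<mu>. wgrad E (\<lambda>x. v x - (a + b \<bullet> x)) x = ?G x - wgrad E (\<lambda>x. a + b \<bullet> x) x"
      by (intro H1_diff v smooth_H1 P1_smooth pP)+
    have "(\<integral>x. wgrad E (\<lambda>x. v x - (a + b \<bullet> x)) x \<bullet> wgrad E (\<lambda>x. c + d \<bullet> x) x \<partial>\<mu>)
      = ((\<integral>x. ?G x \<partial>\<mu>) - ?m *\<^sub>R b) \<bullet> d" for c d
    proof -
      have qP: "(\<lambda>x. c + d \<bullet> x) \<in> P1" by (auto simp: P1_def)
      note [measurable] = L2_measurable[OF wgrad_L2[OF diff(1)]] L2_measurable[OF wgrad_L2[OF v]]
        L2_measurable[OF wgrad_L2[OF smooth_H1[OF P1_smooth[OF qP]]]]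
      have "(\<integral>x. wgrad E (\<lambda>x. v x - (a + b \<bullet> x)) x \<bullet> wgrad E (\<lambda>x. c + d \<bullet> x) x \<partial>\<mu>)
        = (\<integral>x. (?G x - b) \<bullet> d \<partial>\<mu>)"
      proof (rule integral_cong_AE)
        show "AE x in \<mu>. wgrad E (\<lambda>x. v x - (a + b \<bullet> x)) x \<bullet> wgrad E (\<lambda>x. c + d \<bullet> x) x = (?G x - b) \<bullet> d"
          using diff(2) wg[of a b] wg[of c d] by eventually_elim simp
      qed measurable
      also have "\<dots> = (\<integral>x. ?G x - b \<partial>\<mu>) \<bullet> d" using Gi by (intro integral_inner_left) simp
      also have "(\<integral>x. ?G x - b \<partial>\<mu>) = (\<integral>x. ?G x \<partial>\<mu>) - ?m *\<^sub>R b" using Gi by simp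
      finally show ?thesis .
    qed
    moreover have P1_ball: "(\<forall>q\<in>P1. Q q) \<longleftrightarrow> (\<forall>c d. Q (\<lambda>x. c + d \<bullet> x))" for Q :: "(real^2 \<Rightarrow> real) \<Rightarrow> bool"
      by (auto simp: P1_def)
    ultimately have "(\<forall>q\<in>P1. (\<integral>x. wgrad E (\<lambda>x. v x - (a + b \<bullet> x)) x \<bullet> wgrad E q x \<partial>\<mu>) = 0)
      \<longleftrightarrow> (\<forall>d. ((\<integral>x. ?G x \<partial>\<mu>) - ?m *\<^sub>R b) \<bullet> d = 0)"
      unfolding P1_ball by simp
    also have "\<dots> \<longleftrightarrow> ?m *\<^sub>R b = (\<integral>x. ?G x \<partial>\<mu>)"
      by (metis eq_iff_diff_eq_0 inner_eq_zero_iff inner_zero_left)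
    finally have grad_part: "(\<forall>q\<in>P1. (\<integral>x. wgrad E (\<lambda>x. v x - (a + b \<bullet> x)) x \<bullet> wgrad E q x \<partial>\<mu>) = 0)
      \<longleftrightarrow> ?m *\<^sub>R b = (\<integral>x. ?G x \<partial>\<mu>)" .
    have "(\<integral>x. (?g x - (a + b \<bullet> x)) \<partial>\<sigma>) = (\<integral>x. ?g x \<partial>\<sigma>) - (a * ?b + (\<integral>x. b \<bullet> x \<partial>\<sigma>))"
      using gi li[of b] by (simp add: mult.commute)
    then show ?thesis using pP grad_part by auto
  qed
  have bpos: "0 < ?b" by (rule measure_bdry_pos)
  define b where "b = (1 / ?m) *\<^sub>R (\<integral>x. ?G x \<partial>\<mu>)"
  define a where "a = ((\<integral>x. ?g x \<partial>\<sigma>) - (\<integral>x. b \<bullet> x \<partial>\<sigma>)) / ?b"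
  have "?P (\<lambda>x. a + b \<bullet> x)"
    unfolding affine
  proof
    show "?m *\<^sub>R b = (\<integral>x. ?G x \<partial>\<mu>)" using pos by (simp add: b_def)
    show "a * ?b = (\<integral>x. ?g x \<partial>\<sigma>) - (\<integral>x. b \<bullet> x \<partial>\<sigma>)" using bpos by (simp add: a_def)
  qed
  moreover have "p = (\<lambda>x. a + b \<bullet> x)" if P: "?P p" for p
  proof -
    obtain a' b' where p: "p = (\<lambda>x. a' + b' \<bullet> x)" using P by (auto simp: P1_def)
    have "?m *\<^sub>R b' = ?m *\<^sub>R b" "a' * ?b = (\<integral>x. ?g x \<partial>\<sigma>) - (\<integral>x. b' \<bullet> x \<partial>\<sigma>)"
      using P pos unfolding p affine by (simp_all add: b_def)
    then have "b' = b" "a' = a" using pos bpos by (auto simp: a_def eq_divide_eq)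
    then show ?thesis by (simp add: p)
  qed
  ultimately have "?P (Pi_nabla vs v)" unfolding Pi_nabla_def by (rule theI)
  then show ?thesis by blast
qed

text \<open>Gradients of affine functions are constant and the gradient of \<open>z\<close> has mean
  zero, so the two defining predicates coincide for every candidate and the definite descriptions
  are equal.\<close>

lemma Pi_nabla_diff_H10:
  assumes v: "v \<in> H1 E" and z: "z \<in> H10 E"
    and trace: "bdry_trace vs (\<lambda>x. v x - z x) = bdry_trace vs v"
  shows "Pi_nabla vs (\<lambda>x. v x - z x) = Pi_nabla vs v"
proof -
  have zH: "z \<in> H1 E" by (rule H10_H1[OF z])
  have "(\<integral>x. wgrad E (\<lambda>x. v x - z x - p x) x \<bullet> wgrad E q x \<partial>\<mu>)
    = (\<integral>x. wgrad E (\<lambda>x. v x - p x) x \<bullet> wgrad E q x \<partial>\<mu>)"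
    if p: "p \<in> P1" and q: "q \<in> P1" for p q
  proof -
    obtain b where b: "AE x in \<mu>. wgrad E q x = b" by (rule P1_wgrad[OF q])
    have vp: "(\<lambda>x. v x - p x) \<in> H1 E"
      by (intro H1_diff v smooth_H1 P1_smooth p)
    have eq: "(\<lambda>x. v x - z x - p x) = (\<lambda>x. 1 * (v x - p x) + (- 1) * z x)" by auto
    note lin = H1_lincomb[OF vp zH, of 1 "-1", folded eq]
    have qL: "wgrad E q \<in> L2_space \<mu>" by (intro wgrad_L2 smooth_H1 P1_smooth q)
    note [measurable] = L2_measurable[OF wgrad_L2[OF lin(1)]] L2_measurable[OF wgrad_L2[OF vp]]
      L2_measurable[OF wgrad_L2[OF zH]] L2_measurable[OF qL]
    have "(\<integral>x. wgrad E (\<lambda>x. v x - z x - p x) x \<bullet> wgrad E q x \<partial>\<mu>)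
      = (\<integral>x. wgrad E (\<lambda>x. v x - p x) x \<bullet> wgrad E q x - b \<bullet> wgrad E z x \<partial>\<mu>)"
    proof (rule integral_cong_AE)
      show "AE x in \<mu>. wgrad E (\<lambda>x. v x - z x - p x) x \<bullet> wgrad E q x
        = wgrad E (\<lambda>x. v x - p x) x \<bullet> wgrad E q x - b \<bullet> wgrad E z x"
        using lin(2) b by eventually_elim (simp add: inner_diff_left inner_diff_right inner_commute)
    qed measurable
    also have "\<dots> = (\<integral>x. wgrad E (\<lambda>x. v x - p x) x \<bullet> wgrad E q x \<partial>\<mu>) - (\<integral>x. b \<bullet> wgrad E z x \<partial>\<mu>)"
      by (intro Bochner_Integration.integral_diff L2_inner_integrable wgrad_L2 vp qL zH continuous_L2) simp
    finally show ?thesis using integral_wgrad_H10[OF z] by simp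
  qed
  then have "(p \<in> P1 \<and> (\<forall>q\<in>P1. (\<integral>x. wgrad E (\<lambda>x. v x - z x - p x) x \<bullet> wgrad E q x \<partial>\<mu>) = 0) \<and>
      (\<integral>x. (bdry_trace vs v x - p x) \<partial>\<sigma>) = 0)
    \<longleftrightarrow> (p \<in> P1 \<and> (\<forall>q\<in>P1. (\<integral>x. wgrad E (\<lambda>x. v x - p x) x \<bullet> wgrad E q x \<partial>\<mu>) = 0) \<and>
      (\<integral>x. (bdry_trace vs v x - p x) \<partial>\<sigma>) = 0)" for p
    by auto
  then show ?thesis unfolding Pi_nabla_def trace by presburger
qed

text \<open>Adding or subtracting \<open>z\<close> preserves the set of admissible traces. The
  choice operator is thus applied to identical predicates, so the chosen traces are equal as
  functions and not merely almost everywhere.\<close>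

lemma bdry_trace_diff_H10:
  assumes z: "z \<in> H10 E"
  shows "has_trace vs (\<lambda>x. v x - z x) g \<longleftrightarrow> has_trace vs v g" "bdry_trace vs (\<lambda>x. v x - z x) = bdry_trace vs v"
proof -
  have 0: "has_trace vs z (\<lambda>_. 0)" by (rule has_trace_H10[OF z])
  have *: "has_trace vs (\<lambda>x. v x - z x) g \<longleftrightarrow> has_trace vs v g" for g
  proof
    assume "has_trace vs (\<lambda>x. v x - z x) g"
    from has_trace_lincomb[OF this 0, of 1 1] show "has_trace vs v g" by simp
  next
    assume "has_trace vs v g"
    from has_trace_lincomb[OF this 0, of 1 "-1"] show "has_trace vs (\<lambda>x. v x - z x) g" by simp
  qed
  then show "has_trace vs (\<lambda>x. v x - z x) g \<longleftrightarrow> has_trace vs v g"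
    "bdry_trace vs (\<lambda>x. v x - z x) = bdry_trace vs v"
    unfolding bdry_trace_def by (simp_all add: fun_eq_iff[THEN iffD2, OF allI, OF *])
qed

end

section \<open>The maximum principle for virtual element functions\<close>

lemma Linf_norm_AE: "AE x in M. ereal \<bar>f x\<bar> \<le> Linf_norm M f"
  unfolding Linf_norm_def by (rule esssup_AE)

lemma Linf_norm_le:
  assumes "f \<in> borel_measurable M" "AE x in M. \<bar>f x\<bar> \<le> c"
  shows "Linf_norm M f \<le> ereal c"
  unfolding Linf_norm_def using assms by (intro esssup_I) auto

text \<open>On a null measure the essential supremum of a measurable function is minus infinity,
  hence the assumption.\<close>

lemma Linf_norm_nonneg:
  assumes "\<not> (AE x in M. False)" shows "0 \<le> Linf_norm M f"
proof (rule ccontr)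
  assume "\<not> 0 \<le> Linf_norm M f"
  then have "AE x in M. False"
    using Linf_norm_AE[of f M] by (auto elim!: eventually_mono simp: not_le dest: order_le_less_trans)
  with assms show False by simp
qed

lemma (in polygon_domain) virtual_element_bound:
  assumes vhat: "vhat \<in> H10 E" "has_weak_laplacian E vhat (\<lambda>_. - 1)"
    and C1: "0 < C1" "ereal C1 = Linf_norm \<mu> vhat"
    and C2: "0 < C2" "\<And>w. w \<in> W_space vs \<Longrightarrow>
      Linf_norm \<mu> (Pi_nabla vs w) \<le> ereal C2 * Linf_norm \<sigma> (bdry_trace vs w)"
    and C3: "0 < C3" "\<And>w f. w \<in> H10 E \<Longrightarrow> f \<in> P1 \<Longrightarrow> has_weak_laplacian E w f \<Longrightarrow>
      (L2_norm \<mu> f)\<^sup>2 \<le> C3 * (L2_norm \<mu> (wgrad E w))\<^sup>2"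
    and C4: "0 < C4" "\<And>q. q \<in> P1 \<Longrightarrow> Linf_norm \<mu> q
      \<le> ereal (C4 * measure lebesgue E powr (- 1 / 2) * L2_norm \<mu> q)"
    and v: "v \<in> V_space vs"
  shows "Linf_norm \<mu> v
    \<le> ereal (1 + C1 * C4 * (1 + C2) * C3) * Linf_norm \<sigma> (bdry_trace vs v)"
proof -
  let ?m = "measure lebesgue E"
  define g where "g = bdry_trace vs v"
  obtain f where vH: "v \<in> H1 E" and f: "f \<in> P1" "has_weak_laplacian E v f"
    using v unfolding V_space_def by blast
  have orth: "(\<integral>x. (v x - Pi_nabla vs v x) * q x \<partial>\<mu>) = 0" if "q \<in> P1" for q
    using v that unfolding V_space_def by blast
  obtain b where b: "b \<in> B_bdry vs" "has_trace vs v b" using v unfolding V_space_def by blast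
  have g: "has_trace vs v g" unfolding g_def bdry_trace_def using b(2) by (rule someI[of "has_trace vs v"])
  have gL2: "g \<in> L2_space \<sigma>" using g by (simp add: has_trace_def)
  have fL2: "f \<in> L2_space \<mu>" using f(2) by (simp add: has_weak_laplacian_def)
  have vhatH: "vhat \<in> H1 E" by (rule H10_H1[OF vhat(1)])

  \<comment> \<open>The projection of \<open>v\<close> in energy carries the whole Laplacian of
    \<open>v\<close>, so subtracting it leaves a harmonic function.\<close>
  obtain z where z: "z \<in> H10 E"
    "\<And>\<phi>. \<phi> \<in> test_functions E \<Longrightarrow> (\<integral>x. wgrad E z x \<bullet> grad \<phi> x \<partial>\<mu>) = (\<integral>x. wgrad E v x \<bullet> grad \<phi> x \<partial>\<mu>)"
    by (rule Dirichlet_projection[OF vH]) blast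
  have zH: "z \<in> H1 E" by (rule H10_H1[OF z(1)])
  have zlap: "has_weak_laplacian E z f"
    using f(2) z(2) unfolding has_weak_laplacian_def by simp
  define w where "w = (\<lambda>x. v x - z x)"
  have wtrace: "has_trace vs w k \<longleftrightarrow> has_trace vs v k" "bdry_trace vs w = g" for k
    unfolding w_def g_def using bdry_trace_diff_H10[OF z(1)] by auto
  have wlap: "has_weak_laplacian E w (\<lambda>_. 0)"
    using weak_laplacian_lincomb[OF vH zH f(2) zlap, of 1 "-1"] by (simp add: w_def)
  have wH: "w \<in> H1 E" unfolding w_def by (rule H1_diff(1)[OF vH zH])
  have wW: "w \<in> W_space vs" unfolding W_space_def using wH wlap b wtrace(1) by blast
  define p where "p = Pi_nabla vs w"
  have pv: "Pi_nabla vs v = p"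
    unfolding p_def w_def using Pi_nabla_diff_H10[OF vH z(1) bdry_trace_diff_H10(2)[OF z(1)]] by simp

  \<comment> \<open>On a null region -1 would be an upper bound for \<open>vhat\<close>,
    contradicting the positivity of \<open>C1\<close>.\<close>
  have nonnull: "\<not> (AE x in \<mu>. False)"
  proof
    assume "AE x in \<mu>. False"
    then have "AE x in \<mu>. \<bar>vhat x\<bar> \<le> - 1" by (rule eventually_mono) simp
    then have "Linf_norm \<mu> vhat \<le> ereal (- 1)"
      by (intro Linf_norm_le L2_measurable H1_L2 vhatH)
    then show False using C1 by (metis ereal_less_eq(3) less_eq_real_def not_less neg_le_0_iff_le zero_le_one order_trans)
  qed
  have meas: "measure \<mu> (space \<mu>) = ?m"
    by (simp add: measure_restrict_space sets_E)
  have mpos: "0 < ?m"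
  proof -
    interpret finite_measure \<mu> by (rule finite_measure_E)
    have "emeasure \<mu> (space \<mu>) \<noteq> 0"
      using nonnull AE_iff_measurable[of "space \<mu>" \<mu> "\<lambda>_. False"] by auto
    then have "measure \<mu> (space \<mu>) \<noteq> 0" by (simp add: emeasure_eq_measure)
    then show ?thesis using meas measure_nonneg[of lebesgue E] by linarith
  qed
  have pP1: "p \<in> P1"
    unfolding pv[symmetric]
    by (rule Pi_nabla_P1[OF vH]) (use gL2 mpos in \<open>simp_all only: meas g_def\<close>)
  have pL2: "p \<in> L2_space \<mu>" by (intro smooth_L2 P1_smooth pP1)
  let ?N = "Linf_norm \<sigma> g"
  have pN: "Linf_norm \<mu> p \<le> ereal C2 * ?N"
    using C2(2)[OF wW] unfolding p_def[symmetric] wtrace(2) .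
  let ?C = "1 + C1 * C4 * (1 + C2) * C3"
  have Cpos: "0 < ?C" using C1(1) C2(1) C3(1) C4(1) by (intro add_pos_nonneg) auto
  \<comment> \<open>The norm of \<open>p\<close> on the region is nonnegative because the region is
    not null; (A2) transfers this to the boundary norm.\<close>
  have "0 \<le> ereal C2 * ?N" using Linf_norm_nonneg[OF nonnull, of p] pN by (rule order_trans)
  then have N0: "0 \<le> ?N" using C2(1) by (simp add: ereal_zero_le_0_iff)
  show ?thesis
  proof (cases "?N = \<infinity>")
    case True
    then show ?thesis using Cpos by (simp add: g_def)
  next
    case False
    then obtain M where M: "?N = ereal M" "0 \<le> M" using N0 by (cases ?N) auto
    have gM: "AE x in \<sigma>. \<bar>g x\<bar> \<le> M"
      using Linf_norm_AE[of g "\<sigma>"] unfolding M(1) by simp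
    have wM: "AE x in \<mu>. \<bar>w x\<bar> \<le> M"
      by (rule harmonic_bound[OF wlap _ gM vhatH vhat(2)]) (simp add: wtrace(1) g)
    have pM: "AE x in \<mu>. \<bar>p x\<bar> \<le> C2 * M"
      using Linf_norm_AE[of p \<mu>]
    proof eventually_elim
      case (elim x)
      then have "ereal \<bar>p x\<bar> \<le> ereal C2 * ?N" using pN by (rule order_trans)
      then show ?case by (simp add: M(1))
    qed
    have zL2: "z \<in> L2_space \<mu>" and wL2: "w \<in> L2_space \<mu>" by (intro H1_L2 zH wH)+
    let ?F = "L2_norm \<mu> f" and ?G = "L2_norm \<mu> (wgrad E z)"
    have wpL2: "(\<lambda>x. w x - p x) \<in> L2_space \<mu>" by (intro L2_diff wL2 pL2)
    \<comment> \<open>The enhancement constraint with \<open>f\<close> itself as test polynomial,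
      after writing \<open>v - p\<close> as \<open>(w - p) + z\<close>.\<close>
    have "0 = (\<integral>x. (w x - p x) * f x + f x * z x \<partial>\<mu>)"
      using orth[OF f(1)] unfolding pv by (simp add: w_def algebra_simps)
    also have "\<dots> = (\<integral>x. (w x - p x) * f x \<partial>\<mu>) + (\<integral>x. f x * z x \<partial>\<mu>)"
      by (intro Bochner_Integration.integral_add L2_mult_integrable wpL2 fL2 zL2)
    finally have "- (\<integral>x. f x * z x \<partial>\<mu>) = (\<integral>x. (w x - p x) * f x \<partial>\<mu>)" by simp
    moreover have "?G\<^sup>2 = - (\<integral>x. f x * z x \<partial>\<mu>)"
      using weak_laplacian_H10[OF zH zlap z(1)] by (simp add: L2_norm_sq power2_norm_eq_inner)
    ultimately have "?G\<^sup>2 \<le> L2_norm \<mu> (\<lambda>x. w x - p x) * ?F"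
      using L2_Cauchy_Schwarz[OF wpL2 fL2] by simp
    also have "\<dots> \<le> (sqrt ?m * ((1 + C2) * M)) * ?F"
    proof (intro mult_right_mono)
      have "AE x in \<mu>. norm (w x - p x) \<le> (1 + C2) * M"
        using wM pM by eventually_elim (simp add: algebra_simps abs_le_iff)
      from L2_bounded(2)[OF finite_measure_E L2_measurable[OF wpL2] this]
      show "L2_norm \<mu> (\<lambda>x. w x - p x) \<le> sqrt ?m * ((1 + C2) * M)"
        using C2(1) M(2) unfolding meas by simp
    qed simp
    finally have "C3 * ?G\<^sup>2 \<le> C3 * ((sqrt ?m * ((1 + C2) * M)) * ?F)"
      using C3(1) by (intro mult_left_mono) auto
    \<comment> \<open>(A3) for \<open>z\<close> bounds the squared norm of \<open>f\<close> by the
      energy of \<open>z\<close>, which has just been bounded linearly in the norm of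
      \<open>f\<close>. One factor can be divided out.\<close>
    then have sq: "?F * ?F \<le> (C3 * (sqrt ?m * ((1 + C2) * M))) * ?F"
      using C3(2)[OF z(1) f(1) zlap] by (simp add: power2_eq_square mult.assoc)
    have F: "?F \<le> C3 * (sqrt ?m * ((1 + C2) * M))"
    proof (cases "?F = 0")
      case True then show ?thesis using C2(1) C3(1) M(2) by simp
    next
      case False
      then have "0 < ?F" using L2_norm_nonneg[of \<mu> f] by linarith
      then show ?thesis using sq by (simp only: mult_le_cancel_right_pos)
    qed
    define K where "K = C4 * C3 * (1 + C2) * M"
    have K0: "0 \<le> K" using C2(1) C3(1) C4(1) M(2) by (simp add: K_def)
    \<comment> \<open>The factor from integrating a bounded function over the region meets the
      normalisation in (A4), and the measure of the region cancels.\<close>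
    have root: "?m powr (- 1 / 2) * sqrt ?m = 1"
      using mpos by (simp add: powr_half_sqrt[symmetric] powr_add[symmetric])
    have "C4 * ?m powr (- 1 / 2) * ?F \<le> C4 * ?m powr (- 1 / 2) * (C3 * (sqrt ?m * ((1 + C2) * M)))"
      using F C4(1) by (intro mult_left_mono) auto
    also have "\<dots> = K * (?m powr (- 1 / 2) * sqrt ?m)" by (simp add: K_def)
    finally have FK: "C4 * ?m powr (- 1 / 2) * ?F \<le> K" unfolding root by simp
    have fK: "AE x in \<mu>. \<bar>f x\<bar> \<le> K"
      using Linf_norm_AE[of f \<mu>]
    proof eventually_elim
      case (elim x)
      then have "ereal \<bar>f x\<bar> \<le> ereal (C4 * ?m powr (- 1 / 2) * ?F)"
        using C4(2)[OF f(1)] by (rule order_trans)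
      then show ?case using FK by simp
    qed
    have zK: "AE x in \<mu>. \<bar>z x\<bar> \<le> K * vhat x"
      by (rule torsion_bound[OF z(1) zlap fK vhat])
    have vhatC: "AE x in \<mu>. \<bar>vhat x\<bar> \<le> C1"
      using Linf_norm_AE[of vhat \<mu>] unfolding C1(2)[symmetric] by simp
    have "AE x in \<mu>. \<bar>v x\<bar> \<le> ?C * M"
      using wM zK vhatC
    \<comment> \<open>The summand 1 of the constant comes from the harmonic part \<open>w\<close>;
      the product of the four constants comes from \<open>z\<close>, bounded by \<open>K\<close>
      times the torsion function.\<close>
    proof eventually_elim
      case (elim x)
      have "K * vhat x \<le> K * C1" using elim K0 by (intro mult_left_mono) auto
      moreover have "v x = w x + z x" by (simp add: w_def)
      ultimately have "\<bar>v x\<bar> \<le> M + K * C1" using elim by linarith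
      also have "M + K * C1 = ?C * M" by (simp add: K_def algebra_simps)
      finally show ?case .
    qed
    then have "Linf_norm \<mu> v \<le> ereal (?C * M)"
      by (intro Linf_norm_le L2_measurable H1_L2 vH)
    then show ?thesis using M(1) by (simp add: g_def)
  qed
qed

theorem lemma5p1:
  shows "\<exists>C::real. 0 < C \<and>
    (\<forall>(vs::polygon) (C1::real) (C2::real) (C3::real) (C4::real) (vhat::real^2 \<Rightarrow> real).
       simple_polygon vs \<longrightarrow>
       vhat \<in> H10 (region vs) \<longrightarrow>
       has_weak_laplacian (region vs) vhat (\<lambda>_. - 1) \<longrightarrow>
       0 < C1 \<longrightarrow>
       ereal C1 = Linf_norm (lebesgue_on (region vs)) vhat \<longrightarrow>
       smallest_positive (\<lambda>c. \<forall>w\<in>W_space vs.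
           Linf_norm (lebesgue_on (region vs)) (Pi_nabla vs w)
             \<le> ereal c * Linf_norm (bdry_measure vs) (bdry_trace vs w)) C2 \<longrightarrow>
       smallest_positive (\<lambda>c. \<forall>w\<in>H10 (region vs). \<forall>f\<in>P1. has_weak_laplacian (region vs) w f \<longrightarrow>
           (L2_norm (lebesgue_on (region vs)) f)\<^sup>2
             \<le> c * (L2_norm (lebesgue_on (region vs)) (wgrad (region vs) w))\<^sup>2) C3 \<longrightarrow>
       smallest_positive (\<lambda>c. \<forall>q\<in>P1.
           Linf_norm (lebesgue_on (region vs)) q
             \<le> ereal (c * measure lebesgue (region vs) powr (- 1 / 2)
                        * L2_norm (lebesgue_on (region vs)) q)) C4 \<longrightarrow>
       (\<forall>v\<in>V_space vs.
           Linf_norm (lebesgue_on (region vs)) v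
             \<le> ereal (C * (1 + C1 * C4 * (1 + C2) * C3))
                 * Linf_norm (bdry_measure vs) (bdry_trace vs v)))"
proof (intro exI[of _ "1::real"] conjI allI impI ballI)
  fix vs :: polygon and C1 C2 C3 C4 :: real and vhat v
  assume "simple_polygon vs"
  then interpret polygon_domain vs by unfold_locales
  assume "vhat \<in> H10 (region vs)" "has_weak_laplacian (region vs) vhat (\<lambda>_. - 1)"
    "0 < C1" "ereal C1 = Linf_norm (lebesgue_on (region vs)) vhat"
    "smallest_positive (\<lambda>c. \<forall>w\<in>W_space vs.
           Linf_norm (lebesgue_on (region vs)) (Pi_nabla vs w)
             \<le> ereal c * Linf_norm (bdry_measure vs) (bdry_trace vs w)) C2"
    "smallest_positive (\<lambda>c. \<forall>w\<in>H10 (region vs). \<forall>f\<in>P1. has_weak_laplacian (region vs) w f \<longrightarrow>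
           (L2_norm (lebesgue_on (region vs)) f)\<^sup>2
             \<le> c * (L2_norm (lebesgue_on (region vs)) (wgrad (region vs) w))\<^sup>2) C3"
    "smallest_positive (\<lambda>c. \<forall>q\<in>P1.
           Linf_norm (lebesgue_on (region vs)) q
             \<le> ereal (c * measure lebesgue (region vs) powr (- 1 / 2)
                        * L2_norm (lebesgue_on (region vs)) q)) C4"
    "v \<in> V_space vs"
  then show "Linf_norm (lebesgue_on (region vs)) v
    \<le> ereal (1 * (1 + C1 * C4 * (1 + C2) * C3)) * Linf_norm (bdry_measure vs) (bdry_trace vs v)"
    unfolding smallest_positive_def mult_1 by (intro virtual_element_bound[of vhat C1 C2 C3 C4 v]) auto
qed simp

end
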